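(* Let $E$ be a complex Banach lattice with order continuous norm, $u \in E_+$ and let $(e^{tA})_{t \ge 0}$ be a $C_0$-semigroup on $E$ with generator $A$. Suppose that $e^{t_0A}E \subseteq E_u$ for some $t_0 \ge 0$. Then the semigroup $(e^{tA})_{t \ge 0}$ is eventually compact. In particular, all spectral values of $A$ are poles of the resolvent $\mathcal{R}(\,\cdot\,,A)$ and have finite algebraic multiplicity. Moreover, the peripheral spectrum of $A$ is finite.
   Context: $E_+$ denotes the positive cone of the Banach lattice $E$. For $u \in E_+$ the principal ideal generated by $u$ is $E_u := \{f \in E : \exists c \ge 0,\ |f| \le cu\}$. The semigroup is eventually compact if there is $t_1 \ge 0$ such that $e^{t_1A}$ is a compact operator. For $\lambda$ in the resolvent set $\rho(A)$, $\mathcal{R}(\lambda,A) := (\lambda I - A)^{-1}$; the resolvent is an analytic map on $\rho(A)$. The spectral bound of $A$ is $\mathrm{s}(A) := \sup\{\operatorname{Re}\lambda : \lambda \in \sigma(A)\} \in [-\infty,\infty]$, and the peripheral spectrum of $A$ is $\sigma_{\mathrm{per}}(A) := \{\lambda \in \sigma(A) : \operatorname{Re}\lambda = \mathrm{s}(A)\}$. A complex Banach lattice $E$ has order continuous norm if its real part $E_{\mathbb{R}}$ has order continuous norm, i.e. every downward directed net in $E_{\mathbb{R}}$ with infimum $0$ converges to $0$ in norm. *)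

theory Defs
  imports "HOL-Analysis.Analysis" "HOL-Library.Lattice_Algebras"
begin

section \<open>Real Banach lattices\<close>

class banach_lattice = banach + ordered_real_vector + lattice_ab_group_add_abs +
  assumes norm_mono_abs: "\<bar>x\<bar> \<le> \<bar>y\<bar> \<Longrightarrow> norm x \<le> norm y"

text \<open>A downward directed set is regarded as a net indexed by itself; the image of any
  decreasing net is such a set, with the same infimum and the same norm limit.\<close>

class order_continuous_banach_lattice = banach_lattice +
  assumes order_continuous_norm:
    "\<lbrakk> D \<noteq> {};
       \<And>x y. \<lbrakk> x \<in> D; y \<in> D \<rbrakk> \<Longrightarrow> \<exists>z\<in>D. z \<le> x \<and> z \<le> y;
       \<And>x. x \<in> D \<Longrightarrow> 0 \<le> x;
       \<And>b. (\<And>x. x \<in> D \<Longrightarrow> b \<le> x) \<Longrightarrow> b \<le> 0;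
       0 < e \<rbrakk>
     \<Longrightarrow> \<exists>x\<in>D. \<forall>y\<in>D. y \<le> x \<longrightarrow> norm y < e"

lemma norm_abs_eq [simp]: "norm \<bar>x\<bar> = norm (x::'a::banach_lattice)"
  by (intro antisym norm_mono_abs) simp_all

lemma norm_mono_nonneg: "0 \<le> x \<Longrightarrow> x \<le> y \<Longrightarrow> norm x \<le> norm (y::'a::banach_lattice)"
  by (intro norm_mono_abs) (simp add: order_trans[of 0 x y])

lemma lattice_abs_leI: "x \<le> y \<Longrightarrow> - x \<le> y \<Longrightarrow> \<bar>x\<bar> \<le> (y::'a::banach_lattice)"
  by (simp add: abs_leI)

lemma abs_scaleR_le: "\<bar>r *\<^sub>R x\<bar> \<le> \<bar>r\<bar> *\<^sub>R \<bar>x::'a::banach_lattice\<bar>"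
proof -
  have *: "r *\<^sub>R x \<le> \<bar>r\<bar> *\<^sub>R \<bar>x\<bar>" for r and x :: 'a
  proof (cases "0 \<le> r")
    case True
    then show ?thesis by (simp add: scaleR_left_mono abs_ge_self)
  next
    case False
    then have "(- r) *\<^sub>R (- x) \<le> (- r) *\<^sub>R \<bar>x\<bar>"
      by (intro scaleR_left_mono) (simp_all add: abs_ge_minus_self)
    with False show ?thesis by simp
  qed
  from *[of r x] *[of "- r" x] show ?thesis
    by (intro lattice_abs_leI) simp_all
qed

lemma limit_nonneg:
  fixes X :: "nat \<Rightarrow> 'a::banach_lattice"
  assumes "X \<longlonglongrightarrow> l" "\<And>n. 0 \<le> X n"
  shows "0 \<le> l"
proof -
  have "norm (sup (- l) 0) \<le> norm (X n - l)" for n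
  proof -
    have "- l \<le> X n - l" using assms(2)[of n] by simp
    also have "\<dots> \<le> \<bar>X n - l\<bar>" by (rule abs_ge_self)
    finally have "sup (- l) 0 \<le> \<bar>X n - l\<bar>" by simp
    then have "norm (sup (- l) 0) \<le> norm \<bar>X n - l\<bar>"
      by (intro norm_mono_nonneg) simp_all
    then show ?thesis by simp
  qed
  moreover have "(\<lambda>n. norm (X n - l)) \<longlonglongrightarrow> 0"
    using assms(1) by (simp add: LIM_zero tendsto_norm_zero)
  ultimately have "norm (sup (- l) 0) \<le> 0"
    by (intro LIMSEQ_le_const[where X = "\<lambda>n. norm (X n - l)"]) auto
  then have "sup (- l) 0 = 0" by simp
  then have "- l \<le> 0" by (metis sup_ge1)
  then show ?thesis by simp
qed

lemma limit_mono:
  fixes X Y :: "nat \<Rightarrow> 'a::banach_lattice"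
  assumes "X \<longlonglongrightarrow> a" "Y \<longlonglongrightarrow> b" "\<And>n. X n \<le> Y n"
  shows "a \<le> b"
  using limit_nonneg[OF tendsto_diff[OF assms(2,1)]] assms(3) by simp


section \<open>Complex Banach spaces\<close>

class complex_normed_vector = real_normed_vector +
  fixes scaleC :: "complex \<Rightarrow> 'a \<Rightarrow> 'a"  (infixr \<open>*\<^sub>C\<close> 75)
  assumes scaleC_add_right: "a *\<^sub>C (x + y) = a *\<^sub>C x + a *\<^sub>C y"
    and scaleC_add_left: "(a + b) *\<^sub>C x = a *\<^sub>C x + b *\<^sub>C x"
    and scaleC_scaleC: "a *\<^sub>C b *\<^sub>C x = (a * b) *\<^sub>C x"
    and scaleC_of_real: "of_real r *\<^sub>C x = r *\<^sub>R x"
    and norm_scaleC: "norm (a *\<^sub>C x) = cmod a * norm x"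

class complex_banach = complex_normed_vector + banach

lemma vector_space_scaleC:
  "vector_space (scaleC :: complex \<Rightarrow> 'a::complex_normed_vector \<Rightarrow> 'a)"
proof
  show "1 *\<^sub>C x = x" for x :: 'a
    using scaleC_of_real[of 1 x] by simp
qed (simp_all add: scaleC_add_left scaleC_add_right scaleC_scaleC)


section \<open>Complex Banach lattices\<close>

text \<open>A complex Banach lattice is the complexification of a real Banach lattice \<open>'a\<close>,
  its real part.\<close>

datatype 'a complexification = Complexify (rpart: 'a) (ipart: 'a)

lemma complexification_eq_iff: "z = w \<longleftrightarrow> rpart z = rpart w \<and> ipart z = ipart w"
  by (cases z; cases w) simp

text \<open>The modulus is the supremum, in the real part, of the elements
  \<open>Re (exp (- \<i> \<theta>) z)\<close>.\<close>

definition modulus :: "'a::banach_lattice complexification \<Rightarrow> 'a" where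
  "modulus z = (LEAST b. \<forall>\<theta>. cos \<theta> *\<^sub>R rpart z + sin \<theta> *\<^sub>R ipart z \<le> b)"

lemma modulus_exists:
  fixes x y :: "'a::banach_lattice"
  shows "\<exists>s. (\<forall>\<theta>. cos \<theta> *\<^sub>R x + sin \<theta> *\<^sub>R y \<le> s) \<and>
             (\<forall>b. (\<forall>\<theta>. cos \<theta> *\<^sub>R x + sin \<theta> *\<^sub>R y \<le> b) \<longrightarrow> s \<le> b)"
proof -
  define f where "f \<theta> = cos \<theta> *\<^sub>R x + sin \<theta> *\<^sub>R y" for \<theta>
  define u where "u = \<bar>x\<bar> + \<bar>y\<bar>"
  have u0: "0 \<le> u" by (simp add: u_def)
  have lip: "f a \<le> f b + \<bar>a - b\<bar> *\<^sub>R u" for a b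
  proof -
    have c: "\<bar>cos a - cos b\<bar> \<le> \<bar>a - b\<bar>"
      using abs_sin_x_le_abs_x[of "(b - a)/2"] abs_sin_le_one[of "(a + b)/2"]
        mult_mono[of "\<bar>sin ((a + b)/2)\<bar>" 1 "\<bar>sin ((b - a)/2)\<bar>" "\<bar>(b - a)/2\<bar>"]
      by (simp add: cos_diff_cos abs_mult)
    have s: "\<bar>sin a - sin b\<bar> \<le> \<bar>a - b\<bar>"
      using abs_sin_x_le_abs_x[of "(a - b)/2"] abs_cos_le_one[of "(a + b)/2"]
        mult_mono[of "\<bar>sin ((a - b)/2)\<bar>" "\<bar>(a - b)/2\<bar>" "\<bar>cos ((a + b)/2)\<bar>" 1]
      by (simp add: sin_diff_sin abs_mult)
    have "f a - f b = (cos a - cos b) *\<^sub>R x + (sin a - sin b) *\<^sub>R y"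
      by (simp add: f_def algebra_simps)
    also have "\<dots> \<le> \<bar>(cos a - cos b) *\<^sub>R x\<bar> + \<bar>(sin a - sin b) *\<^sub>R y\<bar>"
      by (intro add_mono abs_ge_self)
    also have "\<dots> \<le> \<bar>cos a - cos b\<bar> *\<^sub>R \<bar>x\<bar> + \<bar>sin a - sin b\<bar> *\<^sub>R \<bar>y\<bar>"
      by (intro add_mono abs_scaleR_le)
    also have "\<dots> \<le> \<bar>a - b\<bar> *\<^sub>R \<bar>x\<bar> + \<bar>a - b\<bar> *\<^sub>R \<bar>y\<bar>"
      using c s by (intro add_mono scaleR_right_mono) simp_all
    also have "\<dots> = \<bar>a - b\<bar> *\<^sub>R u" by (simp add: u_def scaleR_add_right)
    finally show ?thesis by (simp add: algebra_simps)
  qed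
  define G where "G n = (\<lambda>k. f (real k / real (Suc n))) ` {..7 * Suc n}" for n
  define s where "s n = Sup_fin (G n)" for n
  have G: "finite (G n)" "G n \<noteq> {}" for n by (auto simp: G_def)
  have up: "f \<theta> \<le> s n + (1 / real (Suc n)) *\<^sub>R u" for \<theta> n
  proof -
    obtain t where t: "0 \<le> t" "t < 2 * pi" "cos \<theta> = cos t" "sin \<theta> = sin t"
      using sincos_total_2pi[of "cos \<theta>" "sin \<theta>"] sin_cos_squared_add2[of \<theta>] by metis
    define k where "k = nat \<lfloor>t * real (Suc n)\<rfloor>"
    have k: "real k \<le> t * real (Suc n)" "t * real (Suc n) < real k + 1"
      using t(1) unfolding k_def by (simp_all add: of_nat_nat del: of_nat_Suc)
    have "t < 7" using t(2) pi_less_4 pi_approx by simp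
    then have "t * real (Suc n) \<le> 7 * real (Suc n)"
      by (intro mult_right_mono) simp_all
    with k(1) have "real k \<le> real (7 * Suc n)" by simp
    then have "k \<le> 7 * Suc n" by (simp only: of_nat_le_iff)
    then have "f (real k / real (Suc n)) \<in> G n" by (auto simp: G_def)
    then have 1: "f (real k / real (Suc n)) \<le> s n"
      unfolding s_def using G by (intro Sup_fin.coboundedI) auto
    have "\<bar>t - real k / real (Suc n)\<bar> \<le> 1 / real (Suc n)"
    proof -
      have "real k / real (Suc n) \<le> t"
        using k(1) by (simp add: pos_divide_le_eq del: of_nat_Suc)
      moreover have "t < (real k + 1) / real (Suc n)"
        using k(2) by (simp add: pos_less_divide_eq del: of_nat_Suc)
      ultimately show ?thesis by (simp add: add_divide_distrib del: of_nat_Suc)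
    qed
    then have 2: "\<bar>t - real k / real (Suc n)\<bar> *\<^sub>R u \<le> (1 / real (Suc n)) *\<^sub>R u"
      using u0 by (rule scaleR_right_mono)
    have "f \<theta> = f t" using t by (simp add: f_def)
    also have "\<dots> \<le> f (real k / real (Suc n)) + \<bar>t - real k / real (Suc n)\<bar> *\<^sub>R u"
      by (rule lip)
    also have "\<dots> \<le> s n + (1 / real (Suc n)) *\<^sub>R u"
      using 1 2 by (rule add_mono)
    finally show ?thesis .
  qed
  have least: "s n \<le> b" if "\<And>\<theta>. f \<theta> \<le> b" for n b
    unfolding s_def using G that by (intro Sup_fin.boundedI) (auto simp: G_def)
  have ss: "s m \<le> s n + (1 / real (Suc n)) *\<^sub>R u" for m n
    by (intro least up)
  have est: "norm (s m - s n) \<le> (1 / real (Suc n)) * norm u" if "n \<le> m" for m n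
  proof -
    have "(1 / real (Suc m)) *\<^sub>R u \<le> (1 / real (Suc n)) *\<^sub>R u"
      using that u0 by (intro scaleR_right_mono) (simp_all add: frac_le)
    with ss[of n m] have "s n \<le> s m + (1 / real (Suc n)) *\<^sub>R u"
      by (meson add_left_mono order_trans)
    with ss[of m n] have "\<bar>s m - s n\<bar> \<le> (1 / real (Suc n)) *\<^sub>R u"
      by (intro lattice_abs_leI) (simp_all add: algebra_simps)
    then have "norm \<bar>s m - s n\<bar> \<le> norm ((1 / real (Suc n)) *\<^sub>R u)"
      by (intro norm_mono_nonneg) simp_all
    then show ?thesis by simp
  qed
  have null: "(\<lambda>n. 1 / real (Suc n)) \<longlonglongrightarrow> 0"
    using LIMSEQ_inverse_real_of_nat by (simp add: inverse_eq_divide)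
  have "Cauchy s"
  proof (rule CauchyI')
    fix e :: real assume "0 < e"
    have "(\<lambda>n. (1 / real (Suc n)) * norm u) \<longlonglongrightarrow> 0 * norm u"
      by (intro tendsto_mult null tendsto_const)
    then have "\<forall>\<^sub>F n in sequentially. (1 / real (Suc n)) * norm u < e"
      using \<open>0 < e\<close> by (intro order_tendstoD(2)) simp_all
    then obtain N where N: "\<And>n. N \<le> n \<Longrightarrow> (1 / real (Suc n)) * norm u < e"
      unfolding eventually_sequentially by blast
    have "norm (s m - s n) < e" if "N \<le> m" "m < n" for m n
      using est[of m n] N[of m] that by (simp add: norm_minus_commute)
    then show "\<exists>M. \<forall>m\<ge>M. \<forall>n>m. dist (s m) (s n) < e" unfolding dist_norm by blast
  qed
  then obtain l where l: "s \<longlonglongrightarrow> l" using Cauchy_convergent_iff convergent_def by blast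
  have "(\<lambda>n. s n + (1 / real (Suc n)) *\<^sub>R u) \<longlonglongrightarrow> l + 0 *\<^sub>R u"
    by (intro tendsto_intros l null)
  then have "f \<theta> \<le> l" for \<theta>
    using limit_mono[OF tendsto_const _ up[of \<theta>]] by simp
  moreover have "l \<le> b" if "\<And>\<theta>. f \<theta> \<le> b" for b
    using limit_mono[OF l tendsto_const least[OF that]] by simp
  ultimately show ?thesis unfolding f_def by blast
qed

lemma modulus_upper: "cos \<theta> *\<^sub>R rpart z + sin \<theta> *\<^sub>R ipart z \<le> modulus z"
  and modulus_least:
    "(\<And>\<theta>. cos \<theta> *\<^sub>R rpart z + sin \<theta> *\<^sub>R ipart z \<le> b) \<Longrightarrow> modulus z \<le> b"
proof -
  obtain s where s: "\<forall>\<theta>. cos \<theta> *\<^sub>R rpart z + sin \<theta> *\<^sub>R ipart z \<le> s"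
    "\<And>b. \<forall>\<theta>. cos \<theta> *\<^sub>R rpart z + sin \<theta> *\<^sub>R ipart z \<le> b \<Longrightarrow> s \<le> b"
    using modulus_exists[of "rpart z" "ipart z"] by blast
  then have "modulus z = s"
    unfolding modulus_def by (intro Least_equality) blast+
  with s show "cos \<theta> *\<^sub>R rpart z + sin \<theta> *\<^sub>R ipart z \<le> modulus z"
    and "(\<And>\<theta>. cos \<theta> *\<^sub>R rpart z + sin \<theta> *\<^sub>R ipart z \<le> b) \<Longrightarrow> modulus z \<le> b"
    by blast+
qed

lemma abs_rpart_le_modulus: "\<bar>rpart z\<bar> \<le> modulus z"
  using modulus_upper[of 0 z] modulus_upper[of pi z] by (intro lattice_abs_leI) simp_all

lemma abs_ipart_le_modulus: "\<bar>ipart z\<bar> \<le> modulus z"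
  using modulus_upper[of "pi/2" z] modulus_upper[of "- (pi/2)" z]
  by (intro lattice_abs_leI) simp_all

lemma modulus_nonneg: "0 \<le> modulus z"
  using abs_rpart_le_modulus[of z] abs_ge_zero order_trans by blast

lemma modulus_le_parts: "modulus z \<le> \<bar>rpart z\<bar> + \<bar>ipart z\<bar>"
proof (rule modulus_least)
  fix \<theta>
  have *: "r *\<^sub>R x \<le> \<bar>x\<bar>" if "\<bar>r\<bar> \<le> 1" for r and x :: 'a
  proof -
    have "r *\<^sub>R x \<le> \<bar>r *\<^sub>R x\<bar>" by (rule abs_ge_self)
    also have "\<dots> \<le> \<bar>r\<bar> *\<^sub>R \<bar>x\<bar>" by (rule abs_scaleR_le)
    also have "\<dots> \<le> 1 *\<^sub>R \<bar>x\<bar>" using that by (intro scaleR_right_mono) simp_all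
    finally show ?thesis by simp
  qed
  show "cos \<theta> *\<^sub>R rpart z + sin \<theta> *\<^sub>R ipart z \<le> \<bar>rpart z\<bar> + \<bar>ipart z\<bar>"
    by (intro add_mono *) simp_all
qed

instantiation complexification :: (banach_lattice) complex_normed_vector
begin

definition zero_complexification :: "'a complexification" where
  "0 = Complexify 0 0"

definition plus_complexification ::
    "'a complexification \<Rightarrow> 'a complexification \<Rightarrow> 'a complexification" where
  "z + w = Complexify (rpart z + rpart w) (ipart z + ipart w)"

definition uminus_complexification :: "'a complexification \<Rightarrow> 'a complexification" where
  "- z = Complexify (- rpart z) (- ipart z)"

definition minus_complexification ::
    "'a complexification \<Rightarrow> 'a complexification \<Rightarrow> 'a complexification" where
  "z - w = Complexify (rpart z - rpart w) (ipart z - ipart w)"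

definition scaleR_complexification ::
    "real \<Rightarrow> 'a complexification \<Rightarrow> 'a complexification" where
  "r *\<^sub>R z = Complexify (r *\<^sub>R rpart z) (r *\<^sub>R ipart z)"

definition scaleC_complexification ::
    "complex \<Rightarrow> 'a complexification \<Rightarrow> 'a complexification" where
  "c *\<^sub>C z = Complexify (Re c *\<^sub>R rpart z - Im c *\<^sub>R ipart z)
                      (Re c *\<^sub>R ipart z + Im c *\<^sub>R rpart z)"

definition norm_complexification :: "'a complexification \<Rightarrow> real" where
  "norm z = norm (modulus z)"

definition dist_complexification ::
    "'a complexification \<Rightarrow> 'a complexification \<Rightarrow> real" where
  "dist_complexification z w = norm (z - w)"

definition sgn_complexification :: "'a complexification \<Rightarrow> 'a complexification" where
  "sgn_complexification z = scaleR (inverse (norm z)) z"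

definition uniformity_complexification ::
    "('a complexification \<times> 'a complexification) filter" where
  "uniformity_complexification = (INF e\<in>{0 <..}. principal {(z, w). dist z w < e})"

definition open_complexification :: "'a complexification set \<Rightarrow> bool" where
  "open_complexification U \<longleftrightarrow> (\<forall>z\<in>U. eventually (\<lambda>(z', w). z' = z \<longrightarrow> w \<in> U) uniformity)"

lemma parts_simps:
  "rpart (0::'a complexification) = 0" "ipart (0::'a complexification) = 0"
  "rpart (z + w) = rpart z + rpart w" "ipart (z + w) = ipart z + ipart w"
  "rpart (- z) = - rpart z" "ipart (- z) = - ipart z"
  "rpart (z - w) = rpart z - rpart w" "ipart (z - w) = ipart z - ipart w"
  "rpart (r *\<^sub>R z) = r *\<^sub>R rpart z" "ipart (r *\<^sub>R z) = r *\<^sub>R ipart z"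
  "rpart (c *\<^sub>C z) = Re c *\<^sub>R rpart z - Im c *\<^sub>R ipart z"
  "ipart (c *\<^sub>C z) = Re c *\<^sub>R ipart z + Im c *\<^sub>R rpart z"
  for z w :: "'a complexification"
  by (simp_all add: zero_complexification_def plus_complexification_def
      uminus_complexification_def minus_complexification_def
      scaleR_complexification_def scaleC_complexification_def)

lemma modulus_triangle: "modulus (z + w) \<le> modulus z + modulus w"
  for z w :: "'a complexification"
proof (rule modulus_least)
  fix \<theta>
  show "cos \<theta> *\<^sub>R rpart (z + w) + sin \<theta> *\<^sub>R ipart (z + w) \<le> modulus z + modulus w"
    using add_mono[OF modulus_upper[of \<theta> z] modulus_upper[of \<theta> w]]
    by (simp add: parts_simps algebra_simps)
qed

lemma modulus_scaleC_le: "modulus (c *\<^sub>C z) \<le> cmod c *\<^sub>R modulus z"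
  for z :: "'a complexification"
proof (rule modulus_least)
  fix \<theta>
  obtain r a where c: "c = rcis r a" and r: "r = cmod c"
    using rcis_cmod_Arg[of c] by metis
  have "cos \<theta> *\<^sub>R rpart (c *\<^sub>C z) + sin \<theta> *\<^sub>R ipart (c *\<^sub>C z)
      = r *\<^sub>R (cos (\<theta> - a) *\<^sub>R rpart z + sin (\<theta> - a) *\<^sub>R ipart z)"
    by (simp add: c parts_simps cos_diff sin_diff algebra_simps)
  also have "\<dots> \<le> r *\<^sub>R modulus z"
    using r by (intro scaleR_left_mono modulus_upper) simp_all
  finally show "cos \<theta> *\<^sub>R rpart (c *\<^sub>C z) + sin \<theta> *\<^sub>R ipart (c *\<^sub>C z) \<le> cmod c *\<^sub>R modulus z"
    using r by simp
qed

lemma modulus_eq_0: "modulus z = 0 \<longleftrightarrow> z = 0" for z :: "'a complexification"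
proof
  assume "modulus z = 0"
  with abs_rpart_le_modulus[of z] abs_ipart_le_modulus[of z]
  have "\<bar>rpart z\<bar> \<le> 0" "\<bar>ipart z\<bar> \<le> 0" by simp_all
  then show "z = 0" by (simp add: complexification_eq_iff parts_simps)
next
  assume "z = 0"
  then show "modulus z = 0"
    using modulus_le_parts[of z] modulus_nonneg[of z]
    by (intro antisym) (simp_all add: parts_simps)
qed

lemma norm_scaleC_complexification: "norm (c *\<^sub>C z) = cmod c * norm z"
  for z :: "'a complexification"
proof -
  have le: "norm (c *\<^sub>C z) \<le> cmod c * norm z" for c and z :: "'a complexification"
    using norm_mono_nonneg[OF modulus_nonneg modulus_scaleC_le[of c z]]
    by (simp add: norm_complexification_def)
  show ?thesis
  proof (cases "c = 0")
    case True
    have "0 \<le> norm (c *\<^sub>C z)" by (simp add: norm_complexification_def)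
    with True le[of c z] show ?thesis by simp
  next
    case False
    have assoc: "a *\<^sub>C b *\<^sub>C z = (a * b) *\<^sub>C z" for a b
      by (simp add: complexification_eq_iff parts_simps algebra_simps)
    have "inverse c *\<^sub>C c *\<^sub>C z = (inverse c * c) *\<^sub>C z" by (rule assoc)
    also have "\<dots> = z" using False by (simp add: complexification_eq_iff parts_simps)
    finally have "norm z \<le> cmod (inverse c) * norm (c *\<^sub>C z)"
      using le[of "inverse c" "c *\<^sub>C z"] by simp
    then have "cmod c * norm z \<le> cmod c * (inverse (cmod c) * norm (c *\<^sub>C z))"
      by (intro mult_left_mono) (simp_all only: norm_inverse norm_ge_zero)
    with False have "cmod c * norm z \<le> norm (c *\<^sub>C z)"
      by (simp flip: mult.assoc)
    with le[of c z] show ?thesis by simp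
  qed
qed

instance
proof
  fix z w v :: "'a complexification" and r s :: real and a b :: complex
  show "z + w + v = z + (w + v)" "z + w = w + z" "0 + z = z" "- z + z = 0" "z - w = z + - w"
    "r *\<^sub>R (z + w) = r *\<^sub>R z + r *\<^sub>R w" "(r + s) *\<^sub>R z = r *\<^sub>R z + s *\<^sub>R z"
    "r *\<^sub>R s *\<^sub>R z = (r * s) *\<^sub>R z" "1 *\<^sub>R z = z"
    "a *\<^sub>C (z + w) = a *\<^sub>C z + a *\<^sub>C w" "(a + b) *\<^sub>C z = a *\<^sub>C z + b *\<^sub>C z"
    "a *\<^sub>C b *\<^sub>C z = (a * b) *\<^sub>C z"
    by (simp_all add: complexification_eq_iff parts_simps algebra_simps)
  show of_real: "of_real r *\<^sub>C z = r *\<^sub>R z" for r and z :: "'a complexification"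
    by (simp add: complexification_eq_iff parts_simps)
  show "norm (a *\<^sub>C z) = cmod a * norm z"
    by (rule norm_scaleC_complexification)
  show "norm (r *\<^sub>R z) = \<bar>r\<bar> * norm z"
    using norm_scaleC_complexification[of "of_real r" z] by (simp add: of_real)
  show "norm z = 0 \<longleftrightarrow> z = 0"
    by (simp add: norm_complexification_def modulus_eq_0)
  show "norm (z + w) \<le> norm z + norm w"
    unfolding norm_complexification_def
    using norm_mono_nonneg[OF modulus_nonneg modulus_triangle[of z w]]
      norm_triangle_ineq[of "modulus z" "modulus w"] by linarith
  show "dist z w = norm (z - w)" "sgn z = inverse (norm z) *\<^sub>R z"
    by (rule dist_complexification_def sgn_complexification_def)+
  show "(uniformity :: ('a complexification \<times> 'a complexification) filter) =
      (INF e\<in>{0 <..}. principal {(z, w). dist z w < e})"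
    by (rule uniformity_complexification_def)
  show "open U \<longleftrightarrow> (\<forall>z\<in>U. eventually (\<lambda>(z', w). z' = z \<longrightarrow> w \<in> U) uniformity)"
    for U :: "'a complexification set"
    by (rule open_complexification_def)
qed

end

lemma norm_rpart_le: "norm (rpart z) \<le> norm z"
  using norm_mono_nonneg[OF abs_ge_zero abs_rpart_le_modulus[of z]]
  by (simp add: norm_complexification_def)

lemma norm_ipart_le: "norm (ipart z) \<le> norm z"
  using norm_mono_nonneg[OF abs_ge_zero abs_ipart_le_modulus[of z]]
  by (simp add: norm_complexification_def)

lemma norm_le_parts: "norm z \<le> norm (rpart z) + norm (ipart z)"
proof -
  have "norm z \<le> norm (\<bar>rpart z\<bar> + \<bar>ipart z\<bar>)"
    using norm_mono_nonneg[OF modulus_nonneg modulus_le_parts[of z]]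
    by (simp add: norm_complexification_def)
  also have "\<dots> \<le> norm (rpart z) + norm (ipart z)"
    using norm_triangle_ineq[of "\<bar>rpart z\<bar>" "\<bar>ipart z\<bar>"] by simp
  finally show ?thesis .
qed

instance complexification :: (banach_lattice) complex_banach
proof
  fix X :: "nat \<Rightarrow> 'a complexification"
  assume X: "Cauchy X"
  have "Cauchy (\<lambda>n. g (X n))"
    if g: "\<And>z. norm (g z) \<le> norm z" "\<And>z w. g (z - w) = g z - g w"
    for g :: "'a complexification \<Rightarrow> 'a"
  proof (rule CauchyI)
    fix e :: real assume "0 < e"
    then obtain M where M: "\<And>m n. M \<le> m \<Longrightarrow> M \<le> n \<Longrightarrow> norm (X m - X n) < e"
      using CauchyD[OF X] by blast
    have "norm (g (X m) - g (X n)) < e" if "M \<le> m" "M \<le> n" for m n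
      using g(1)[of "X m - X n"] M[OF that] by (simp add: g(2))
    then show "\<exists>M. \<forall>m\<ge>M. \<forall>n\<ge>M. norm (g (X m) - g (X n)) < e" by blast
  qed
  from this[OF norm_rpart_le] this[OF norm_ipart_le]
  have "Cauchy (\<lambda>n. rpart (X n))" "Cauchy (\<lambda>n. ipart (X n))"
    by (simp_all add: parts_simps)
  then obtain a b where a: "(\<lambda>n. rpart (X n)) \<longlonglongrightarrow> a" and b: "(\<lambda>n. ipart (X n)) \<longlonglongrightarrow> b"
    unfolding Cauchy_convergent_iff convergent_def by blast
  have "(\<lambda>n. norm (rpart (X n) - a) + norm (ipart (X n) - b)) \<longlonglongrightarrow> 0"
    using tendsto_add[OF tendsto_norm_zero[OF LIM_zero[OF a]] tendsto_norm_zero[OF LIM_zero[OF b]]]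
    by simp
  moreover have "norm (X n - Complexify a b) \<le> norm (rpart (X n) - a) + norm (ipart (X n) - b)" for n
    using norm_le_parts[of "X n - Complexify a b"] by (simp add: parts_simps)
  ultimately have "(\<lambda>n. X n - Complexify a b) \<longlonglongrightarrow> 0"
    by (rule Lim_null_comparison[OF always_eventually[OF allI], rotated])
  then show "convergent X"
    by (rule convergentI[OF LIM_zero_cancel])
qed

text \<open>The positive cone of the complex lattice is that of its real part, so the generator
  \<open>u\<close> of a principal ideal is taken from \<open>'a\<close>.\<close>

definition principal_ideal :: "'a::banach_lattice \<Rightarrow> 'a complexification set" where
  "principal_ideal u = {f. \<exists>c\<ge>0. modulus f \<le> c *\<^sub>R u}"


section \<open>Bounded and unbounded linear operators\<close>

definition bounded_clinear ::
    "('a::complex_normed_vector \<Rightarrow> 'b::complex_normed_vector) \<Rightarrow> bool" where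
  "bounded_clinear f \<longleftrightarrow> Vector_Spaces.linear scaleC scaleC f \<and> bounded_linear f"

definition compact_operator ::
    "('a::complex_normed_vector \<Rightarrow> 'b::complex_normed_vector) \<Rightarrow> bool" where
  "compact_operator f \<longleftrightarrow> bounded_clinear f \<and> compact (closure (f ` cball 0 1))"

text \<open>An unbounded operator is a partial function \<open>A\<close> with domain \<^term>\<open>dom A\<close>.\<close>

type_synonym 'a operator = "'a \<rightharpoonup> 'a"

definition resolvent :: "'a::complex_normed_vector operator \<Rightarrow> complex \<Rightarrow> 'a \<Rightarrow> 'a" where
  "resolvent A z = inv_into (dom A) (\<lambda>x. z *\<^sub>C x - the (A x))"

definition resolvent_set :: "'a::complex_normed_vector operator \<Rightarrow> complex set" where
  "resolvent_set A = {z. bij_betw (\<lambda>x. z *\<^sub>C x - the (A x)) (dom A) UNIV \<and>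
                         bounded_clinear (resolvent A z)}"

definition spectrum :: "'a::complex_normed_vector operator \<Rightarrow> complex set" where
  "spectrum A = - resolvent_set A"

definition spectral_bound :: "'a::complex_normed_vector operator \<Rightarrow> ereal" where
  "spectral_bound A = (SUP z\<in>spectrum A. ereal (Re z))"

definition peripheral_spectrum :: "'a::complex_normed_vector operator \<Rightarrow> complex set" where
  "peripheral_spectrum A = {z \<in> spectrum A. ereal (Re z) = spectral_bound A}"

text \<open>\<open>z\<^sub>0\<close> is a pole of order \<open>n\<close> if on a punctured disc the resolvent has a Laurent expansion,
  converging in operator norm, with leading term \<open>(z - z\<^sub>0)\<^sup>-\<^sup>n U\<^sub>0\<close> and \<open>U\<^sub>0 \<noteq> 0\<close>.
  The library notion \<open>is_pole\<close> (the norm tends to infinity) would not do: the norm of a resolvent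
  tends to infinity at every isolated spectral value, essential singularities included.\<close>

definition resolvent_pole_of_order ::
    "nat \<Rightarrow> 'a::complex_normed_vector operator \<Rightarrow> complex \<Rightarrow> bool" where
  "resolvent_pole_of_order n A z0 \<longleftrightarrow> 0 < n \<and>
     (\<exists>r>0. \<exists>U :: nat \<Rightarrow> 'a \<Rightarrow> 'a.
        (\<forall>k. bounded_clinear (U k)) \<and> U 0 \<noteq> (\<lambda>x. 0) \<and>
        (\<forall>z\<in>ball z0 r - {z0}. z \<in> resolvent_set A \<and>
           (\<lambda>N. onorm (\<lambda>x. resolvent A z x -
              (\<Sum>k<N. ((z - z0) powi (int k - int n)) *\<^sub>C U k x))) \<longlonglongrightarrow> 0))"

definition resolvent_pole :: "'a::complex_normed_vector operator \<Rightarrow> complex \<Rightarrow> bool" where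
  "resolvent_pole A z0 \<longleftrightarrow> (\<exists>n. resolvent_pole_of_order n A z0)"

text \<open>For an isolated point \<open>z\<^sub>0\<close> of the spectrum: \<open>(1 / 2\<pi>\<i>) \<oint> R(z, A) x dz\<close> over a circle around
  \<open>z\<^sub>0\<close> that neither meets nor encloses the rest of the spectrum, parametrised by
  \<open>z = z\<^sub>0 + r exp (\<i> \<theta>)\<close>. It does not depend on the radius.\<close>

definition spectral_projection ::
    "'a::complex_banach operator \<Rightarrow> complex \<Rightarrow> 'a \<Rightarrow> 'a" where
  "spectral_projection A z0 x =
     (let r = (SOME r. 0 < r \<and> cball z0 r - {z0} \<subseteq> resolvent_set A)
      in integral {0..2 * pi}
           (\<lambda>\<theta>. (rcis r \<theta> / of_real (2 * pi)) *\<^sub>C resolvent A (z0 + rcis r \<theta>) x))"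

definition cdimension :: "'a::complex_normed_vector set \<Rightarrow> enat" where
  "cdimension V = (if \<exists>B. finite B \<and> V \<subseteq> module.span scaleC B
                   then enat (vector_space.dim scaleC V) else \<infinity>)"

text \<open>Only meaningful at isolated points of the spectrum.\<close>

definition algebraic_multiplicity :: "'a::complex_banach operator \<Rightarrow> complex \<Rightarrow> enat" where
  "algebraic_multiplicity A z0 = cdimension (range (spectral_projection A z0))"


section \<open>Strongly continuous semigroups\<close>

text \<open>A semigroup is a family indexed by all of \<^typ>\<open>real\<close>, of which only the values at
  nonnegative times matter.\<close>

definition C0_semigroup :: "(real \<Rightarrow> 'a::complex_banach \<Rightarrow> 'a) \<Rightarrow> bool" where
  "C0_semigroup T \<longleftrightarrow>
     (\<forall>t\<ge>0. bounded_clinear (T t)) \<and>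
     T 0 = id \<and>
     (\<forall>s\<ge>0. \<forall>t\<ge>0. T (s + t) = T s \<circ> T t) \<and>
     (\<forall>x. ((\<lambda>t. T t x) \<longlongrightarrow> x) (at_right 0))"

definition generator :: "(real \<Rightarrow> 'a::complex_banach \<Rightarrow> 'a) \<Rightarrow> 'a operator" where
  "generator T x =
     (if \<exists>y. ((\<lambda>h. (T h x - x) /\<^sub>R h) \<longlongrightarrow> y) (at_right 0)
      then Some (Lim (at_right 0) (\<lambda>h. (T h x - x) /\<^sub>R h)) else None)"

definition eventually_compact :: "(real \<Rightarrow> 'a::complex_banach \<Rightarrow> 'a) \<Rightarrow> bool" where
  "eventually_compact T \<longleftrightarrow> (\<exists>t\<ge>0. compact_operator (T t))"

end

theory Submission
  imports Defs
begin

text \<open>The semigroup operator \<open>F = T t\<^sub>0\<close> maps the whole space into the principal ideal of \<open>u\<close>, and the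
core of the argument is that \<open>F \<circ> F = T (2 t\<^sub>0)\<close> is then compact. By Baire's theorem
\<open>\<bar>F x\<bar> \<le> C \<parallel>x\<parallel> u\<close>, so the unit ball is mapped into an order interval \<open>[-c u, c u]\<close>, and
it remains to see that \<open>F\<close> maps order intervals to relatively compact sets. In the usual
language this is the Dunford-Pettis property of \<open>C(K)\<close> together with the weak compactness of
order intervals. The proof below replaces both by a Hilbert space argument of Banach-Saks type,
in four steps.

\<^item> Order continuity of the norm yields positive functionals \<open>f\<close> that control the norm on an order
  interval: for each \<open>\<epsilon>\<close> there are \<open>f\<close> and \<open>\<delta>\<close> such that \<open>f x < \<delta>\<close> implies \<open>\<parallel>x\<parallel> < \<epsilon>\<close> there
  (\<open>control_functional\<close>; the functionals come from the Hahn-Banach theorem).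
\<^item> The expression \<open>f (x\<^sup>2 / u)\<close>, where \<open>x\<^sup>2 / u\<close> is the supremum of \<open>2 a x - a\<^sup>2 u\<close> over all real
  \<open>a\<close>, satisfies the parallelogram law, so \<open>f\<close> gives the ideal of \<open>u\<close> a pre-Hilbert structure in
  which order intervals are bounded.
\<^item> If \<open>F [-u, u]\<close> were not totally bounded, there would be \<open>y\<^sub>n\<close> in \<open>[-u, u]\<close> with separated images.
  Among the differences \<open>y\<^sub>m - y\<^sub>n\<close> one finds \<open>d\<^sub>1, \<dots>, d\<^sub>N\<close> that are almost orthogonal. Then
  all signed averages \<open>N\<^sup>-\<^sup>1 (\<plusminus>d\<^sub>1 \<plusminus> \<dots> \<plusminus> d\<^sub>N)\<close> are small in the Hilbert norm, hence in the norm of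
  the lattice by the first step.
\<^item> Applying \<open>F\<close> and taking the supremum over the signs, the average of the \<open>\<bar>F d\<^sub>i\<bar>\<close> is dominated
  by a small multiple of \<open>u\<close>. A second control functional shows that some \<open>\<parallel>F d\<^sub>i\<parallel>\<close> is small, a
  contradiction (\<open>order_interval_image_totally_bounded\<close>).

The spectral statements hold for every semigroup on a complex Banach space with a compact operator
\<open>T \<tau>\<close>. Integrating \<open>e\<^sup>-\<^sup>z\<^sup>s T s\<close> over \<open>[0, \<tau>]\<close> gives an operator \<open>V\<close> that commutes with \<open>A\<close> and satisfies
\<open>(z - A) V = I - e\<^sup>-\<^sup>z\<^sup>\<tau> T \<tau>\<close>, so \<open>z - A\<close> is invertible up to a compact operator, from both
sides. After multiplication with a resolvent this becomes an equation between commuting bounded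
operators, to which the Riesz theory of compact operators applies (\<open>drazin_inverse\<close>): the space
splits into a finite-dimensional part on which \<open>A - z\<close> is nilpotent and a complement on which
\<open>z - A\<close> is invertible (\<open>spectral_decomposition_exists\<close>). On the first part the resolvent is a finite
sum of negative powers, on the second a Neumann series; together they form the Laurent expansion.
The second part of the resolvent is holomorphic across the spectral value, so its circle
integral vanishes and the spectral projection maps into the finite-dimensional part. Finally, every
spectral value is an eigenvalue; unit eigenvectors for spectral values in a right half-plane
are a relatively compact set because they lie in a bounded multiple of the image under \<open>T \<tau>\<close> of the
unit ball. Infinitely many of them would produce an accumulation point of the spectrum that is
itself an eigenvalue, which is impossible since poles are isolated.\<close>

section \<open>Sublinear functionals and the Hahn-Banach theorem\<close>

definition sublinear :: "('a::real_vector \<Rightarrow> real) \<Rightarrow> bool" where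
  "sublinear p \<longleftrightarrow> (\<forall>x y. p (x + y) \<le> p x + p y) \<and> (\<forall>r x. 0 < r \<longrightarrow> p (r *\<^sub>R x) = r * p x) \<and> p 0 = 0"

lemma sublinearD:
  assumes "sublinear p"
  shows "p (x + y) \<le> p x + p y" "0 < r \<Longrightarrow> p (r *\<^sub>R x) = r * p x" "p 0 = 0" "- p (- x) \<le> p x"
proof -
  show "p (x + y) \<le> p x + p y" for x y using assms by (auto simp: sublinear_def)
  from this[of "x" "- x"] show "- p (- x) \<le> p x"
    using assms by (simp add: sublinear_def)
qed (use assms in \<open>auto simp: sublinear_def\<close>)

text \<open>This is the one-dimensional extension step of the Hahn-Banach theorem in terms of sublinear
  functionals: the infimum of \<open>p (x + t y) - t p y\<close> over \<open>t \<ge> 0\<close> is again sublinear, lies below \<open>p\<close> and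
  takes at \<open>- y\<close> the value \<open>- p y\<close>, as a linear functional with the value \<open>p y\<close> at \<open>y\<close> would.\<close>

lemma sublinear_lower:
  assumes p: "sublinear p"
  obtains q where "sublinear q" "\<And>x. q x \<le> p x" "q (- y) \<le> - p y"
proof -
  define S where "S x = (\<lambda>t. p (x + t *\<^sub>R y) - t * p y) ` {0..}" for x
  define q where "q x = Inf (S x)" for x
  have nonneg: "0 \<le> t \<Longrightarrow> p (t *\<^sub>R y) = t * p y" for t
    using sublinearD[OF p] by (cases "t = 0") auto
  have low: "- p (- x) \<le> v" if "v \<in> S x" for v x
  proof -
    obtain t where t: "0 \<le> t" "v = p (x + t *\<^sub>R y) - t * p y" using \<open>v \<in> S x\<close> unfolding S_def by (elim imageE) auto
    have "p (t *\<^sub>R y) \<le> p (x + t *\<^sub>R y) + p (- x)"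
      using sublinearD(1)[OF p, of "x + t *\<^sub>R y" "- x"] by simp
    with t nonneg show ?thesis by simp
  qed
  have ne: "S x \<noteq> {}" for x by (auto simp: S_def)
  have bdd: "bdd_below (S x)" for x using low by (intro bdd_belowI) auto
  have qle: "q x \<le> p (x + t *\<^sub>R y) - t * p y" if "0 \<le> t" for x t
    unfolding q_def using bdd that by (intro cInf_lower) (auto simp: S_def)
  have qge: "b \<le> q x" if "\<And>t. 0 \<le> t \<Longrightarrow> b \<le> p (x + t *\<^sub>R y) - t * p y" for b x
    unfolding q_def using ne that by (intro cInf_greatest) (auto simp: S_def)
  have 0: "q 0 = 0"
  proof (rule antisym)
    show "q 0 \<le> 0" using qle[of 0 0] sublinearD(3)[OF p] by simp
    show "0 \<le> q 0" by (rule qge) (simp add: nonneg)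
  qed
  have add: "q (x + z) \<le> q x + q z" for x z
  proof -
    have "q (x + z) - (p (z + t *\<^sub>R y) - t * p y) \<le> q x" if "0 \<le> t" for t
    proof (rule qge)
      fix s :: real assume "0 \<le> s"
      have "q (x + z) \<le> p ((x + s *\<^sub>R y) + (z + t *\<^sub>R y)) - (s + t) * p y"
        using qle[of "s + t" "x + z"] \<open>0 \<le> s\<close> that by (simp add: algebra_simps)
      with sublinearD(1)[OF p, of "x + s *\<^sub>R y" "z + t *\<^sub>R y"]
      show "q (x + z) - (p (z + t *\<^sub>R y) - t * p y) \<le> p (x + s *\<^sub>R y) - s * p y"
        by (simp add: algebra_simps)
    qed
    then have "q (x + z) - q x \<le> q z"
      by (intro qge) (force simp: algebra_simps)
    then show ?thesis by simp
  qed
  have scale1: "q (r *\<^sub>R x) \<le> r * q x" if "0 < r" for r x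
  proof -
    have "inverse r * q (r *\<^sub>R x) \<le> q x"
    proof (rule qge)
      fix t :: real assume "0 \<le> t"
      have "q (r *\<^sub>R x) \<le> p (r *\<^sub>R (x + t *\<^sub>R y)) - (r * t) * p y"
        using qle[of "r * t" "r *\<^sub>R x"] \<open>0 \<le> t\<close> that by (simp add: algebra_simps)
      also have "\<dots> = r * (p (x + t *\<^sub>R y) - t * p y)"
        using sublinearD(2)[OF p that, of "x + t *\<^sub>R y"]
        by (simp only: right_diff_distrib mult.assoc)
      finally show "inverse r * q (r *\<^sub>R x) \<le> p (x + t *\<^sub>R y) - t * p y"
        using that by (simp add: field_simps)
    qed
    then show ?thesis using that by (simp add: field_simps)
  qed
  have scale: "q (r *\<^sub>R x) = r * q x" if "0 < r" for r x
  proof (rule antisym)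
    have "q (inverse r *\<^sub>R (r *\<^sub>R x)) \<le> inverse r * q (r *\<^sub>R x)"
      using that by (intro scale1) simp
    then show "r * q x \<le> q (r *\<^sub>R x)" using that by (simp add: field_simps)
  qed (rule scale1[OF that])
  have "sublinear q" using 0 add scale by (simp add: sublinear_def)
  moreover have "q x \<le> p x" for x using qle[of 0 x] by simp
  moreover have "q (- y) \<le> - p y" using qle[of 1 "- y"] sublinearD(3)[OF p] by simp
  ultimately show ?thesis using that by blast
qed

text \<open>By Zorn's lemma. Infima of chains are finite because \<open>- p (- x) \<le> q x\<close> for all sublinear \<open>q \<le> p\<close>,
  and they are subadditive because any two members of a chain have a common lower bound in it.\<close>

lemma minimal_sublinear:
  assumes p: "sublinear p"
  obtains q where "sublinear q" "\<And>x. q x \<le> p x"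
    "\<And>r. sublinear r \<Longrightarrow> (\<And>x. r x \<le> q x) \<Longrightarrow> r = q"
proof -
  define F where "F = {q. sublinear q \<and> q \<le> p}"
  have "\<exists>m\<in>F. \<forall>a\<in>F. a \<le> m \<longrightarrow> a = m"
  proof (rule predicate_Zorn)
    show "partial_order_on F (relation_of (\<lambda>x y. y \<le> x) F)"
      by (rule partial_order_on_relation_ofI) auto
    fix C assume "C \<in> Chains (relation_of (\<lambda>x y. y \<le> x) F)"
    then have CF: "C \<subseteq> F" and tot: "\<And>a b. a \<in> C \<Longrightarrow> b \<in> C \<Longrightarrow> a \<le> b \<or> b \<le> a"
      by (auto simp: Chains_def relation_of_def)
    show "\<exists>l\<in>F. \<forall>a\<in>C. l \<le> a"
    proof (cases "C = {}")
      case True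
      with p show ?thesis by (auto simp: F_def)
    next
      case False
      define l where "l x = (INF q\<in>C. q x)" for x
      have sub: "sublinear q" "q x \<le> p x" if "q \<in> C" for q x
        using CF that by (auto simp: F_def le_fun_def)
      have bdd: "bdd_below ((\<lambda>q. q x) ` C)" for x
      proof (rule bdd_belowI2)
        fix q assume "q \<in> C"
        then show "- p (- x) \<le> q x"
          using sublinearD(4)[OF sub(1), of q x] sub(2)[of q "- x"] by simp
      qed
      have le: "l x \<le> q x" if "q \<in> C" for q x
        unfolding l_def by (rule cINF_lower[OF bdd that])
      have ge: "b \<le> l x" if "\<And>q. q \<in> C \<Longrightarrow> b \<le> q x" for b x
        unfolding l_def using False that by (rule cINF_greatest)
      have "l (x + y) \<le> l x + l y" for x y
      proof -
        have "l (x + y) - q x \<le> l y" if qC: "q \<in> C" for q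
        proof (rule ge)
          fix q' assume "q' \<in> C"
          obtain g where g: "g \<in> C" "g \<le> q" "g \<le> q'"
            using tot[OF qC \<open>q' \<in> C\<close>] qC \<open>q' \<in> C\<close> by blast
          have "l (x + y) \<le> g x + g y"
            using le[OF g(1)] sublinearD(1)[OF sub(1)[OF g(1)]] by (meson order_trans)
          also have "\<dots> \<le> q x + q' y" using g by (intro add_mono) (auto simp: le_fun_def)
          finally show "l (x + y) - q x \<le> q' y" by simp
        qed
        then have "l (x + y) - l y \<le> l x" by (intro ge) (force simp: algebra_simps)
        then show ?thesis by simp
      qed
      moreover have "l (r *\<^sub>R x) = r * l x" if "0 < r" for r x
      proof (rule antisym)
        have "inverse r * l (r *\<^sub>R x) \<le> l x"
          using le[of _ "r *\<^sub>R x"] sublinearD(2)[OF sub(1) that] that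
          by (intro ge) (simp add: field_simps)
        then show "l (r *\<^sub>R x) \<le> r * l x" using that by (simp add: field_simps)
        show "r * l x \<le> l (r *\<^sub>R x)"
        proof (rule ge)
          fix q assume q: "q \<in> C"
          show "r * l x \<le> q (r *\<^sub>R x)"
            using le[OF q, of x] sublinearD(2)[OF sub(1)[OF q] that, of x] that by simp
        qed
      qed
      moreover have "l 0 = 0"
        using sublinearD(3)[OF sub(1)] False le[of _ 0] by (intro antisym ge) fastforce+
      ultimately have "sublinear l" by (simp add: sublinear_def)
      moreover have "l \<le> p" using False le sub(2) by (meson ex_in_conv le_funI order_trans)
      ultimately show ?thesis using le by (intro bexI[of _ l]) (auto simp: F_def le_fun_def)
    qed
  qed
  then obtain m where m: "m \<in> F" "\<And>a. a \<in> F \<Longrightarrow> a \<le> m \<Longrightarrow> a = m" by blast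
  show ?thesis
  proof (rule that[of m])
    show "sublinear m" "m x \<le> p x" for x using m(1) by (auto simp: F_def le_fun_def)
    show "r = m" if "sublinear r" "\<And>x. r x \<le> m x" for r
      using that m by (intro m(2)) (auto simp: F_def le_fun_def intro: order_trans)
  qed
qed

text \<open>A minimal sublinear functional is odd, since \<open>sublinear_lower\<close> cannot decrease it any further, and an
  odd sublinear functional is linear. Applying \<open>sublinear_lower\<close> at \<open>x\<^sub>0\<close> beforehand forces the value
  \<open>p x\<^sub>0\<close> at \<open>x\<^sub>0\<close>.\<close>

lemma hahn_banach_sublinear:
  assumes p: "sublinear p"
  obtains f where "linear f" "\<And>x. f x \<le> p x" "f x0 = p x0"
proof -
  obtain p' where p': "sublinear p'" "\<And>x. p' x \<le> p x" "p' (- x0) \<le> - p x0"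
    using sublinear_lower[OF p] by metis
  obtain f where f: "sublinear f" "\<And>x. f x \<le> p' x"
    "\<And>r. sublinear r \<Longrightarrow> (\<And>x. r x \<le> f x) \<Longrightarrow> r = f"
    using minimal_sublinear[OF p'(1)] by metis
  have neg: "f (- y) = - f y" for y
  proof -
    obtain q where "sublinear q" "\<And>x. q x \<le> f x" "q (- y) \<le> - f y"
      using sublinear_lower[OF f(1)] by metis
    then have "f (- y) \<le> - f y" using f(3) by metis
    then show ?thesis using sublinearD(4)[OF f(1), of y] by simp
  qed
  have add: "f (x + y) = f x + f y" for x y
    using sublinearD(1)[OF f(1), of x y] sublinearD(1)[OF f(1), of "- x" "- y"]
      neg[of "x + y"] by (simp add: neg)
  have "f (r *\<^sub>R x) = r * f x" for r x
  proof (cases r "0::real" rule: linorder_cases)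
    case less
    then show ?thesis using sublinearD(2)[OF f(1), of "- r" x] neg[of "r *\<^sub>R x"] by simp
  qed (use sublinearD(2,3)[OF f(1)] in auto)
  with add have "linear f" by (intro linearI) auto
  moreover have "f x \<le> p x" for x using f(2) p'(2) order_trans by blast
  moreover have "f x0 = p x0"
  proof (rule antisym)
    show "f x0 \<le> p x0" by fact
    show "p x0 \<le> f x0" using f(2)[of "- x0"] p'(3) neg[of x0] by simp
  qed
  ultimately show ?thesis by (rule that)
qed

section \<open>Consequences of the category theorem\<close>

text \<open>Some \<open>F n\<close> contains a ball around a point \<open>x\<close>. The midpoint condition moves it to the
  origin, because \<open>z\<close> is half the difference of \<open>x + z\<close> and \<open>x - z\<close>. The uniform boundedness principle
  and its order-theoretic analogue below are both instances.\<close>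

lemma baire_symmetric_convex:
  fixes F :: "nat \<Rightarrow> 'a::banach set"
  assumes closed: "\<And>n. closed (F n)" and cover: "(\<Union>n. F n) = UNIV"
    and diff: "\<And>n x y. x \<in> F n \<Longrightarrow> y \<in> F n \<Longrightarrow> (1/2) *\<^sub>R (x - y) \<in> F n"
  obtains n r where "0 < r" "cball 0 r \<subseteq> F n"
proof -
  have "\<exists>n. interior (F n) \<noteq> {}"
  proof (rule ccontr)
    assume "\<not> ?thesis"
    then have "Met_TC.mtopology interior_of (\<Union>(range F)) = {}"
      using closed by (intro Met_TC.metric_Baire_category_alt) (auto simp: complete_UNIV)
    with cover show False by simp
  qed
  then obtain n x where "x \<in> interior (F n)" by blast
  then obtain e where e: "0 < e" "cball x e \<subseteq> F n" by (meson mem_interior_cball)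
  have "cball 0 e \<subseteq> F n"
  proof
    fix z :: 'a assume "z \<in> cball 0 e"
    then have "x + z \<in> F n" "x - z \<in> F n" using e by (auto simp: dist_norm subset_iff)
    from diff[OF this] show "z \<in> F n" by (simp flip: scaleR_2)
  qed
  with e that show ?thesis by blast
qed

lemma uniform_boundedness:
  fixes f :: "nat \<Rightarrow> 'a::banach \<Rightarrow> 'b::real_normed_vector"
  assumes lin: "\<And>n. bounded_linear (f n)" and bdd: "\<And>x. \<exists>c. \<forall>n. norm (f n x) \<le> c"
  obtains M where "\<And>n x. norm (f n x) \<le> M * norm x"
proof -
  define F where "F k = {x. \<forall>n. norm (f n x) \<le> real k}" for k
  have "closed (F k)" for k
    unfolding F_def
    by (intro closed_Collect_all closed_Collect_le continuous_intros
        linear_continuous_on lin continuous_on_const)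
  moreover have "(\<Union>k. F k) = UNIV"
  proof -
    have "\<exists>k. x \<in> F k" for x
    proof -
      obtain c where c: "\<forall>n. norm (f n x) \<le> c" using bdd by blast
      obtain k where "c \<le> real k" using real_arch_simple by blast
      with c show ?thesis by (auto simp: F_def intro: order_trans)
    qed
    then show ?thesis by blast
  qed
  moreover have "(1/2) *\<^sub>R (x - y) \<in> F k" if xy: "x \<in> F k" "y \<in> F k" for k x y
    unfolding F_def
  proof safe
    fix n
    interpret bounded_linear "f n" by (rule lin)
    show "norm (f n ((1/2) *\<^sub>R (x - y))) \<le> real k"
      using xy norm_triangle_ineq4[of "f n x" "f n y"] unfolding F_def
      by (simp add: scaleR diff) (smt (verit))
  qed
  ultimately obtain k r where r: "0 < r" "cball 0 r \<subseteq> F k" by (rule baire_symmetric_convex)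
  show ?thesis
  proof (rule that)
    fix n x
    interpret bounded_linear "f n" by (rule lin)
    show "norm (f n x) \<le> (real k / r) * norm x"
    proof (cases "x = 0")
      case False
      then have "(r / norm x) *\<^sub>R x \<in> F k" using r by auto
      then have "norm (f n ((r / norm x) *\<^sub>R x)) \<le> real k" by (auto simp: F_def)
      with r False show ?thesis by (simp add: scaleR field_simps)
    qed (simp add: zero)
  qed
qed

text \<open>This plays the role of the closed graph theorem for \<open>R\<close> as a map into the principal ideal of \<open>u\<close>
  with its gauge norm. The sets of all \<open>x\<close> with \<open>\<bar>R x\<bar> \<le> k u\<close> are closed because the
  order is closed in the norm topology.\<close>

lemma order_bounded_bound:
  fixes R :: "'a::banach \<Rightarrow> 'b::banach_lattice"
  assumes R: "bounded_linear R" and u: "0 \<le> u" and ob: "\<And>x. \<exists>c. \<bar>R x\<bar> \<le> c *\<^sub>R u"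
  obtains C where "0 < C" "\<And>x. \<bar>R x\<bar> \<le> (C * norm x) *\<^sub>R u"
proof -
  interpret R: bounded_linear R by fact
  define F where "F k = {x. \<bar>R x\<bar> \<le> real k *\<^sub>R u}" for k
  have F: "x \<in> F k \<longleftrightarrow> R x \<le> real k *\<^sub>R u \<and> - R x \<le> real k *\<^sub>R u" for x k
    by (auto simp: F_def abs_le_iff)
  have "closed (F k)" for k
    unfolding closed_sequential_limits
  proof (intro allI impI, elim conjE)
    fix x l assume x: "\<forall>n. x n \<in> F k" "x \<longlonglongrightarrow> l"
    have l: "(\<lambda>n. R (x n)) \<longlonglongrightarrow> R l" by (rule R.tendsto[OF x(2)])
    show "l \<in> F k"
      using limit_mono[OF l tendsto_const] limit_mono[OF tendsto_minus[OF l] tendsto_const] x(1)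
      by (simp add: F)
  qed
  moreover have "(\<Union>k. F k) = UNIV"
  proof -
    have "\<exists>k. x \<in> F k" for x
    proof -
      obtain c where c: "\<bar>R x\<bar> \<le> c *\<^sub>R u" using ob by blast
      obtain k where "c \<le> real k" using real_arch_simple by blast
      then have "c *\<^sub>R u \<le> real k *\<^sub>R u" using u by (rule scaleR_right_mono)
      with c show ?thesis by (auto simp: F_def intro: order_trans)
    qed
    then show ?thesis by blast
  qed
  moreover have "(1/2) *\<^sub>R (x - y) \<in> F k" if xy: "x \<in> F k" "y \<in> F k" for k x y
  proof -
    have half: "(1/2::real) *\<^sub>R a \<le> b" if "a \<le> b + b" for a b :: 'b
      using scaleR_left_mono[OF that, of "1/2"] by (simp flip: scaleR_2)
    have "R x - R y \<le> real k *\<^sub>R u + real k *\<^sub>R u" "R y - R x \<le> real k *\<^sub>R u + real k *\<^sub>R u"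
      using xy add_mono[of "R x" "real k *\<^sub>R u" "- R y"] add_mono[of "R y" "real k *\<^sub>R u" "- R x"]
      by (auto simp: F)
    from this[THEN half] show ?thesis
      by (simp add: F R.scaleR R.diff scaleR_right_diff_distrib)
  qed
  ultimately obtain k r where r: "0 < r" "cball 0 r \<subseteq> F k" by (rule baire_symmetric_convex)
  show ?thesis
  proof (rule that[of "(real k + 1) / r"])
    show "0 < (real k + 1) / r" using r by simp
    fix x
    show "\<bar>R x\<bar> \<le> ((real k + 1) / r * norm x) *\<^sub>R u"
    proof (cases "x = 0")
      case False
      have "R x = (norm x / r) *\<^sub>R R ((r / norm x) *\<^sub>R x)" using r False by (simp add: R.scaleR)
      then have "\<bar>R x\<bar> \<le> (norm x / r) *\<^sub>R \<bar>R ((r / norm x) *\<^sub>R x)\<bar>"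
        using abs_scaleR_le[of "norm x / r" "R ((r / norm x) *\<^sub>R x)"] r by simp
      also have "\<dots> \<le> (norm x / r) *\<^sub>R (real k *\<^sub>R u)"
      proof (rule scaleR_left_mono)
        have "(r / norm x) *\<^sub>R x \<in> F k" using r False by auto
        then show "\<bar>R ((r / norm x) *\<^sub>R x)\<bar> \<le> real k *\<^sub>R u" by (simp add: F_def)
      qed (use r in simp)
      also have "\<dots> \<le> ((real k + 1) / r * norm x) *\<^sub>R u"
      proof -
        have "norm x * real k / r \<le> (real k + 1) / r * norm x"
          using r by (simp add: field_simps)
        then show ?thesis using u by (simp add: scaleR_right_mono)
      qed
      finally show ?thesis .
    qed (simp add: R.zero)
  qed
qed

section \<open>Order continuous norms and control functionals\<close>

text \<open>The set of all differences \<open>c - x n\<close>, where \<open>c\<close> ranges over the upper bounds of the sequence, is directed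
  downwards. Its infimum is \<open>0\<close>: if \<open>d\<close> is a lower bound, then with \<open>c\<close> also \<open>c - d\<close> is an upper bound,
  so \<open>b - k d\<close> is one for every \<open>k\<close>, and the order is Archimedean. Order continuity now makes the
  sequence Cauchy.\<close>

lemma incseq_bounded_convergent:
  fixes x :: "nat \<Rightarrow> 'a::order_continuous_banach_lattice"
  assumes inc: "\<And>n. x n \<le> x (Suc n)" and bd: "\<And>n. x n \<le> b"
  obtains l where "x \<longlonglongrightarrow> l" "\<And>n. x n \<le> l"
proof -
  have mono: "x m \<le> x n" if "m \<le> n" for m n using inc that by (rule lift_Suc_mono_le)
  define U where "U = {b. \<forall>n. x n \<le> b}"
  define D where "D = {c - x n | c n. c \<in> U}"
  have bU: "b \<in> U" using bd by (simp add: U_def)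
  have shrink: "\<exists>z\<in>D. \<forall>y\<in>D. y \<le> z \<longrightarrow> norm y < e" if "0 < e" for e
  proof (rule order_continuous_norm)
    show "D \<noteq> {}" using bU by (auto simp: D_def)
    show "\<exists>z\<in>D. z \<le> p \<and> z \<le> q" if pq: "p \<in> D" "q \<in> D" for p q
    proof -
      obtain c n c' n' where p: "p = c - x n" "c \<in> U" and q: "q = c' - x n'" "c' \<in> U"
        using pq by (auto simp: D_def)
      have "inf c c' - x (max n n') \<in> D" using p q by (auto simp: D_def U_def)
      moreover have "inf c c' - x (max n n') \<le> p" "inf c c' - x (max n n') \<le> q"
        unfolding p q by (intro diff_mono mono inf_le1 inf_le2; simp)+
      ultimately show ?thesis by blast
    qed
    show "0 \<le> p" if "p \<in> D" for p using that by (auto simp: D_def U_def)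
    fix d assume d: "\<And>p. p \<in> D \<Longrightarrow> d \<le> p"
    have "d \<le> c - x n" if "c \<in> U" for c n using d that by (auto simp: D_def)
    then have step: "c - d \<in> U" if "c \<in> U" for c
      using that by (auto simp: U_def le_diff_eq add.commute)
    have "b - real k *\<^sub>R d \<in> U" for k
    proof (induction k)
      case (Suc k)
      from step[OF this] show ?case by (simp add: algebra_simps)
    qed (simp add: bU)
    then have k: "real k *\<^sub>R d \<le> b - x 0" for k by (simp add: U_def le_diff_eq add.commute)
    have "d \<le> (1 / real (Suc k)) *\<^sub>R (b - x 0)" for k
      using scaleR_left_mono[OF k[of "Suc k"], of "1 / real (Suc k)"] by (simp del: of_nat_Suc)
    moreover have "(\<lambda>k. (1 / real (Suc k)) *\<^sub>R (b - x 0)) \<longlonglongrightarrow> 0 *\<^sub>R (b - x 0)"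
      using LIMSEQ_inverse_real_of_nat by (intro tendsto_intros) (simp add: inverse_eq_divide)
    ultimately show "d \<le> 0" using limit_mono[OF tendsto_const] by fastforce
  qed (fact that)
  have "Cauchy x"
  proof (rule CauchyI')
    fix e :: real assume "0 < e"
    obtain z where z: "z \<in> D" "\<forall>y\<in>D. y \<le> z \<longrightarrow> norm y < e" using shrink[OF \<open>0 < e\<close>] by blast
    obtain c M where c: "z = c - x M" "c \<in> U" using z(1) by (auto simp: D_def)
    have "norm z < e" using z by blast
    have "dist (x m) (x n) < e" if "M \<le> m" "m < n" for m n
    proof -
      have "x n - x m \<le> z" using c mono[OF that(1)] by (auto simp: U_def intro: diff_mono)
      then have "norm (x n - x m) \<le> norm z"
        using mono[of m n] that by (intro norm_mono_nonneg) auto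
      with \<open>norm z < e\<close> show ?thesis by (simp add: dist_norm norm_minus_commute)
    qed
    then show "\<exists>M. \<forall>m\<ge>M. \<forall>n>m. dist (x m) (x n) < e" by blast
  qed
  then obtain l where l: "x \<longlonglongrightarrow> l" by (auto simp: Cauchy_convergent_iff convergent_def)
  have "x n \<le> l" for n
    using limit_mono[OF tendsto_const LIMSEQ_ignore_initial_segment[OF l, of n], of "x n"]
      mono[of n] by auto
  with l that show ?thesis by blast
qed

lemma decseq_bounded_convergent:
  fixes x :: "nat \<Rightarrow> 'a::order_continuous_banach_lattice"
  assumes dec: "\<And>n. x (Suc n) \<le> x n" and bd: "\<And>n. b \<le> x n"
  obtains l where "x \<longlonglongrightarrow> l" "\<And>n. l \<le> x n"
proof -
  have "\<And>n. - x n \<le> - x (Suc n)" "\<And>n. - x n \<le> - b" using assms by auto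
  then obtain l where l: "(\<lambda>n. - x n) \<longlonglongrightarrow> l" "\<And>n. - x n \<le> l"
    by (rule incseq_bounded_convergent) auto
  show ?thesis
  proof (rule that)
    show "x \<longlonglongrightarrow> - l" using tendsto_minus[OF l(1)] by simp
    show "- l \<le> x n" for n using l(2)[of n] by (simp add: minus_le_iff)
  qed
qed

definition positive_functional :: "('a::banach_lattice \<Rightarrow> real) \<Rightarrow> bool" where
  "positive_functional f \<longleftrightarrow> bounded_linear f \<and> (\<forall>x\<ge>0. 0 \<le> f x)"

lemma positive_functional_mono:
  assumes "positive_functional f" "x \<le> y"
  shows "f x \<le> f y"
proof -
  have "0 \<le> f (y - x)" using assms by (simp add: positive_functional_def)
  also have "f (y - x) = f y - f x"
    using assms by (intro linear_diff bounded_linear.linear) (simp add: positive_functional_def)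
  finally show ?thesis by simp
qed

text \<open>Apply the Hahn-Banach theorem to the norm of the positive part.\<close>

lemma positive_functional_norming:
  fixes x0 :: "'a::banach_lattice"
  assumes "0 \<le> x0"
  obtains f where "positive_functional f" "\<And>x. \<bar>f x\<bar> \<le> norm x" "f x0 = norm x0"
proof -
  define p where "p x = norm (sup x 0)" for x :: 'a
  have "p (x + y) \<le> p x + p y" for x y
  proof -
    have "sup (x + y) 0 \<le> sup x 0 + sup y 0" by (intro le_supI add_mono add_nonneg_nonneg) auto
    then have "p (x + y) \<le> norm (sup x 0 + sup y 0)"
      unfolding p_def by (intro norm_mono_nonneg) auto
    then show ?thesis using norm_triangle_ineq[of "sup x 0" "sup y 0"] by (simp add: p_def)
  qed
  moreover have "p (r *\<^sub>R x) = r * p x" if "0 < r" for r x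
  proof -
    have "sup (r *\<^sub>R x) 0 = r *\<^sub>R sup x 0"
    proof (rule antisym)
      show "sup (r *\<^sub>R x) 0 \<le> r *\<^sub>R sup x 0"
        using that by (intro le_supI scaleR_left_mono scaleR_nonneg_nonneg) auto
      have "sup x 0 \<le> inverse r *\<^sub>R sup (r *\<^sub>R x) 0"
      proof (rule le_supI)
        have "inverse r *\<^sub>R (r *\<^sub>R x) \<le> inverse r *\<^sub>R sup (r *\<^sub>R x) 0"
          using that by (intro scaleR_left_mono) auto
        then show "x \<le> inverse r *\<^sub>R sup (r *\<^sub>R x) 0" using that by simp
      qed (use that in \<open>auto intro: scaleR_nonneg_nonneg\<close>)
      then have "r *\<^sub>R sup x 0 \<le> r *\<^sub>R (inverse r *\<^sub>R sup (r *\<^sub>R x) 0)"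
        using that by (intro scaleR_left_mono) auto
      then show "r *\<^sub>R sup x 0 \<le> sup (r *\<^sub>R x) 0" using that by simp
    qed
    then show ?thesis using that by (simp add: p_def)
  qed
  ultimately have "sublinear p" by (simp add: sublinear_def p_def)
  then obtain f where f: "linear f" "\<And>x. f x \<le> p x" "f x0 = p x0" 
    using hahn_banach_sublinear[where p = p and ?x0.0 = x0] by blast
  have le: "f x \<le> norm x" for x
  proof -
    have "p x \<le> norm \<bar>x\<bar>" unfolding p_def by (intro norm_mono_nonneg) (auto intro: abs_ge_self)
    then show ?thesis using f(2)[of x] by simp
  qed
  have bd: "\<bar>f x\<bar> \<le> norm x" for x
    using le[of x] le[of "- x"] linear_neg[OF f(1), of x] by simp
  have "0 \<le> f x" if "0 \<le> x" for x
    using f(2)[of "- x"] that linear_neg[OF f(1), of x] by (simp add: p_def sup_absorb2)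
  moreover have "bounded_linear f"
    using f(1) bd by (intro bounded_linear_intro[where K = 1])
      (auto simp: linear_add linear_scale)
  ultimately have "positive_functional f" by (simp add: positive_functional_def)
  then show ?thesis using bd f(3) assms by (intro that[of f]) (auto simp: p_def sup_absorb1)
qed

text \<open>Here \<open>w n\<close> is the supremum of the \<open>n\<close>-th tail of the sequence. It is a norm limit of finite suprema,
  so that a positive functional can be estimated on it by the sum of its values.\<close>

lemma sup_tails:
  fixes x :: "nat \<Rightarrow> 'a::order_continuous_banach_lattice"
  assumes x: "\<And>n. 0 \<le> x n" "\<And>n. x n \<le> u"
  obtains w where "\<And>n. x n \<le> w n" "\<And>n. w (Suc n) \<le> w n" "\<And>n. 0 \<le> w n"
    "\<And>f n s. positive_functional f \<Longrightarrow> (\<And>m. (\<Sum>i=n..<m. f (x i)) \<le> s) \<Longrightarrow> f (w n) \<le> s"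
proof -
  define v where "v n M = rec_nat (x n) (\<lambda>M s. sup s (x (n + Suc M))) M" for n M
  have v0: "v n 0 = x n" and vS: "v n (Suc M) = sup (v n M) (x (n + Suc M))" for n M
    by (simp_all add: v_def)
  have inc: "v n M \<le> v n (Suc M)" for n M by (simp add: vS)
  have vu: "v n M \<le> u" for n M by (induction M) (simp_all add: v0 vS x)
  have "\<exists>w. (\<lambda>M. v n M) \<longlonglongrightarrow> w \<and> (\<forall>M. v n M \<le> w)" for n
    using incseq_bounded_convergent[of "v n" u, OF inc vu] by metis
  then obtain w where w: "\<And>n. (\<lambda>M. v n M) \<longlonglongrightarrow> w n" "\<And>n M. v n M \<le> w n" by metis
  have vpos: "0 \<le> v n M" for n M
    by (induction M) (simp_all add: v0 vS x le_supI1)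
  show ?thesis
  proof (rule that)
    show xw: "x n \<le> w n" for n using w(2)[of n 0] by (simp add: v0)
    show "0 \<le> w n" for n using xw x(1) order_trans by blast
    show "w (Suc n) \<le> w n" for n
    proof -
      have "v (Suc n) M \<le> v n (Suc M)" for M
        by (induction M) (auto simp: v0 vS intro: le_supI1)
      then have "v (Suc n) M \<le> w n" for M using w(2) order_trans by blast
      then show ?thesis by (rule limit_mono[OF w(1) tendsto_const])
    qed
    fix f n s
    assume f: "positive_functional f" and s: "\<And>m. (\<Sum>i=n..<m. f (x i)) \<le> s"
    interpret bounded_linear f using f by (simp add: positive_functional_def)
    have "f (v n M) \<le> (\<Sum>i=n..<Suc (n + M). f (x i))" for M
    proof (induction M)
      case (Suc M)
      have "v n (Suc M) \<le> v n M + x (n + Suc M)"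
        unfolding vS by (rule le_supI) (simp_all add: x vpos)
      then have "f (v n (Suc M)) \<le> f (v n M) + f (x (n + Suc M))"
        using positive_functional_mono[OF f] by (metis add)
      with Suc show ?case by simp
    qed (simp add: v0)
    then have "f (v n M) \<le> s" for M using s order_trans by blast
    moreover have "(\<lambda>M. f (v n M)) \<longlonglongrightarrow> f (w n)" by (rule tendsto[OF w(1)])
    ultimately show "f (w n) \<le> s" by (intro LIMSEQ_le_const2) auto
  qed
qed

text \<open>Otherwise one chooses recursively \<open>x\<^sub>k\<close> in \<open>[0, u]\<close> of norm at least \<open>e\<close> on which all functionals chosen
  so far are less than \<open>2\<^sup>-\<^sup>k\<close>, and a positive functional norming \<open>x\<^sub>k\<close>. The suprema \<open>w\<^sub>n\<close> of the tails
  decrease in norm to some \<open>l\<close> on which every one of the functionals vanishes. Then the \<open>k\<close>-th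
  functional takes at \<open>w\<^sub>k - l\<close> a value of at least \<open>e\<close>, although \<open>w\<^sub>k - l\<close> tends to \<open>0\<close>.\<close>

lemma control_functional:
  fixes u :: "'a::order_continuous_banach_lattice"
  assumes "0 < e"
  obtains f \<delta> where "positive_functional f" "0 < \<delta>"
    "\<And>x. 0 \<le> x \<Longrightarrow> x \<le> u \<Longrightarrow> f x < \<delta> \<Longrightarrow> norm x < e"
proof (rule ccontr)
  note found = that
  assume contra: "\<not> thesis"
  have "\<exists>x. 0 \<le> x \<and> x \<le> u \<and> f x < \<delta> \<and> e \<le> norm x"
    if "positive_functional f" "0 < \<delta>" for f :: "'a \<Rightarrow> real" and \<delta>
  proof (rule ccontr)
    assume "\<not> ?thesis"
    then have "\<And>x. 0 \<le> x \<Longrightarrow> x \<le> u \<Longrightarrow> f x < \<delta> \<Longrightarrow> norm x < e" by (auto simp: not_le)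
    from found[OF that this] contra show False by contradiction
  qed
  then obtain X where X: "\<And>f \<delta>. positive_functional f \<Longrightarrow> 0 < \<delta> \<Longrightarrow>
      0 \<le> X f \<delta> \<and> X f \<delta> \<le> u \<and> f (X f \<delta>) < \<delta> \<and> e \<le> norm (X f \<delta>)"
    by metis
  have "\<exists>f. positive_functional f \<and> (\<forall>x. \<bar>f x\<bar> \<le> norm x) \<and> f y = norm y" if "0 \<le> y" for y :: 'a
    by (rule positive_functional_norming[OF that]) blast
  then obtain H where H: "\<And>y::'a. 0 \<le> y \<Longrightarrow> positive_functional (H y)"
      "\<And>y x::'a. 0 \<le> y \<Longrightarrow> \<bar>H y x\<bar> \<le> norm x" "\<And>y::'a. 0 \<le> y \<Longrightarrow> H y y = norm y"
    by metis
  \<comment> \<open>\<open>\<psi> k\<close> is the sum of the norming functionals of the first \<open>k\<close> vectors, so that the next vector is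
    small for all of them at once.\<close>
  define \<psi> where "\<psi> = rec_nat (\<lambda>_. 0) (\<lambda>k f y. f y + H (X f ((1/2) ^ k)) y)"
  define x where "x k = X (\<psi> k) ((1/2) ^ k)" for k
  have \<psi>S: "\<psi> (Suc k) = (\<lambda>y. \<psi> k y + H (x k) y)" for k by (simp add: \<psi>_def x_def)
  have \<psi>: "positive_functional (\<psi> k)" for k
  proof (induction k)
    case 0
    then show ?case by (simp add: \<psi>_def positive_functional_def)
  next
    case (Suc k)
    then have "0 \<le> x k" using X by (simp add: x_def)
    with Suc H(1) show ?case
      by (simp add: \<psi>S positive_functional_def bounded_linear_add)
  qed
  have x: "0 \<le> x k" "x k \<le> u" "\<psi> k (x k) < (1/2) ^ k" "e \<le> norm (x k)" for k
    using X[OF \<psi>, of "(1/2) ^ k"] by (simp_all add: x_def)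
  have \<psi>le: "\<psi> k y \<le> \<psi> m y" if "0 \<le> y" "k \<le> m" for k m y
  proof (rule lift_Suc_mono_le[OF _ that(2), of "\<lambda>k. \<psi> k y"])
    show "\<psi> k y \<le> \<psi> (Suc k) y" for k
      using H(1)[OF x(1)] that(1) by (simp add: \<psi>S positive_functional_def)
  qed
  obtain w where w: "\<And>n. x n \<le> w n" "\<And>n. w (Suc n) \<le> w n" "\<And>n. 0 \<le> w n"
    "\<And>f n s. positive_functional f \<Longrightarrow> (\<And>m. (\<Sum>i=n..<m. f (x i)) \<le> s) \<Longrightarrow> f (w n) \<le> s"
    by (rule sup_tails[of x u, OF x(1,2)]) blast
  obtain l where l: "w \<longlonglongrightarrow> l" "\<And>n. l \<le> w n" 
    using decseq_bounded_convergent[of w, OF w(2,3)] by blast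
  have l0: "0 \<le> l" by (rule limit_nonneg[OF l(1) w(3)])
  have geo: "(\<Sum>i=n..<m. (1/2) ^ i) \<le> 2 * (1/2::real) ^ n" for n m
  proof (cases "n \<le> m")
    case True
    then have "(\<Sum>i=n..<m. (1/2) ^ i) = 2 * (1/2::real) ^ n - 2 * (1/2) ^ m"
      by (induction rule: dec_induct) auto
    then show ?thesis by simp
  qed simp
  have "\<psi> k l \<le> 2 * (1/2) ^ n" if "k \<le> n" for k n
  proof -
    have "(\<Sum>i=n..<m. \<psi> k (x i)) \<le> 2 * (1/2) ^ n" for m
    proof -
      have "(\<Sum>i=n..<m. \<psi> k (x i)) \<le> (\<Sum>i=n..<m. (1/2) ^ i)"
      proof (rule sum_mono)
        fix i assume "i \<in> {n..<m}"
        then have "\<psi> k (x i) \<le> \<psi> i (x i)" using \<psi>le x(1) that by simp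
        then show "\<psi> k (x i) \<le> (1/2) ^ i" using x(3)[of i] by simp
      qed
      then show ?thesis using geo order_trans by blast
    qed
    then have "\<psi> k (w n) \<le> 2 * (1/2) ^ n" by (rule w(4)[OF \<psi>])
    then show ?thesis using positive_functional_mono[OF \<psi> l(2)] order_trans by blast
  qed
  moreover have "(\<lambda>n. 2 * (1/2::real) ^ n) \<longlonglongrightarrow> 2 * 0"
    by (intro tendsto_mult tendsto_const LIMSEQ_power_zero) simp
  ultimately have \<psi>l: "\<psi> k l \<le> 0" for k
    by (intro LIMSEQ_le_const[of "\<lambda>n. 2 * (1/2::real) ^ n"]) auto
  have "e \<le> norm (w k - l)" for k
  proof -
    have Hk: "positive_functional (H (x k))" by (rule H(1)[OF x(1)])
    have "H (x k) l \<le> 0"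
      using \<psi>l[of "Suc k"] \<psi>[of k] l0 by (simp add: \<psi>S positive_functional_def) (smt (verit))
    have "e \<le> H (x k) (x k)" using H(3)[OF x(1)] x(4) by simp
    also have "\<dots> \<le> H (x k) (w k)" by (rule positive_functional_mono[OF Hk w(1)])
    also have "\<dots> \<le> H (x k) (w k) - H (x k) l" using \<open>H (x k) l \<le> 0\<close> by simp
    also have "\<dots> = H (x k) (w k - l)"
      using Hk by (simp add: positive_functional_def linear_diff[OF bounded_linear.linear])
    also have "\<dots> \<le> norm (w k - l)" using H(2)[OF x(1), of k "w k - l"] by simp
    finally show ?thesis .
  qed
  moreover have "(\<lambda>k. norm (w k - l)) \<longlonglongrightarrow> 0" using l(1) by (simp add: LIM_zero tendsto_norm_zero)
  ultimately have "e \<le> 0" by (intro LIMSEQ_le_const[of "\<lambda>k. norm (w k - l)"]) auto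
  with \<open>0 < e\<close> show False by simp
qed

section \<open>A pre-Hilbert structure on a principal ideal\<close>

text \<open>For \<open>u \<ge> 0\<close> this is the principal ideal of \<open>u\<close> in the real lattice.\<close>

definition order_ideal :: "'a::banach_lattice \<Rightarrow> 'a set" where
  "order_ideal u = {x. \<exists>K. \<bar>x\<bar> \<le> K *\<^sub>R u}"

lemma order_ideal_add:
  assumes "x \<in> order_ideal u" "y \<in> order_ideal u"
  shows "x + y \<in> order_ideal u"
proof -
  obtain K L where "\<bar>x\<bar> \<le> K *\<^sub>R u" "\<bar>y\<bar> \<le> L *\<^sub>R u"
    using assms unfolding order_ideal_def by blast
  then have "\<bar>x + y\<bar> \<le> (K + L) *\<^sub>R u"
    using abs_triangle_ineq[of x y] add_mono[of "\<bar>x\<bar>" "K *\<^sub>R u" "\<bar>y\<bar>" "L *\<^sub>R u"]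
    by (simp add: scaleR_add_left)
  then show ?thesis unfolding order_ideal_def by blast
qed

lemma order_ideal_minus: "x \<in> order_ideal u \<Longrightarrow> - x \<in> order_ideal u"
  by (simp add: order_ideal_def)

lemma order_ideal_diff:
  "x \<in> order_ideal u \<Longrightarrow> y \<in> order_ideal u \<Longrightarrow> x - y \<in> order_ideal u"
  using order_ideal_add[of x u "- y"] order_ideal_minus[of y u] by simp

lemma order_ideal_zero: "0 \<in> order_ideal u"
  by (auto simp: order_ideal_def intro: exI[of _ 0])

text \<open>If the ideal of \<open>u\<close> is represented as a space of functions in which \<open>u\<close> is the constant \<open>1\<close>, then
  \<open>2 a x - a\<^sup>2 u\<close> is the tangent at \<open>a\<close> to the parabola, evaluated at \<open>x\<close>, and the supremum over all \<open>a\<close> is \<open>x\<^sup>2\<close>.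
  Finite sets of tangents keep the definition inside the lattice; the full supremum is taken only
  after applying a functional.\<close>

definition square_sup :: "'a::banach_lattice \<Rightarrow> real set \<Rightarrow> 'a \<Rightarrow> 'a" where
  "square_sup u A x = Sup_fin ((\<lambda>a. (2 * a) *\<^sub>R x - a\<^sup>2 *\<^sub>R u) ` A)"

definition square_form :: "('a::banach_lattice \<Rightarrow> real) \<Rightarrow> 'a \<Rightarrow> 'a \<Rightarrow> real" where
  "square_form f u x = (SUP A\<in>{A. finite A \<and> A \<noteq> {}}. f (square_sup u A x))"

lemma square_sup_upper:
  "finite A \<Longrightarrow> a \<in> A \<Longrightarrow> (2 * a) *\<^sub>R x - a\<^sup>2 *\<^sub>R u \<le> square_sup u A x"
  unfolding square_sup_def by (rule Sup_fin.coboundedI) auto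

lemma square_sup_least:
  "finite A \<Longrightarrow> A \<noteq> {} \<Longrightarrow> (\<And>a. a \<in> A \<Longrightarrow> (2 * a) *\<^sub>R x - a\<^sup>2 *\<^sub>R u \<le> b) \<Longrightarrow> square_sup u A x \<le> b"
  unfolding square_sup_def by (rule Sup_fin.boundedI) auto

lemma scaleR_le_abs:
  fixes x :: "'a::banach_lattice"
  shows "r *\<^sub>R x \<le> \<bar>r\<bar> *\<^sub>R \<bar>x\<bar>"
  using abs_ge_self[of "r *\<^sub>R x"] abs_scaleR_le[of r x] by (rule order_trans)

context
  fixes f :: "'a::banach_lattice \<Rightarrow> real" and u :: 'a
  assumes f: "positive_functional f" and u: "0 \<le> u"
begin

private lemma lin: "linear f"
  using f bounded_linear.linear by (auto simp: positive_functional_def)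

private lemma fu: "0 \<le> f u"
  using f u by (simp add: positive_functional_def)

lemma square_sup_bound:
  assumes "finite A" "A \<noteq> {}" "\<bar>x\<bar> \<le> K *\<^sub>R u"
  shows "f (square_sup u A x) \<le> K\<^sup>2 * f u"
proof -
  have "square_sup u A x \<le> K\<^sup>2 *\<^sub>R u"
  proof (rule square_sup_least[OF assms(1,2)])
    fix a
    have "(2 * a) *\<^sub>R x \<le> \<bar>2 * a\<bar> *\<^sub>R \<bar>x\<bar>" by (rule scaleR_le_abs)
    also have "\<dots> \<le> \<bar>2 * a\<bar> *\<^sub>R (K *\<^sub>R u)" by (rule scaleR_left_mono[OF assms(3)]) simp
    finally have "(2 * a) *\<^sub>R x - a\<^sup>2 *\<^sub>R u \<le> (\<bar>2 * a\<bar> * K - a\<^sup>2) *\<^sub>R u"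
      by (simp add: scaleR_left_diff_distrib)
    also have "\<dots> \<le> K\<^sup>2 *\<^sub>R u"
    proof (rule scaleR_right_mono[OF _ u])
      have "0 \<le> (\<bar>a\<bar> - K)\<^sup>2" by simp
      then show "\<bar>2 * a\<bar> * K - a\<^sup>2 \<le> K\<^sup>2" by (simp add: power2_diff abs_mult mult.commute mult.left_commute)
    qed
    finally show "(2 * a) *\<^sub>R x - a\<^sup>2 *\<^sub>R u \<le> K\<^sup>2 *\<^sub>R u" .
  qed
  then have "f (square_sup u A x) \<le> f (K\<^sup>2 *\<^sub>R u)" by (rule positive_functional_mono[OF f])
  then show ?thesis using linear_scale[OF lin] by simp
qed

lemma square_form_upper:
  assumes "x \<in> order_ideal u" "finite A" "A \<noteq> {}"
  shows "f (square_sup u A x) \<le> square_form f u x"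
  unfolding square_form_def
proof (rule cSUP_upper)
  obtain K where "\<bar>x\<bar> \<le> K *\<^sub>R u" using assms(1) by (auto simp: order_ideal_def)
  then show "bdd_above ((\<lambda>A. f (square_sup u A x)) ` {A. finite A \<and> A \<noteq> {}})"
    using square_sup_bound by (intro bdd_aboveI2) auto
qed (use assms in auto)

lemma square_form_least:
  "(\<And>A. finite A \<Longrightarrow> A \<noteq> {} \<Longrightarrow> f (square_sup u A x) \<le> b) \<Longrightarrow> square_form f u x \<le> b"
  unfolding square_form_def by (intro cSUP_least) auto

lemma square_form_bound: "\<bar>x\<bar> \<le> K *\<^sub>R u \<Longrightarrow> square_form f u x \<le> K\<^sup>2 * f u"
  by (intro square_form_least square_sup_bound)

lemma square_form_nonneg: "x \<in> order_ideal u \<Longrightarrow> 0 \<le> square_form f u x"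
  using square_form_upper[of x "{0}"] linear_0[OF lin] by (simp add: square_sup_def)

lemma square_form_scale_le:
  assumes x: "x \<in> order_ideal u" and "0 < r"
  shows "square_form f u (r *\<^sub>R x) \<le> r\<^sup>2 * square_form f u x"
proof (rule square_form_least)
  fix A :: "real set" assume A: "finite A" "A \<noteq> {}"
  have "square_sup u A (r *\<^sub>R x) \<le> r\<^sup>2 *\<^sub>R square_sup u ((\<lambda>a. a / r) ` A) x"
  proof (rule square_sup_least[OF A])
    fix a assume "a \<in> A"
    have "(2 * a) *\<^sub>R r *\<^sub>R x - a\<^sup>2 *\<^sub>R u = r\<^sup>2 *\<^sub>R ((2 * (a / r)) *\<^sub>R x - (a / r)\<^sup>2 *\<^sub>R u)"
      using \<open>0 < r\<close> by (simp add: scaleR_right_diff_distrib power2_eq_square)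
    also have "\<dots> \<le> r\<^sup>2 *\<^sub>R square_sup u ((\<lambda>a. a / r) ` A) x"
      using A \<open>a \<in> A\<close> by (intro scaleR_left_mono square_sup_upper) auto
    finally show "(2 * a) *\<^sub>R r *\<^sub>R x - a\<^sup>2 *\<^sub>R u \<le> r\<^sup>2 *\<^sub>R square_sup u ((\<lambda>a. a / r) ` A) x" .
  qed
  then have "f (square_sup u A (r *\<^sub>R x)) \<le> r\<^sup>2 * f (square_sup u ((\<lambda>a. a / r) ` A) x)"
    using positive_functional_mono[OF f] linear_scale[OF lin] by (metis real_scaleR_def)
  also have "\<dots> \<le> r\<^sup>2 * square_form f u x"
    using A by (intro mult_left_mono square_form_upper x) auto
  finally show "f (square_sup u A (r *\<^sub>R x)) \<le> r\<^sup>2 * square_form f u x" .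
qed

lemma square_form_minus_le:
  assumes x: "x \<in> order_ideal u"
  shows "square_form f u (- x) \<le> square_form f u x"
proof (rule square_form_least)
  fix A :: "real set" assume A: "finite A" "A \<noteq> {}"
  have "square_sup u A (- x) \<le> square_sup u (uminus ` A) x"
  proof (rule square_sup_least[OF A])
    fix a assume "a \<in> A"
    then show "(2 * a) *\<^sub>R (- x) - a\<^sup>2 *\<^sub>R u \<le> square_sup u (uminus ` A) x"
      using square_sup_upper[of "uminus ` A" "- a" x u] A by simp
  qed
  then have "f (square_sup u A (- x)) \<le> f (square_sup u (uminus ` A) x)"
    by (rule positive_functional_mono[OF f])
  also have "\<dots> \<le> square_form f u x" using A by (intro square_form_upper x) auto
  finally show "f (square_sup u A (- x)) \<le> square_form f u x" .
qed

lemma square_form_minus: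
  assumes "x \<in> order_ideal u"
  shows "square_form f u (- x) = square_form f u x"
  using square_form_minus_le[OF assms] square_form_minus_le[OF order_ideal_minus[OF assms]]
  by simp

text \<open>The tangents add up according to
  \<open>(2 (a + b) (x + y) - (a + b)\<^sup>2 u) + (2 (a - b) (x - y) - (a - b)\<^sup>2 u) = 2 ((2 a x - a\<^sup>2 u) + (2 b y - b\<^sup>2 u))\<close>.\<close>

lemma square_form_parallelogram_le:
  assumes x: "x \<in> order_ideal u" and y: "y \<in> order_ideal u"
  shows "2 * (square_form f u x + square_form f u y)
    \<le> square_form f u (x + y) + square_form f u (x - y)"
proof -
  define S where "S = square_form f u (x + y) + square_form f u (x - y)"
  have key: "2 * (f (square_sup u A x) + f (square_sup u B y)) \<le> S"
    if A: "finite A" "A \<noteq> {}" and B: "finite B" "B \<noteq> {}" for A B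
  proof -
    define C D where "C = (\<lambda>(a, b). a + b) ` (A \<times> B)" and "D = (\<lambda>(a, b). a - b) ` (A \<times> B)"
    have CD: "finite C" "C \<noteq> {}" "finite D" "D \<noteq> {}" using A B by (auto simp: C_def D_def)
    define Z where "Z = square_sup u C (x + y) + square_sup u D (x - y)"
    have "square_sup u A x \<le> (1/2) *\<^sub>R Z - square_sup u B y"
    proof (rule square_sup_least[OF A])
      fix a assume a: "a \<in> A"
      have "square_sup u B y \<le> (1/2) *\<^sub>R Z - ((2 * a) *\<^sub>R x - a\<^sup>2 *\<^sub>R u)"
      proof (rule square_sup_least[OF B])
        fix b assume b: "b \<in> B"
        have "a + b \<in> C" "a - b \<in> D" using a b by (auto simp: C_def D_def)
        then have "((2 * (a + b)) *\<^sub>R (x + y) - (a + b)\<^sup>2 *\<^sub>R u) +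
            ((2 * (a - b)) *\<^sub>R (x - y) - (a - b)\<^sup>2 *\<^sub>R u) \<le> Z"
          unfolding Z_def using CD by (intro add_mono square_sup_upper) auto
        also have "((2 * (a + b)) *\<^sub>R (x + y) - (a + b)\<^sup>2 *\<^sub>R u) +
            ((2 * (a - b)) *\<^sub>R (x - y) - (a - b)\<^sup>2 *\<^sub>R u)
          = 2 *\<^sub>R (((2 * a) *\<^sub>R x - a\<^sup>2 *\<^sub>R u) + ((2 * b) *\<^sub>R y - b\<^sup>2 *\<^sub>R u))"
          by (simp add: algebra_simps power2_eq_square flip: scaleR_2)
        finally have "(1/2) *\<^sub>R (2 *\<^sub>R (((2 * a) *\<^sub>R x - a\<^sup>2 *\<^sub>R u) + ((2 * b) *\<^sub>R y - b\<^sup>2 *\<^sub>R u)))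
            \<le> (1/2) *\<^sub>R Z" by (rule scaleR_left_mono) simp
        then have "((2 * a) *\<^sub>R x - a\<^sup>2 *\<^sub>R u) + ((2 * b) *\<^sub>R y - b\<^sup>2 *\<^sub>R u) \<le> (1/2) *\<^sub>R Z"
          by (simp only: scaleR_scaleR) simp
        then show "(2 * b) *\<^sub>R y - b\<^sup>2 *\<^sub>R u \<le> (1/2) *\<^sub>R Z - ((2 * a) *\<^sub>R x - a\<^sup>2 *\<^sub>R u)"
          by (simp only: le_diff_eq add.commute)
      qed
      then show "(2 * a) *\<^sub>R x - a\<^sup>2 *\<^sub>R u \<le> (1/2) *\<^sub>R Z - square_sup u B y"
        by (simp only: le_diff_eq add.commute)
    qed
    then have "square_sup u A x + square_sup u B y \<le> (1/2) *\<^sub>R Z"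
      by (simp only: le_diff_eq)
    from positive_functional_mono[OF f this]
    have "2 * (f (square_sup u A x) + f (square_sup u B y)) \<le> f Z"
      by (simp add: linear_add[OF lin] linear_scale[OF lin])
    also have "f Z \<le> S" unfolding Z_def S_def linear_add[OF lin]
      using CD by (intro add_mono square_form_upper order_ideal_add order_ideal_diff x y) auto
    finally show ?thesis .
  qed
  have "square_form f u x \<le> S / 2 - square_form f u y"
  proof (rule square_form_least)
    fix A :: "real set" assume A: "finite A" "A \<noteq> {}"
    have "square_form f u y \<le> S / 2 - f (square_sup u A x)"
      using key[OF A] by (intro square_form_least) (force simp: field_simps)
    then show "f (square_sup u A x) \<le> S / 2 - square_form f u y" by simp
  qed
  then show ?thesis unfolding S_def by argo
qed

text \<open>Applying the inequality to \<open>x + y\<close> and \<open>x - y\<close> gives the converse one.\<close>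

lemma square_form_parallelogram:
  assumes x: "x \<in> order_ideal u" and y: "y \<in> order_ideal u"
  shows "square_form f u (x + y) + square_form f u (x - y)
    = 2 * (square_form f u x + square_form f u y)"
proof (rule antisym)
  have "2 * (square_form f u (x + y) + square_form f u (x - y))
      \<le> square_form f u (2 *\<^sub>R x) + square_form f u (2 *\<^sub>R y)"
    using square_form_parallelogram_le[OF order_ideal_add[OF x y] order_ideal_diff[OF x y]]
    by (simp add: scaleR_2)
  also have "\<dots> \<le> 4 * square_form f u x + 4 * square_form f u y"
    using square_form_scale_le[OF x, of 2] square_form_scale_le[OF y, of 2] by simp
  finally show "square_form f u (x + y) + square_form f u (x - y)
      \<le> 2 * (square_form f u x + square_form f u y)" by simp
qed (rule square_form_parallelogram_le[OF x y])

text \<open>The Cauchy-Schwarz inequality \<open>(f \<bar>x\<bar>)\<^sup>2 \<le> f (x\<^sup>2 / u) f u\<close>, before optimising over \<open>a\<close>. Only the tangents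
  at \<open>a\<close> and \<open>- a\<close> are involved.\<close>

lemma square_form_abs:
  assumes x: "x \<in> order_ideal u" and a: "0 < a"
  shows "2 * a * f \<bar>x\<bar> \<le> square_form f u x + a\<^sup>2 * f u"
proof -
  define s where "s = square_sup u {a, - a} x"
  have "(2 * a) *\<^sub>R x - a\<^sup>2 *\<^sub>R u \<le> s" "(2 * - a) *\<^sub>R x - (- a)\<^sup>2 *\<^sub>R u \<le> s"
    unfolding s_def by (intro square_sup_upper; simp)+
  then have s: "(2 * a) *\<^sub>R x \<le> s + a\<^sup>2 *\<^sub>R u" "(2 * a) *\<^sub>R (- x) \<le> s + a\<^sup>2 *\<^sub>R u"
    by (simp_all add: algebra_simps)
  have "\<bar>x\<bar> \<le> inverse (2 * a) *\<^sub>R (s + a\<^sup>2 *\<^sub>R u)"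
    using s[THEN scaleR_left_mono, of "inverse (2 * a)"] a by (intro abs_leI) simp_all
  then have "(2 * a) *\<^sub>R \<bar>x\<bar> \<le> (2 * a) *\<^sub>R (inverse (2 * a) *\<^sub>R (s + a\<^sup>2 *\<^sub>R u))"
    using a by (intro scaleR_left_mono) auto
  then have "(2 * a) *\<^sub>R \<bar>x\<bar> \<le> s + a\<^sup>2 *\<^sub>R u" using a by simp
  from positive_functional_mono[OF f this]
  have "2 * a * f \<bar>x\<bar> \<le> f s + a\<^sup>2 * f u"
    by (simp add: linear_add[OF lin] linear_scale[OF lin])
  also have "f s \<le> square_form f u x" unfolding s_def by (intro square_form_upper x) auto
  finally show ?thesis by simp
qed

text \<open>Four times the bilinear form that belongs to the quadratic form.\<close>

definition polar_form :: "'a \<Rightarrow> 'a \<Rightarrow> real" where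
  "polar_form x y = square_form f u (x + y) - square_form f u (x - y)"

lemma polar_form_sym:
  assumes x: "x \<in> order_ideal u" and y: "y \<in> order_ideal u"
  shows "polar_form x y = polar_form y x"
  using square_form_minus[OF order_ideal_diff[OF x y]] by (simp add: polar_form_def add.commute)

lemma polar_form_minus_right: "polar_form x (- y) = - polar_form x y"
  by (simp add: polar_form_def)

text \<open>The additive part of the theorem of Jordan and von Neumann; since only signed sums occur below,
  additivity suffices.\<close>

lemma polar_form_add:
  assumes x: "x \<in> order_ideal u" and y: "y \<in> order_ideal u" and z: "z \<in> order_ideal u"
  shows "polar_form (x + y) z = polar_form x z + polar_form y z"
proof -
  note I = order_ideal_add order_ideal_diff order_ideal_zero
  have half: "2 * (polar_form x z + polar_form y z) = polar_form (x + y) (2 *\<^sub>R z)"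
    if x: "x \<in> order_ideal u" and y: "y \<in> order_ideal u" for x y
  proof -
    have "(x + z) + (y + z) = (x + y) + 2 *\<^sub>R z" "(x + z) - (y + z) = x - y"
      "(x - z) + (y - z) = (x + y) - 2 *\<^sub>R z" "(x - z) - (y - z) = x - y"
      by (simp_all add: scaleR_2)
    note eqs = this
    show ?thesis
      using square_form_parallelogram[OF I(1)[OF x z] I(1)[OF y z]]
        square_form_parallelogram[OF I(2)[OF x z] I(2)[OF y z]]
      unfolding polar_form_def eqs by argo
  qed
  have "polar_form 0 z = 0" using square_form_minus[OF z] by (simp add: polar_form_def)
  then have "2 * polar_form (x + y) z = polar_form (x + y) (2 *\<^sub>R z)"
    using half[OF I(1)[OF x y] I(3)] by simp
  with half[OF x y] show ?thesis by simp
qed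

lemma square_form_add:
  assumes x: "x \<in> order_ideal u" and y: "y \<in> order_ideal u"
  shows "square_form f u (x + y)
    = square_form f u x + square_form f u y + polar_form x y / 2"
  using square_form_parallelogram[OF assms] unfolding polar_form_def by argo

lemma polar_form_bound:
  assumes x: "\<bar>x\<bar> \<le> K *\<^sub>R u" and y: "\<bar>y\<bar> \<le> L *\<^sub>R u"
  shows "\<bar>polar_form x y\<bar> \<le> (K + L)\<^sup>2 * f u"
proof -
  have I: "x \<in> order_ideal u" "y \<in> order_ideal u" using x y by (auto simp: order_ideal_def)
  have "\<bar>x + y\<bar> \<le> (K + L) *\<^sub>R u" "\<bar>x - y\<bar> \<le> (K + L) *\<^sub>R u"
    using abs_triangle_ineq[of x y] abs_triangle_ineq[of x "- y"] add_mono[OF x y]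
    by (auto simp: scaleR_add_left intro: order_trans)
  then show ?thesis
    using square_form_bound square_form_nonneg[OF order_ideal_add[OF I]]
      square_form_nonneg[OF order_ideal_diff[OF I]]
    unfolding polar_form_def by (smt (verit))
qed

text \<open>Almost orthogonality makes the squares add up, whatever the signs are.\<close>

lemma square_form_signed_sum:
  fixes d :: "nat \<Rightarrow> 'a" and \<epsilon> :: "nat \<Rightarrow> real"
  assumes d: "\<And>i. i < n \<Longrightarrow> \<bar>d i\<bar> \<le> K *\<^sub>R u"
    and orth: "\<And>i j. i < j \<Longrightarrow> j < n \<Longrightarrow> \<bar>polar_form (d i) (d j)\<bar> \<le> \<eta>"
    and \<epsilon>: "\<And>i. \<epsilon> i = 1 \<or> \<epsilon> i = - 1" and "0 \<le> \<eta>"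
  shows "square_form f u (\<Sum>i<n. \<epsilon> i *\<^sub>R d i) \<le> n * (K\<^sup>2 * f u) + n\<^sup>2 * \<eta>"
proof -
  have dI: "\<epsilon> i *\<^sub>R d i \<in> order_ideal u" if "i < n" for i
    using d[OF that] \<epsilon>[of i] by (auto simp: order_ideal_def)
  have sumI: "(\<Sum>i<m. \<epsilon> i *\<^sub>R d i) \<in> order_ideal u" if "m \<le> n" for m
    using that
  proof (induction m)
    case (Suc m)
    then show ?case using order_ideal_add[OF _ dI[of m]] by simp
  qed (simp add: order_ideal_zero)
  have polar: "\<bar>polar_form (\<Sum>i<m. \<epsilon> i *\<^sub>R d i) (\<epsilon> j *\<^sub>R d j)\<bar> \<le> m * \<eta>"
    if "m \<le> j" "j < n" for m j
    using that
  proof (induction m)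
    case 0
    have "polar_form 0 (\<epsilon> j *\<^sub>R d j) = 0"
      using square_form_minus[OF dI[OF \<open>j < n\<close>]] by (simp add: polar_form_def)
    then show ?case by simp
  next
    case (Suc m)
    have "\<bar>polar_form (\<epsilon> m *\<^sub>R d m) (\<epsilon> j *\<^sub>R d j)\<bar> \<le> \<eta>"
    proof -
      have I: "d m \<in> order_ideal u" "d j \<in> order_ideal u" "- d j \<in> order_ideal u"
        using d[of m] d[of j] Suc.prems by (auto simp: order_ideal_def)
      have "\<bar>polar_form (\<epsilon> m *\<^sub>R d m) (\<epsilon> j *\<^sub>R d j)\<bar> = \<bar>polar_form (d m) (d j)\<bar>"
        using \<epsilon>[of m] \<epsilon>[of j] polar_form_sym[OF order_ideal_minus[OF I(1)] I(2)]
          polar_form_sym[OF order_ideal_minus[OF I(1)] I(3)] polar_form_sym[OF I(1,2)]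
        by (auto simp: polar_form_minus_right)
      then show ?thesis using orth[of m j] Suc.prems by simp
    qed
    moreover have "polar_form (\<Sum>i<Suc m. \<epsilon> i *\<^sub>R d i) (\<epsilon> j *\<^sub>R d j)
      = polar_form (\<Sum>i<m. \<epsilon> i *\<^sub>R d i) (\<epsilon> j *\<^sub>R d j) + polar_form (\<epsilon> m *\<^sub>R d m) (\<epsilon> j *\<^sub>R d j)"
      using polar_form_add[OF sumI dI dI] Suc.prems by simp
    ultimately show ?case using Suc by (simp add: algebra_simps)
  qed
  have "square_form f u (\<Sum>i<m. \<epsilon> i *\<^sub>R d i) \<le> m * (K\<^sup>2 * f u) + m\<^sup>2 * \<eta>" if "m \<le> n" for m
    using that
  proof (induction m)
    case 0
    then show ?case using square_form_bound[of 0 0] by simp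
  next
    case (Suc m)
    have "square_form f u (\<epsilon> m *\<^sub>R d m) \<le> K\<^sup>2 * f u"
      using d[of m] \<epsilon>[of m] Suc.prems by (intro square_form_bound) auto
    moreover have "square_form f u (\<Sum>i<Suc m. \<epsilon> i *\<^sub>R d i) = square_form f u (\<Sum>i<m. \<epsilon> i *\<^sub>R d i)
        + square_form f u (\<epsilon> m *\<^sub>R d m) + polar_form (\<Sum>i<m. \<epsilon> i *\<^sub>R d i) (\<epsilon> m *\<^sub>R d m) / 2"
      using square_form_add[OF sumI dI] Suc.prems by simp
    moreover have "polar_form (\<Sum>i<m. \<epsilon> i *\<^sub>R d i) (\<epsilon> m *\<^sub>R d m) \<le> m * \<eta>"
      using polar[of m m] Suc.prems by simp
    ultimately have "square_form f u (\<Sum>i<Suc m. \<epsilon> i *\<^sub>R d i)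
        \<le> (m * (K\<^sup>2 * f u) + m\<^sup>2 * \<eta>) + K\<^sup>2 * f u + m * \<eta> / 2"
      using Suc.IH Suc.prems by simp
    also have "\<dots> \<le> Suc m * (K\<^sup>2 * f u) + (real (Suc m))\<^sup>2 * \<eta>"
    proof -
      have "0 \<le> real m * \<eta>" using \<open>0 \<le> \<eta>\<close> by simp
      then show ?thesis using \<open>0 \<le> \<eta>\<close> by (simp add: power2_eq_square algebra_simps)
    qed
    finally show ?case .
  qed
  then show ?thesis by simp
qed

end

section \<open>Operators with values in a principal ideal\<close>

text \<open>The next difference is found by the pigeonhole principle: the values of finitely many
  functionals \<open>polar_form f u d\<close> at the \<open>y n\<close> are bounded, so two of the \<open>y n\<close> agree for all of them up
  to \<open>\<eta>\<close>.\<close>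

lemma almost_orthogonal_differences:
  fixes y :: "nat \<Rightarrow> 'a::banach_lattice"
  assumes f: "positive_functional f" and u: "0 \<le> u" and y: "\<And>n. \<bar>y n\<bar> \<le> u" and "0 < \<eta>"
  obtains d :: "nat \<Rightarrow> 'a" where "\<And>i. \<exists>m n. m \<noteq> n \<and> d i = y m - y n"
    "\<And>i j. i < j \<Longrightarrow> \<bar>polar_form f u (d i) (d j)\<bar> \<le> (\<eta>::real)"
proof -
  have yI: "y n \<in> order_ideal u" for n
    using y[of n] by (auto simp: order_ideal_def intro: exI[of _ 1])
  have pick: "\<exists>m n. m \<noteq> n \<and> (\<forall>d\<in>D. \<bar>polar_form f u d (y m - y n)\<bar> \<le> \<eta>)"
    if D: "finite D" "D \<subseteq> order_ideal u" for D
  proof -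
    define cell where "cell n = restrict (\<lambda>d. \<lfloor>polar_form f u d (y n) / \<eta>\<rfloor>) D" for n
    have "\<exists>M. \<forall>n. \<lfloor>polar_form f u d (y n) / \<eta>\<rfloor> \<in> {- M..M}" if dD: "d \<in> D" for d
    proof -
      obtain K where K: "\<bar>d\<bar> \<le> K *\<^sub>R u" using D dD by (auto simp: order_ideal_def)
      define b where "b = (K + 1)\<^sup>2 * f u / \<eta>"
      have bd: "\<bar>polar_form f u d (y n) / \<eta>\<bar> \<le> b" for n
        using polar_form_bound[OF f u K, of "y n" 1] y[of n] \<open>0 < \<eta>\<close>
        by (simp add: b_def abs_divide divide_right_mono)
      have "- \<lceil>b\<rceil> \<le> \<lfloor>polar_form f u d (y n) / \<eta>\<rfloor>" "\<lfloor>polar_form f u d (y n) / \<eta>\<rfloor> \<le> \<lceil>b\<rceil>" for n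
        using bd[of n] by linarith+
      then show ?thesis by (intro exI[of _ "\<lceil>b\<rceil>"]) simp
    qed
    then obtain M where M: "\<And>d n. d \<in> D \<Longrightarrow> \<lfloor>polar_form f u d (y n) / \<eta>\<rfloor> \<in> {- M d..M d}"
      by metis
    have "range cell \<subseteq> (\<Pi>\<^sub>E d\<in>D. {- M d..M d})" using M by (auto simp: cell_def PiE_def)
    moreover have "finite (\<Pi>\<^sub>E d\<in>D. {- M d..M d})" using D by (intro finite_PiE) auto
    ultimately have "finite (range cell)" by (rule finite_subset)
    then have "\<not> inj cell" using finite_imageD by blast
    then obtain m n where mn: "m \<noteq> n" "cell m = cell n" by (auto simp: inj_def)
    have "\<bar>polar_form f u d (y m - y n)\<bar> \<le> \<eta>" if "d \<in> D" for d
    proof -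
      have "\<lfloor>polar_form f u d (y m) / \<eta>\<rfloor> = \<lfloor>polar_form f u d (y n) / \<eta>\<rfloor>"
        using fun_cong[OF mn(2), of d] that by (simp add: cell_def)
      then have "\<bar>polar_form f u d (y m) / \<eta> - polar_form f u d (y n) / \<eta>\<bar> < 1" by linarith
      then have le: "\<bar>polar_form f u d (y m) - polar_form f u d (y n)\<bar> < \<eta>"
        using \<open>0 < \<eta>\<close> by (simp flip: diff_divide_distrib)
      have dI: "d \<in> order_ideal u" using D that by blast
      have "polar_form f u d (y m - y n) = polar_form f u (y m + - y n) d"
        using polar_form_sym[OF f u dI order_ideal_diff[OF yI yI]] by simp
      also have "\<dots> = polar_form f u (y m) d + polar_form f u (- y n) d"
        by (rule polar_form_add[OF f u yI order_ideal_minus[OF yI] dI])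
      also have "\<dots> = polar_form f u d (y m) - polar_form f u d (y n)"
        using polar_form_sym[OF f u dI yI] polar_form_sym[OF f u dI order_ideal_minus[OF yI]]
        by (simp add: polar_form_minus_right[OF f u])
      finally show ?thesis using le by simp
    qed
    with mn(1) show ?thesis by blast
  qed
  define good where "good d n r \<longleftrightarrow> (\<exists>m k. m \<noteq> k \<and> r = y m - y k) \<and>
      (\<forall>i<n. \<bar>polar_form f u (d i) r\<bar> \<le> \<eta>)" for d :: "nat \<Rightarrow> 'a" and n :: nat and r
  have "\<exists>d. \<forall>n. good d n (d n)"
  proof (rule dependent_wellorder_choice)
    fix n :: nat and d assume prev: "\<And>i. i < n \<Longrightarrow> good d i (d i)"
    have "d ` {..<n} \<subseteq> order_ideal u"
    proof
      fix z assume "z \<in> d ` {..<n}"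
      then obtain i where "i < n" "z = d i" by auto
      with prev[of i] show "z \<in> order_ideal u" by (auto simp: good_def intro!: order_ideal_diff yI)
    qed
    from pick[OF _ this] obtain m k where "m \<noteq> k"
      "\<forall>z\<in>d ` {..<n}. \<bar>polar_form f u z (y m - y k)\<bar> \<le> \<eta>" by auto
    then have "good d n (y m - y k)" by (auto simp: good_def)
    then show "\<exists>r. good d n r" by blast
  qed (simp add: good_def)
  then obtain d where "\<And>n. good d n (d n)" by blast
  then show ?thesis by (intro that[of d]) (auto simp: good_def)
qed

text \<open>The supremum of the signed sums over all choices of signs is the sum of the absolute values.\<close>

lemma sum_abs_le_of_signed_sums:
  fixes a :: "nat \<Rightarrow> 'a::banach_lattice"
  assumes "\<And>\<epsilon> :: nat \<Rightarrow> real. (\<And>i. \<epsilon> i = 1 \<or> \<epsilon> i = - 1) \<Longrightarrow> (\<Sum>i<n. \<epsilon> i *\<^sub>R a i) \<le> b"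
  shows "(\<Sum>i<n. \<bar>a i\<bar>) \<le> b"
  using assms
proof (induction n arbitrary: b)
  case 0
  then show ?case using 0[of "\<lambda>_. 1"] by simp
next
  case (Suc n)
  have *: "(\<Sum>i<n. \<bar>a i\<bar>) \<le> b - s *\<^sub>R a n" if s: "s = 1 \<or> s = - 1" for s :: real
  proof (rule Suc.IH)
    fix \<epsilon> :: "nat \<Rightarrow> real" assume "\<And>i. \<epsilon> i = 1 \<or> \<epsilon> i = - 1"
    then have "(\<Sum>i<Suc n. (\<epsilon>(n := s)) i *\<^sub>R a i) \<le> b" using s by (intro Suc.prems) auto
    then show "(\<Sum>i<n. \<epsilon> i *\<^sub>R a i) \<le> b - s *\<^sub>R a n" by (simp add: le_diff_eq)
  qed
  from *[of 1] *[of "- 1"] have "\<bar>a n\<bar> \<le> b - (\<Sum>i<n. \<bar>a i\<bar>)"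
    by (intro abs_leI) (simp_all add: algebra_simps)
  then show ?case by (simp add: algebra_simps)
qed

lemma separated_sequence:
  fixes S :: "'a::metric_space set"
  assumes "\<not> (\<exists>k. finite k \<and> S \<subseteq> (\<Union>x\<in>k. ball x e))"
  obtains s :: "nat \<Rightarrow> 'a" where "\<And>n. s n \<in> S" "\<And>m n. m \<noteq> n \<Longrightarrow> e \<le> dist (s m) (s n)"
proof -
  let ?Q = "\<lambda>x n r. r \<in> S \<and> (\<forall>m<n::nat. e \<le> dist (x m) r)"
  have "\<exists>x. \<forall>n. ?Q x n (x n)"
  proof (rule dependent_wellorder_choice)
    fix n :: nat and x :: "nat \<Rightarrow> 'a"
    have "\<not> S \<subseteq> (\<Union>z\<in>x ` {..<n}. ball z e)" using assms by blast
    then show "\<exists>r. ?Q x n r" by (auto simp: subset_iff not_less)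
  qed simp
  then obtain x where x: "\<And>n. ?Q x n (x n)" by blast
  show ?thesis
  proof (rule that)
    show "e \<le> dist (x m) (x n)" if "m \<noteq> n" for m n
      using that x[of n] x[of m] by (cases m n rule: linorder_cases) (auto simp: dist_commute)
  qed (use x in blast)
qed

text \<open>The estimate that drives the proof is \<open>\<bar>R x\<bar> \<le> C \<parallel>x\<parallel> u\<close>: a bound for the norm of all signed averages of
  the \<open>d\<^sub>i\<close> becomes a bound in the order for all signed averages of the \<open>R d\<^sub>i\<close>, and so for the average
  of the \<open>\<bar>R d\<^sub>i\<bar>\<close>. The functional \<open>f1\<close> detects separated images, \<open>f2\<close> provides the Hilbert norm.\<close>

theorem order_interval_image_totally_bounded:
  fixes R :: "'a::order_continuous_banach_lattice \<Rightarrow> 'a"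
  assumes R: "linear R" and u: "0 \<le> u" and C: "0 < C"
    and bound: "\<And>x. \<bar>R x\<bar> \<le> (C * norm x) *\<^sub>R u" and e: "0 < e"
  shows "\<exists>k. finite k \<and> R ` {y. \<bar>y\<bar> \<le> u} \<subseteq> (\<Union>x\<in>k. ball x e)"
proof (rule ccontr)
  assume "\<not> ?thesis"
  then obtain s :: "nat \<Rightarrow> 'a" where s: "\<And>n. s n \<in> R ` {y. \<bar>y\<bar> \<le> u}" "\<And>m n. m \<noteq> n \<Longrightarrow> e \<le> dist (s m) (s n)"
    by (rule separated_sequence) blast
  then have "\<forall>n. \<exists>y. \<bar>y\<bar> \<le> u \<and> s n = R y" by (auto simp: image_iff)
  then obtain y where y: "\<And>n. \<bar>y n\<bar> \<le> u" "\<And>n. s n = R (y n)" by metis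
  have diff: "\<bar>y m - y n\<bar> \<le> 2 *\<^sub>R u" for m n
    using abs_triangle_ineq[of "y m" "- y n"] add_mono[OF y(1)[of m] y(1)[of n]]
    by (simp add: scaleR_2)
  \<comment> \<open>All \<open>\<bar>R (y m - y n)\<bar>\<close> lie in \<open>[0, c u]\<close>.\<close>
  define c where "c = C * (2 * norm u)"
  have "0 \<le> c" using C by (simp add: c_def)
  obtain f1 \<delta>1 where f1: "positive_functional f1" "0 < \<delta>1"
    "\<And>x. 0 \<le> x \<Longrightarrow> x \<le> c *\<^sub>R u \<Longrightarrow> f1 x < \<delta>1 \<Longrightarrow> norm x < e"
    by (rule control_functional[OF e, of "c *\<^sub>R u"]) blast
  have f1_lin: "linear f1" using f1(1) bounded_linear.linear by (auto simp: positive_functional_def)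
  have f1u: "0 \<le> f1 u" using f1(1) u by (simp add: positive_functional_def)
  have big: "\<delta>1 \<le> f1 \<bar>R (y m - y n)\<bar>" if "m \<noteq> n" for m n
  proof (rule ccontr)
    assume "\<not> ?thesis"
    then have less: "f1 \<bar>R (y m - y n)\<bar> < \<delta>1" by simp
    have "norm (y m - y n) \<le> norm (2 *\<^sub>R u)"
      using norm_mono_nonneg[OF abs_ge_zero diff[of m n]] by simp
    then have "C * norm (y m - y n) \<le> c" using C by (simp add: c_def)
    then have "\<bar>R (y m - y n)\<bar> \<le> c *\<^sub>R u"
      using bound[of "y m - y n"] u by (meson order_trans scaleR_right_mono)
    then have "norm \<bar>R (y m - y n)\<bar> < e" using less by (intro f1(3)) auto
    then show False using s(2)[OF that] by (simp add: dist_norm y(2) linear_diff[OF R])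
  qed
  \<comment> \<open>An average of norm below \<open>\<gamma>\<close> has an image below \<open>C \<gamma> u\<close>, where \<open>f1\<close> is less than \<open>\<delta>1\<close>.\<close>
  define \<gamma> where "\<gamma> = \<delta>1 / (2 * (C * f1 u + 1))"
  have Cf: "0 \<le> C * f1 u" using C f1u by simp
  have \<gamma>: "0 < \<gamma>" using f1(2) Cf by (simp add: \<gamma>_def)
  have \<gamma>C: "C * \<gamma> * f1 u < \<delta>1"
  proof -
    have "(C * f1 u) * \<delta>1 < (2 * (C * f1 u + 1)) * \<delta>1"
      using f1(2) Cf by (intro mult_strict_right_mono) auto
    then show ?thesis using Cf by (simp add: \<gamma>_def field_simps)
  qed
  obtain f2 \<delta>2 where f2: "positive_functional f2" "0 < \<delta>2"
    "\<And>x. 0 \<le> x \<Longrightarrow> x \<le> 2 *\<^sub>R u \<Longrightarrow> f2 x < \<delta>2 \<Longrightarrow> norm x < \<gamma>"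
    by (rule control_functional[OF \<gamma>, of "2 *\<^sub>R u"]) blast
  have f2u: "0 \<le> f2 u" using f2(1) u by (simp add: positive_functional_def)
  \<comment> \<open>The parameter of \<open>square_form_abs\<close>: a square form below \<open>a \<delta>2\<close> forces \<open>f2 \<bar>x\<bar> < \<delta>2\<close>. The numbers
    \<open>\<eta>\<close> and \<open>N\<close> make the square form of an average of \<open>N\<close> vectors that small.\<close>
  define a where "a = \<delta>2 / (f2 u + 1)"
  have a: "0 < a" "a * f2 u < \<delta>2" using f2(2) f2u by (simp_all add: a_def field_simps)
  define \<eta> where "\<eta> = a * \<delta>2 / 2"
  have \<eta>: "0 < \<eta>" using a f2(2) by (simp add: \<eta>_def)
  obtain N :: nat where N: "8 * f2 u / (a * \<delta>2) < real N" using reals_Archimedean2 by blast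
  have "0 \<le> 8 * f2 u / (a * \<delta>2)" using a f2(2) f2u by simp
  with N have N0: "0 < real N" by linarith
  obtain d :: "nat \<Rightarrow> 'a" where d: "\<And>i. \<exists>m n. m \<noteq> n \<and> d i = y m - y n"
    "\<And>i j. i < j \<Longrightarrow> \<bar>polar_form f2 u (d i) (d j)\<bar> \<le> \<eta>"
    by (rule almost_orthogonal_differences[of f2 u y \<eta>, OF f2(1) u y(1) \<eta>]) blast
  have d2: "\<bar>d i\<bar> \<le> 2 *\<^sub>R u" for i using d(1)[of i] diff by auto
  have signed: "(\<Sum>i<N. \<epsilon> i *\<^sub>R R (d i)) \<le> (real N * (C * \<gamma>)) *\<^sub>R u"
    if \<epsilon>: "\<And>i. \<epsilon> i = 1 \<or> \<epsilon> i = - 1" for \<epsilon> :: "nat \<Rightarrow> real"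
  proof -
    define S where "S = (\<Sum>i<N. \<epsilon> i *\<^sub>R d i)"
    define x where "x = (1 / real N) *\<^sub>R S"
    have "\<bar>S\<bar> \<le> (\<Sum>i<n. 2 *\<^sub>R u)" if "n = N" for n
    proof -
      have "\<bar>\<Sum>i<n. \<epsilon> i *\<^sub>R d i\<bar> \<le> (\<Sum>i<n. 2 *\<^sub>R u)" for n
      proof (induction n)
        case (Suc n)
        have "\<bar>\<epsilon> n *\<^sub>R d n\<bar> \<le> 2 *\<^sub>R u" using \<epsilon>[of n] d2[of n] by auto
        with Suc show ?case
          using abs_triangle_ineq[of "\<Sum>i<n. \<epsilon> i *\<^sub>R d i" "\<epsilon> n *\<^sub>R d n"]
          by (simp only: sum.lessThan_Suc) (meson add_mono order_trans)
      qed simp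
      then show ?thesis using that by (simp only: S_def)
    qed
    then have absS: "\<bar>S\<bar> \<le> real N *\<^sub>R (2 *\<^sub>R u)" by (simp add: sum_constant_scaleR)
    have absx: "\<bar>x\<bar> \<le> 2 *\<^sub>R u"
    proof -
      have "\<bar>x\<bar> \<le> (1 / real N) *\<^sub>R \<bar>S\<bar>" using abs_scaleR_le[of "1 / real N" S] by (simp add: x_def)
      also have "\<dots> \<le> (1 / real N) *\<^sub>R (real N *\<^sub>R (2 *\<^sub>R u))" by (rule scaleR_left_mono[OF absS]) simp
      finally show ?thesis using N0 by simp
    qed
    have SI: "S \<in> order_ideal u" using absS unfolding order_ideal_def scaleR_scaleR by blast
    have xI: "x \<in> order_ideal u" using absx by (auto simp: order_ideal_def)
    have "square_form f2 u x \<le> (1 / real N)\<^sup>2 * square_form f2 u S"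
      unfolding x_def using N0 by (intro square_form_scale_le f2(1) u SI) simp
    also have "\<dots> \<le> (1 / real N)\<^sup>2 * (real N * (2\<^sup>2 * f2 u) + (real N)\<^sup>2 * \<eta>)"
      unfolding S_def using d(2) d2 \<epsilon> \<eta>
      by (intro mult_left_mono square_form_signed_sum[OF f2(1) u]) auto
    also have "\<dots> = 4 * f2 u / real N + \<eta>" using N0 by (simp add: power2_eq_square field_simps)
    also have "\<dots> < a * \<delta>2"
    proof -
      have "8 * f2 u < real N * (a * \<delta>2)" using N a f2(2) by (simp add: pos_divide_less_eq)
      then have "4 * f2 u / real N < a * \<delta>2 / 2" using N0 by (simp add: pos_divide_less_eq mult.commute)
      then show ?thesis by (simp add: \<eta>_def)
    qed
    finally have "square_form f2 u x < a * \<delta>2" .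
    with square_form_abs[OF f2(1) u xI a(1)]
    have "2 * a * f2 \<bar>x\<bar> < a * \<delta>2 + a\<^sup>2 * f2 u" by linarith
    also have "\<dots> \<le> a * \<delta>2 + a * \<delta>2"
      using a by (simp add: power2_eq_square mult.assoc)
    finally have "f2 \<bar>x\<bar> < \<delta>2" using a(1) by simp
    then have "norm \<bar>x\<bar> < \<gamma>" by (intro f2(3) absx) auto
    then have "C * norm x \<le> C * \<gamma>" using C by simp
    then have "R x \<le> (C * \<gamma>) *\<^sub>R u"
      using bound[of x] u abs_ge_self[of "R x"] by (meson order_trans scaleR_right_mono)
    then have "real N *\<^sub>R R x \<le> real N *\<^sub>R ((C * \<gamma>) *\<^sub>R u)" by (rule scaleR_left_mono) simp
    moreover have "real N *\<^sub>R R x = (\<Sum>i<N. \<epsilon> i *\<^sub>R R (d i))"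
      using N0 by (simp add: x_def S_def linear_sum[OF R] linear_scale[OF R])
    ultimately show ?thesis by simp
  qed
  have "(\<Sum>i<N. \<bar>R (d i)\<bar>) \<le> (real N * (C * \<gamma>)) *\<^sub>R u"
    by (rule sum_abs_le_of_signed_sums[OF signed])
  from positive_functional_mono[OF f1(1) this]
  have "(\<Sum>i<N. f1 \<bar>R (d i)\<bar>) \<le> real N * (C * \<gamma> * f1 u)"
    by (simp add: linear_sum[OF f1_lin] linear_scale[OF f1_lin])
  moreover have "(\<Sum>i<N. \<delta>1) \<le> (\<Sum>i<N. f1 \<bar>R (d i)\<bar>)"
    using d(1) big by (intro sum_mono) metis
  ultimately have "real N * \<delta>1 \<le> real N * (C * \<gamma> * f1 u)" by simp
  with N0 \<gamma>C show False by simp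
qed

section \<open>Bounded complex linear operators\<close>

interpretation cvs: vector_space "scaleC :: complex \<Rightarrow> 'a::complex_normed_vector \<Rightarrow> 'a"
  by (rule vector_space_scaleC)

lemma scaleC_scaleR_commute: "c *\<^sub>C r *\<^sub>R x = r *\<^sub>R c *\<^sub>C (x::'a::complex_normed_vector)"
  by (simp add: scaleC_scaleC mult.commute flip: scaleC_of_real)

lemma bounded_bilinear_scaleC:
  "bounded_bilinear (scaleC :: complex \<Rightarrow> 'a::complex_normed_vector \<Rightarrow> 'a)"
proof
  show "(r *\<^sub>R a) *\<^sub>C b = r *\<^sub>R (a *\<^sub>C b)" for r a and b :: 'a
    by (simp add: scaleR_conv_of_real flip: scaleC_scaleC scaleC_of_real)
  show "\<exists>K. \<forall>a (b::'a). norm (a *\<^sub>C b) \<le> norm a * norm b * K"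
    by (intro exI[of _ 1]) (simp add: norm_scaleC)
qed (simp_all add: scaleC_add_left scaleC_add_right scaleC_scaleR_commute)

lemma bounded_clinear_iff:
  "bounded_clinear f \<longleftrightarrow> bounded_linear f \<and> (\<forall>c x. f (c *\<^sub>C x) = c *\<^sub>C f x)"
  unfolding bounded_clinear_def
proof safe
  assume "Vector_Spaces.linear (*\<^sub>C) (*\<^sub>C) f"
  then interpret Vector_Spaces.linear "(*\<^sub>C)" "(*\<^sub>C)" f .
  show "f (c *\<^sub>C x) = c *\<^sub>C f x" for c x
    by (rule scale)
next
  assume f: "bounded_linear f" "\<forall>c x. f (c *\<^sub>C x) = c *\<^sub>C f x"
  interpret bounded_linear f by fact
  show "Vector_Spaces.linear (*\<^sub>C) (*\<^sub>C) f"
    by unfold_locales (use f(2) in \<open>auto simp: add\<close>)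
qed

lemma bounded_clinearD:
  assumes "bounded_clinear f"
  shows "bounded_linear f" "f (c *\<^sub>C x) = c *\<^sub>C f x" "f (x + y) = f x + f y"
    "f (x - y) = f x - f y" "f 0 = 0" "f (- x) = - f x"
  using assms by (auto simp: bounded_clinear_iff linear_simps bounded_linear.linear linear_0 linear_neg)

lemma bounded_clinearI:
  assumes "\<And>x y. f (x + y) = f x + f y" "\<And>c x. f (c *\<^sub>C x) = c *\<^sub>C f x"
    "\<And>x. norm (f x) \<le> norm x * K"
  shows "bounded_clinear f"
  unfolding bounded_clinear_iff
  using assms(2)[of "of_real r" for r]
  by (auto intro!: bounded_linear_intro[where K = K] simp: assms scaleC_of_real)

lemma bounded_clinear_bound:
  assumes "bounded_clinear f"
  obtains K where "0 < K" "\<And>x. norm (f x) \<le> K * norm x"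
  using bounded_linear.pos_bounded[OF bounded_clinearD(1)[OF assms]] by (auto simp: mult.commute)

lemma bounded_clinear_id: "bounded_clinear (\<lambda>x. x)"
  by (simp add: bounded_clinear_iff)

lemma bounded_clinear_zero: "bounded_clinear (\<lambda>x. 0)"
  by (simp add: bounded_clinear_iff)

lemma bounded_clinear_add:
  "bounded_clinear f \<Longrightarrow> bounded_clinear g \<Longrightarrow> bounded_clinear (\<lambda>x. f x + g x)"
  by (simp add: bounded_clinear_iff bounded_linear_add scaleC_add_right)

lemma bounded_clinear_diff:
  "bounded_clinear f \<Longrightarrow> bounded_clinear g \<Longrightarrow> bounded_clinear (\<lambda>x. f x - g x)"
  by (simp add: bounded_clinear_iff bounded_linear_sub cvs.scale_right_diff_distrib)

lemma bounded_clinear_compose: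
  "bounded_clinear f \<Longrightarrow> bounded_clinear g \<Longrightarrow> bounded_clinear (\<lambda>x. f (g x))"
  by (simp add: bounded_clinear_iff bounded_linear_compose)

lemma bounded_clinear_scaleC:
  "bounded_clinear f \<Longrightarrow> bounded_clinear (\<lambda>x. c *\<^sub>C f x)"
  by (auto simp: bounded_clinear_iff scaleC_scaleC mult.commute
      intro: bounded_bilinear.bounded_linear_right[OF bounded_bilinear_scaleC, THEN bounded_linear_compose])

lemma bounded_clinear_sum:
  "(\<And>i. i \<in> I \<Longrightarrow> bounded_clinear (f i)) \<Longrightarrow> bounded_clinear (\<lambda>x. \<Sum>i\<in>I. f i x)"
  by (induction I rule: infinite_finite_induct) (auto intro: bounded_clinear_zero bounded_clinear_add)

lemma bounded_clinear_funpow: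
  fixes f :: "'a::complex_normed_vector \<Rightarrow> 'a"
  shows "bounded_clinear f \<Longrightarrow> bounded_clinear (f ^^ n)"
proof (induction n)
  case 0
  then show ?case using bounded_clinear_id by (simp add: bounded_clinear_iff id_def)
next
  case (Suc n)
  then show ?case using bounded_clinear_compose[of f "f ^^ n"] by (simp add: o_def)
qed

section \<open>Compactness of the square of an ideal-valued operator\<close>

lemma totally_bounded_imp_compact_closure:
  fixes S :: "'a::complete_space set"
  assumes "\<And>e. 0 < e \<Longrightarrow> \<exists>k. finite k \<and> S \<subseteq> (\<Union>x\<in>k. ball x e)"
  shows "compact (closure S)"
  unfolding compact_eq_totally_bounded
proof (intro conjI allI impI)
  show "complete (closure S)" by (simp add: complete_eq_closed)
  fix e :: real assume "0 < e"
  then obtain k where k: "finite k" "S \<subseteq> (\<Union>x\<in>k. ball x (e/2))" using assms[of "e/2"] by auto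
  have "closure S \<subseteq> (\<Union>x\<in>k. cball x (e/2))"
  proof (rule closure_minimal)
    show "S \<subseteq> (\<Union>x\<in>k. cball x (e/2))" using k(2) by (force simp: subset_iff)
    show "closed (\<Union>x\<in>k. cball x (e/2))" using k(1) by (intro closed_UN) auto
  qed
  also have "\<dots> \<subseteq> (\<Union>x\<in>k. ball x e)" using \<open>0 < e\<close> by (force simp: subset_iff)
  finally show "\<exists>k. finite k \<and> closure S \<subseteq> (\<Union>x\<in>k. ball x e)" using k(1) by blast
qed

lemma tendsto_Complexify:
  assumes "(f \<longlongrightarrow> a) F" "(g \<longlongrightarrow> b) F"
  shows "((\<lambda>x. Complexify (f x) (g x)) \<longlongrightarrow> Complexify a b) F"
proof (rule LIM_zero_cancel, rule Lim_null_comparison)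
  show "\<forall>\<^sub>F x in F. norm (Complexify (f x) (g x) - Complexify a b) \<le> norm (f x - a) + norm (g x - b)"
    using norm_le_parts[of "Complexify (f x) (g x) - Complexify a b" for x]
    by (intro always_eventually allI) (simp add: parts_simps)
  show "((\<lambda>x. norm (f x - a) + norm (g x - b)) \<longlongrightarrow> 0) F"
    using tendsto_add[OF tendsto_norm_zero[OF LIM_zero[OF assms(1)]]
        tendsto_norm_zero[OF LIM_zero[OF assms(2)]]] by simp
qed

text \<open>The real and imaginary parts of \<open>F\<close> on the real lattice are real operators \<open>R1\<close> and \<open>R2\<close> to which the
  previous results apply. The first application of \<open>F\<close> maps the unit ball into an order interval
  in each part, the second maps order intervals to relatively compact sets.\<close>

lemma ideal_valued_square_compact:
  fixes F :: "'a::order_continuous_banach_lattice complexification \<Rightarrow> 'a complexification"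
  assumes F: "bounded_clinear F" and u: "0 \<le> u" and ran: "range F \<subseteq> principal_ideal u"
  shows "compact_operator (F \<circ> F)"
proof -
  interpret F: bounded_linear F by (rule bounded_clinearD(1)[OF F])
  define R1 R2 where "R1 x = rpart (F (Complexify x 0))" and "R2 x = ipart (F (Complexify x 0))" for x
  have emb: "bounded_linear (\<lambda>x::'a. Complexify x 0)"
    using norm_le_parts[of "Complexify x 0" for x :: 'a]
    by (intro bounded_linear_intro[where K = 1])
      (auto simp: complexification_eq_iff parts_simps)
  have rp: "bounded_linear (rpart :: 'a complexification \<Rightarrow> 'a)"
    and ip: "bounded_linear (ipart :: 'a complexification \<Rightarrow> 'a)"
    using norm_rpart_le norm_ipart_le
    by (auto intro!: bounded_linear_intro[where K = 1] simp: parts_simps)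
  have lin: "bounded_linear R1" "bounded_linear R2"
    unfolding R1_def R2_def
    by (intro bounded_linear_compose[OF rp] bounded_linear_compose[OF ip]
        bounded_linear_compose[OF F.bounded_linear_axioms] emb)+
  have F_parts: "F z = Complexify (R1 (rpart z) - R2 (ipart z)) (R2 (rpart z) + R1 (ipart z))" for z
  proof -
    have "z = Complexify (rpart z) 0 + \<i> *\<^sub>C Complexify (ipart z) 0"
      by (simp add: complexification_eq_iff parts_simps)
    then have "F z = F (Complexify (rpart z) 0) + \<i> *\<^sub>C F (Complexify (ipart z) 0)"
      by (metis F.add bounded_clinearD(2)[OF F])
    then show ?thesis by (simp add: complexification_eq_iff parts_simps R1_def R2_def)
  qed
  have ob: "\<exists>c. \<bar>R1 x\<bar> \<le> c *\<^sub>R u" "\<exists>c. \<bar>R2 x\<bar> \<le> c *\<^sub>R u" for x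
  proof -
    obtain c where c: "modulus (F (Complexify x 0)) \<le> c *\<^sub>R u"
      using ran by (auto simp: principal_ideal_def)
    show "\<exists>c. \<bar>R1 x\<bar> \<le> c *\<^sub>R u" "\<exists>c. \<bar>R2 x\<bar> \<le> c *\<^sub>R u"
      unfolding R1_def R2_def
      using order_trans[OF abs_rpart_le_modulus c] order_trans[OF abs_ipart_le_modulus c] by blast+
  qed
  obtain C1 where C1: "0 < C1" "\<And>x. \<bar>R1 x\<bar> \<le> (C1 * norm x) *\<^sub>R u"
    using order_bounded_bound[OF lin(1) u ob(1)] by blast
  obtain C2 where C2: "0 < C2" "\<And>x. \<bar>R2 x\<bar> \<le> (C2 * norm x) *\<^sub>R u"
    using order_bounded_bound[OF lin(2) u ob(2)] by blast
  define v where "v = (1 + C1 + C2) *\<^sub>R u"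
  have v0: "0 \<le> v" unfolding v_def using C1(1) C2(1) u by (intro scaleR_nonneg_nonneg) auto
  have uv: "u \<le> v"
    using scaleR_right_mono[of 1 "1 + C1 + C2" u] C1 C2 u by (simp add: v_def)
  have K: "compact (closure (R ` {y. \<bar>y\<bar> \<le> v}))"
    if lin: "bounded_linear R" and C: "0 < C" and bd: "\<And>x. \<bar>R x\<bar> \<le> (C * norm x) *\<^sub>R u" for R C
  proof (rule totally_bounded_imp_compact_closure)
    fix e :: real assume "0 < e"
    have "\<bar>R x\<bar> \<le> (C * norm x) *\<^sub>R v" for x
      using bd[of x] scaleR_left_mono[OF uv, of "C * norm x"] C by (simp add: order_trans)
    then show "\<exists>k. finite k \<and> R ` {y. \<bar>y\<bar> \<le> v} \<subseteq> (\<Union>x\<in>k. ball x e)"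
      using \<open>0 < e\<close> C
      by (intro order_interval_image_totally_bounded[OF bounded_linear.linear[OF lin] v0])
  qed
  define K1 K2 where "K1 = closure (R1 ` {y. \<bar>y\<bar> \<le> v})" and "K2 = closure (R2 ` {y. \<bar>y\<bar> \<le> v})"
  have K12: "compact K1" "compact K2"
    unfolding K1_def K2_def using K[OF lin(1) C1] K[OF lin(2) C2] by auto
  define M where "M = (\<lambda>w. Complexify (fst (fst w) - fst (snd w)) (snd (snd w) + snd (fst w)))
    ` ((K1 \<times> K1) \<times> (K2 \<times> K2))"
  have "compact M"
    unfolding M_def
  proof (rule compact_continuous_image)
    show "continuous_on ((K1 \<times> K1) \<times> (K2 \<times> K2))
      (\<lambda>w. Complexify (fst (fst w) - fst (snd w)) (snd (snd w) + snd (fst w)))"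
      unfolding continuous_on_def by (intro ballI tendsto_Complexify tendsto_intros)
  qed (intro compact_Times K12)
  have FF: "F (F z) \<in> M" if z: "norm z \<le> 1" for z
  proof -
    have part: "\<bar>R1 x\<bar> \<le> C1 *\<^sub>R u" "\<bar>R2 x\<bar> \<le> C2 *\<^sub>R u" if "norm x \<le> 1" for x
    proof -
      have "(C1 * norm x) *\<^sub>R u \<le> C1 *\<^sub>R u" "(C2 * norm x) *\<^sub>R u \<le> C2 *\<^sub>R u"
        using that C1(1) C2(1) u by (auto intro!: scaleR_right_mono simp: mult_le_cancel_left1)
      then show "\<bar>R1 x\<bar> \<le> C1 *\<^sub>R u" "\<bar>R2 x\<bar> \<le> C2 *\<^sub>R u"
        using C1(2)[of x] C2(2)[of x] by (auto intro: order_trans)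
    qed
    have z1: "norm (rpart z) \<le> 1" "norm (ipart z) \<le> 1"
      using z norm_rpart_le[of z] norm_ipart_le[of z] by auto
    define a b where "a = rpart (F z)" and "b = ipart (F z)"
    have a: "a = R1 (rpart z) - R2 (ipart z)" and b: "b = R2 (rpart z) + R1 (ipart z)"
      by (simp_all add: a_def b_def F_parts[of z])
    have "C1 *\<^sub>R u + C2 *\<^sub>R u \<le> v"
      using u by (simp add: v_def algebra_simps)
    moreover have "\<bar>a\<bar> \<le> C1 *\<^sub>R u + C2 *\<^sub>R u"
      using abs_triangle_ineq[of "R1 (rpart z)" "- R2 (ipart z)"]
        add_mono[OF part(1)[OF z1(1)] part(2)[OF z1(2)]] by (simp add: a)
    moreover have "\<bar>b\<bar> \<le> C1 *\<^sub>R u + C2 *\<^sub>R u"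
      using abs_triangle_ineq[of "R2 (rpart z)" "R1 (ipart z)"]
        add_mono[OF part(2)[OF z1(1)] part(1)[OF z1(2)]] by (simp add: b add.commute)
    ultimately have ab: "\<bar>a\<bar> \<le> v" "\<bar>b\<bar> \<le> v" by (auto intro: order_trans)
    have "R1 a \<in> K1" "R1 b \<in> K1" "R2 a \<in> K2" "R2 b \<in> K2"
      unfolding K1_def K2_def using ab by (auto intro!: subsetD[OF closure_subset])
    moreover have "F (F z) = Complexify (R1 a - R2 b) (R2 a + R1 b)"
      by (simp add: F_parts[of "F z"] a_def b_def)
    ultimately show ?thesis unfolding M_def
      by (intro image_eqI[of _ _ "((R1 a, R1 b), (R2 b, R2 a))"]) auto
  qed
  have sub: "closure ((F \<circ> F) ` cball 0 1) \<subseteq> M"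
  proof (rule closure_minimal)
    show "(F \<circ> F) ` cball 0 1 \<subseteq> M" using FF by (simp add: image_subset_iff)
  qed (rule compact_imp_closed[OF \<open>compact M\<close>])
  have "compact (closure ((F \<circ> F) ` cball 0 1))"
    using compact_Int_closed[OF \<open>compact M\<close> closed_closure, of "(F \<circ> F) ` cball 0 1"]
    by (simp only: Int_absorb1[OF sub])
  then show ?thesis
    using bounded_clinear_compose[OF F F] by (simp add: compact_operator_def o_def)
qed

section \<open>Riesz theory for operators with a commuting parametrix\<close>

text \<open>Compactness in terms of sequences, for real linear maps. The Riesz theory below uses only the
  real linear structure.\<close>

definition compact_map :: "('a::real_normed_vector \<Rightarrow> 'b::real_normed_vector) \<Rightarrow> bool" where
  "compact_map K \<longleftrightarrow> (\<forall>x M. (\<forall>n. norm (x n) \<le> M) \<longrightarrow>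
     (\<exists>l r. strict_mono (r :: nat \<Rightarrow> nat) \<and> (\<lambda>n. K (x (r n))) \<longlonglongrightarrow> l))"

lemma compact_mapD:
  fixes x :: "nat \<Rightarrow> 'a::real_normed_vector"
  assumes "compact_map K" "\<And>n. norm (x n) \<le> M"
  obtains l r where "strict_mono (r :: nat \<Rightarrow> nat)" "(\<lambda>n. K (x (r n))) \<longlonglongrightarrow> l"
proof -
  from assms have "\<exists>l r. strict_mono (r :: nat \<Rightarrow> nat) \<and> (\<lambda>n. K (x (r n))) \<longlonglongrightarrow> l"
    unfolding compact_map_def by (elim allE[of _ x]) blast
  with that show ?thesis by blast
qed

lemma compact_map_not_separated:
  fixes x :: "nat \<Rightarrow> 'a::real_normed_vector"
  assumes "compact_map K" "\<And>n. norm (x n) \<le> M" "0 < e"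
    and sep: "\<And>m n. m < n \<Longrightarrow> e \<le> norm (K (x n) - K (x m))"
  shows False
proof -
  obtain l r where r: "strict_mono (r :: nat \<Rightarrow> nat)" "(\<lambda>n. K (x (r n))) \<longlonglongrightarrow> l"
    by (rule compact_mapD[of K x, OF assms(1,2)])
  have "Cauchy (\<lambda>n. K (x (r n)))" using r(2) by (rule LIMSEQ_imp_Cauchy)
  then obtain N where N: "\<And>m n. N \<le> m \<Longrightarrow> N \<le> n \<Longrightarrow> norm (K (x (r m)) - K (x (r n))) < e"
    using CauchyD[OF _ \<open>0 < e\<close>] by blast
  have "r N < r (Suc N)" using r(1) by (simp add: strict_mono_def)
  from sep[OF this] N[of "Suc N" N] show False by simp
qed

lemma compact_map_add:
  fixes K :: "'a::real_normed_vector \<Rightarrow> 'b::real_normed_vector"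
  assumes K: "compact_map K" and K': "compact_map K'"
  shows "compact_map (\<lambda>x. K x + K' x)"
  unfolding compact_map_def
proof (intro allI impI)
  fix x :: "nat \<Rightarrow> 'a" and M :: real assume x: "\<forall>n. norm (x n) \<le> M"
  obtain l r where r: "strict_mono (r :: nat \<Rightarrow> nat)" "(\<lambda>n. K (x (r n))) \<longlonglongrightarrow> l"
    using compact_mapD[OF K] x by blast
  obtain l' r' where r': "strict_mono (r' :: nat \<Rightarrow> nat)" "(\<lambda>n. K' (x (r (r' n)))) \<longlonglongrightarrow> l'"
    using compact_mapD[OF K', of "\<lambda>n. x (r n)" M] x by blast
  have "(\<lambda>n. K (x (r (r' n))) + K' (x (r (r' n)))) \<longlonglongrightarrow> l + l'"
    using LIMSEQ_subseq_LIMSEQ[OF r(2) r'(1)] r'(2) by (intro tendsto_add) (auto simp: o_def)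
  with strict_mono_o[OF r(1) r'(1)]
  show "\<exists>l r. strict_mono (r :: nat \<Rightarrow> nat) \<and> (\<lambda>n. K (x (r n)) + K' (x (r n))) \<longlonglongrightarrow> l"
    by (intro exI[of _ "l + l'"] exI[of _ "r \<circ> r'"]) (simp add: o_def)
qed

lemma compact_map_sandwich:
  fixes W :: "'a::real_normed_vector \<Rightarrow> 'b::real_normed_vector"
  assumes K: "compact_map K" and L: "bounded_linear L" and W: "bounded_linear W"
  shows "compact_map (\<lambda>x. L (K (W x)))"
  unfolding compact_map_def
proof (intro allI impI)
  interpret L: bounded_linear L by fact
  interpret W: bounded_linear W by fact
  fix x :: "nat \<Rightarrow> 'a" and M :: real assume x: "\<forall>n. norm (x n) \<le> M"
  obtain B where B: "0 < B" "\<And>x. norm (W x) \<le> norm x * B" using W.pos_bounded by blast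
  have Wx: "norm (W (x n)) \<le> M * B" for n
    using B(2)[of "x n"] x B(1) by (meson mult_right_mono less_imp_le order_trans)
  obtain l r where r: "strict_mono (r :: nat \<Rightarrow> nat)" "(\<lambda>n. K (W (x (r n)))) \<longlonglongrightarrow> l"
    using compact_mapD[of K "\<lambda>n. W (x n)", OF K Wx] by blast
  from L.tendsto[OF this(2)] r(1)
  show "\<exists>l r. strict_mono (r :: nat \<Rightarrow> nat) \<and> (\<lambda>n. L (K (W (x (r n))))) \<longlonglongrightarrow> l" by blast
qed

lemma compact_map_zero: "compact_map (\<lambda>x. 0)"
  unfolding compact_map_def
  by (intro allI impI exI[of _ 0] exI[of _ "\<lambda>n::nat. n"]) (simp add: strict_mono_def)

text \<open>So \<open>L\<close> is invertible modulo compact operators, with an inverse that commutes with it. The classical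
  case is \<open>W = I\<close>, where \<open>L\<close> is the identity minus a compact operator. All of the Riesz theory carries
  over because kernels and ranges of the powers of \<open>L\<close> are invariant under \<open>L \<circ> W\<close>.\<close>

definition parametrix :: "('a::real_normed_vector \<Rightarrow> 'a) \<Rightarrow> ('a \<Rightarrow> 'a) \<Rightarrow> bool" where
  "parametrix L W \<longleftrightarrow> bounded_linear L \<and> bounded_linear W \<and> (\<forall>x. L (W x) = W (L x)) \<and>
     compact_map (\<lambda>x. x - L (W x))"

lemma bounded_linear_funpow:
  fixes f :: "'a::real_normed_vector \<Rightarrow> 'a"
  shows "bounded_linear f \<Longrightarrow> bounded_linear (f ^^ n)"
proof (induction n)
  case 0
  then show ?case using bounded_linear_ident by (simp add: id_def)
next
  case (Suc n)
  then show ?case using bounded_linear_compose[of f "f ^^ n"] by (simp add: o_def)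
qed

lemma funpow_commute:
  assumes "\<And>x. X (f x) = f (X x)"
  shows "X ((f ^^ n) x) = (f ^^ n) (X x)"
  by (induction n) (simp_all add: assms)

lemma parametrix_funpow:
  assumes "parametrix L W"
  shows "parametrix (L ^^ n) (W ^^ n)"
proof -
  have L: "bounded_linear L" and W: "bounded_linear W" and c: "L (W x) = W (L x)"
    and K: "compact_map (\<lambda>x. x - L (W x))" for x
    using assms by (auto simp: parametrix_def)
  have "compact_map (\<lambda>x. x - (L ^^ n) ((W ^^ n) x))"
  proof (induction n)
    case 0
    then show ?case by (simp add: compact_map_zero)
  next
    case (Suc n)
    interpret Ln: bounded_linear "L ^^ n" by (rule bounded_linear_funpow[OF L])
    have "(\<lambda>x. x - (L ^^ Suc n) ((W ^^ Suc n) x)) = (\<lambda>x. (x - (L ^^ n) ((W ^^ n) x))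
        + (L ^^ n) ((W ^^ n) x - L (W ((W ^^ n) x))))"
      by (rule ext) (simp add: Ln.diff funpow_swap1)
    then show ?case
      using compact_map_add[OF Suc compact_map_sandwich[OF K bounded_linear_funpow[OF L]
            bounded_linear_funpow[OF W], of n n]] by simp
  qed
  moreover have "(L ^^ n) ((W ^^ n) x) = (W ^^ n) ((L ^^ n) x)" for x
    by (intro funpow_commute funpow_commute[symmetric] c)
  ultimately show ?thesis
    by (simp add: parametrix_def bounded_linear_funpow L W)
qed

text \<open>Write \<open>x\<close> as \<open>(x - L (W x)) + W (L x)\<close>: the first part is compact, the second one converges.\<close>

lemma parametrix_convergent:
  fixes x :: "nat \<Rightarrow> 'a::real_normed_vector"
  assumes p: "parametrix L W" and x: "\<And>n. norm (x n) \<le> M" and Lx: "(\<lambda>n. L (x n)) \<longlonglongrightarrow> y"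
  obtains l r where "strict_mono (r :: nat \<Rightarrow> nat)" "(\<lambda>n. x (r n)) \<longlonglongrightarrow> l" "L l = y"
proof -
  interpret L: bounded_linear L using p by (simp add: parametrix_def)
  interpret W: bounded_linear W using p by (simp add: parametrix_def)
  obtain l r where r: "strict_mono (r :: nat \<Rightarrow> nat)" "(\<lambda>n. x (r n) - L (W (x (r n)))) \<longlonglongrightarrow> l"
    using compact_mapD[of "\<lambda>x. x - L (W x)" x M, OF _ x] p unfolding parametrix_def by blast
  have Lr: "(\<lambda>n. L (x (r n))) \<longlonglongrightarrow> y" using LIMSEQ_subseq_LIMSEQ[OF Lx r(1)] by (simp add: o_def)
  have "(\<lambda>n. (x (r n) - L (W (x (r n)))) + W (L (x (r n)))) \<longlonglongrightarrow> l + W y"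
    by (intro tendsto_add r W.tendsto Lr)
  then have "(\<lambda>n. x (r n)) \<longlonglongrightarrow> l + W y" using p by (simp add: parametrix_def)
  moreover from L.tendsto[OF this] have "L (l + W y) = y" using Lr LIMSEQ_unique by blast
  ultimately show ?thesis using r(1) that by blast
qed

text \<open>Otherwise there are unit vectors in \<open>R\<close> whose images tend to \<open>0\<close>. A subsequence converges to a
  unit vector of \<open>R\<close> in the kernel.\<close>

lemma parametrix_bounded_below:
  assumes p: "parametrix L W" and R: "closed R" "subspace R"
    and inj: "\<And>x. x \<in> R \<Longrightarrow> L x = 0 \<Longrightarrow> x = 0"
  obtains c where "\<And>x. x \<in> R \<Longrightarrow> norm x \<le> c * norm (L x)"
proof (rule ccontr)
  interpret L: bounded_linear L using p by (simp add: parametrix_def)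
  note found = that
  assume contra: "\<not> thesis"
  have "\<exists>x. x \<in> R \<and> real (Suc k) * norm (L x) < norm x" for k
  proof (rule ccontr)
    assume "\<not> ?thesis"
    then have "\<And>x. x \<in> R \<Longrightarrow> norm x \<le> real (Suc k) * norm (L x)" by (auto simp: not_less)
    from found[OF this] contra show False by contradiction
  qed
  then obtain x where x: "\<And>k. x k \<in> R" "\<And>k. real (Suc k) * norm (L (x k)) < norm (x k)" by metis
  have x0: "0 < norm (x k)" for k
    using x(2)[of k] by (smt (verit) mult_nonneg_nonneg norm_ge_zero of_nat_0_le_iff)
  define z where "z k = (1 / norm (x k)) *\<^sub>R x k" for k
  have zR: "z k \<in> R" and z1: "norm (z k) = 1" for k
    using x(1) R(2) x0[of k] by (auto simp: z_def subspace_scale)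
  have "norm (L (z k)) \<le> 1 / real (Suc k)" for k
    using x(2)[of k] x0[of k] by (simp add: z_def L.scaleR field_simps)
  then have Lz: "(\<lambda>k. L (z k)) \<longlonglongrightarrow> 0"
    using LIMSEQ_inverse_real_of_nat
    by (intro Lim_null_comparison[of "\<lambda>k. L (z k)" "\<lambda>k. inverse (real (Suc k))"])
      (auto simp: inverse_eq_divide)
  obtain l r where l: "strict_mono (r :: nat \<Rightarrow> nat)" "(\<lambda>n. z (r n)) \<longlonglongrightarrow> l" "L l = 0"
    by (rule parametrix_convergent[OF p _ Lz, of 1]) (auto simp: z1)
  have "l \<in> R" using zR by (intro closed_sequentially[OF R(1) _ l(2)]) simp
  with inj l(3) have "l = 0" by blast
  moreover have "norm l = 1"
    using tendsto_norm[OF l(2)] by (simp add: z1 LIMSEQ_const_iff)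
  ultimately show False by simp
qed

lemma riesz_lemma:
  fixes V :: "'a::real_normed_vector set"
  assumes V: "closed V" "subspace V" and U: "subspace U" "V \<subseteq> U" and a: "a \<in> U" "a \<notin> V"
  obtains x where "x \<in> U" "norm x = 1" "\<And>v. v \<in> V \<Longrightarrow> 1/2 \<le> norm (x - v)"
proof -
  have ne: "V \<noteq> {}" using subspace_0[OF V(2)] by blast
  define d where "d = infdist a V"
  have d: "0 < d"
    using a(2) V(1) ne infdist_nonneg[of a V] by (auto simp: d_def less_le in_closed_iff_infdist_zero)
  obtain v0 where v0: "v0 \<in> V" "dist a v0 < 2 * d"
  proof -
    have "\<exists>v\<in>V. dist a v < 2 * d"
    proof (rule ccontr)
      assume "\<not> ?thesis"
      then have "2 * d \<le> infdist a V" using ne by (auto simp: infdist_def not_less intro: cINF_greatest)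
      with d show False by (simp add: d_def)
    qed
    then show ?thesis using that by blast
  qed
  define s where "s = norm (a - v0)"
  have s: "0 < s" "s < 2 * d" using v0 a(2) by (auto simp: s_def dist_norm)
  show ?thesis
  proof (rule that[of "(1/s) *\<^sub>R (a - v0)"])
    show "(1/s) *\<^sub>R (a - v0) \<in> U"
      using U v0(1) a(1) by (intro subspace_scale subspace_diff) auto
    show "norm ((1/s) *\<^sub>R (a - v0)) = 1" using s by (simp add: s_def)
    fix v assume "v \<in> V"
    have "v0 + s *\<^sub>R v \<in> V" using V(2) v0(1) \<open>v \<in> V\<close> by (intro subspace_add subspace_scale)
    then have "d \<le> norm (a - (v0 + s *\<^sub>R v))"
      unfolding d_def using infdist_le[of "v0 + s *\<^sub>R v" V a] by (simp add: dist_norm)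
    also have "a - (v0 + s *\<^sub>R v) = s *\<^sub>R ((1/s) *\<^sub>R (a - v0) - v)"
      using s by (simp add: algebra_simps)
    also have "norm \<dots> = s * norm ((1/s) *\<^sub>R (a - v0) - v)" using s by simp
    finally have "s * (1/2) \<le> s * norm ((1/s) *\<^sub>R (a - v0) - v)" using s by linarith
    then show "1/2 \<le> norm ((1/s) *\<^sub>R (a - v0) - v)" using s by (simp only: mult_le_cancel_left_pos)
  qed
qed

lemma subspace_kernel_bounded_linear:
  assumes "bounded_linear f"
  shows "subspace {x. f x = 0}"
proof -
  interpret bounded_linear f by fact
  show ?thesis by (simp add: subspace_def zero add scaleR)
qed

lemma subspace_kernel_funpow:
  fixes f :: "'a::real_normed_vector \<Rightarrow> 'a"
  shows "bounded_linear f \<Longrightarrow> subspace {x. (f ^^ n) x = 0}"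
  by (intro subspace_kernel_bounded_linear bounded_linear_funpow)

lemma subspace_range_funpow:
  fixes f :: "'a::real_normed_vector \<Rightarrow> 'a"
  shows "bounded_linear f \<Longrightarrow> subspace (range (f ^^ n))"
  by (intro linear_subspace_image bounded_linear.linear bounded_linear_funpow subspace_UNIV)

lemma closed_kernel: "bounded_linear f \<Longrightarrow> closed {x. f x = 0}"
  by (intro closed_Collect_eq linear_continuous_on continuous_on_const)

text \<open>If the kernels of the powers increased strictly, Riesz's lemma would give unit vectors \<open>x\<^sub>n\<close> in
  the kernel of \<open>L\<^sup>n\<^sup>+\<^sup>1\<close> at distance at least \<open>1/2\<close> from the kernel of \<open>L\<^sup>n\<close>. Their images under the compact
  map \<open>I - L W\<close> would be separated by \<open>1/2\<close>.\<close>

lemma parametrix_ascent: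
  assumes p: "parametrix L W"
  obtains n where "\<And>k x. (L ^^ (n + k)) x = 0 \<Longrightarrow> (L ^^ n) x = 0"
proof -
  interpret L: bounded_linear L using p by (simp add: parametrix_def)
  have LW: "L (W x) = W (L x)" for x using p by (simp add: parametrix_def)
  have W: "bounded_linear W" using p by (simp add: parametrix_def)
  have "\<exists>n. \<forall>x. (L ^^ Suc n) x = 0 \<longrightarrow> (L ^^ n) x = 0"
  proof (rule ccontr)
    assume "\<not> ?thesis"
    then have ex: "\<forall>n. \<exists>a. (L ^^ Suc n) a = 0 \<and> (L ^^ n) a \<noteq> 0" by blast
    have "\<exists>x. (L ^^ Suc n) x = 0 \<and> norm x = 1 \<and> (\<forall>v. (L ^^ n) v = 0 \<longrightarrow> 1/2 \<le> norm (x - v))" for n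
    proof -
      obtain a where a: "(L ^^ Suc n) a = 0" "(L ^^ n) a \<noteq> 0" using ex by blast
      have "{x. (L ^^ n) x = 0} \<subseteq> {x. (L ^^ Suc n) x = 0}" by (auto simp: L.zero)
      then obtain x where "x \<in> {x. (L ^^ Suc n) x = 0}" "norm x = 1"
        "\<And>v. v \<in> {x. (L ^^ n) x = 0} \<Longrightarrow> 1/2 \<le> norm (x - v)"
        using riesz_lemma[of "{x. (L ^^ n) x = 0}" "{x. (L ^^ Suc n) x = 0}" a] a
          closed_kernel[OF bounded_linear_funpow[OF L.bounded_linear_axioms, of n]]
          subspace_kernel_funpow[OF L.bounded_linear_axioms, of n]
          subspace_kernel_funpow[OF L.bounded_linear_axioms, of "Suc n"]
        by blast
      then show ?thesis by auto
    qed
    then obtain x where x: "\<And>n. (L ^^ Suc n) (x n) = 0" "\<And>n. norm (x n) = 1"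
      "\<And>n v. (L ^^ n) v = 0 \<Longrightarrow> 1/2 \<le> norm (x n - v)" by metis
    have K: "compact_map (\<lambda>x. x - L (W x))" using p unfolding parametrix_def by blast
    show False
    proof (rule compact_map_not_separated[OF K, of x 1 "1/2"])
      fix m n :: nat assume "m < n"
      interpret Ln: bounded_linear "L ^^ n" by (rule bounded_linear_funpow[OF L.bounded_linear_axioms])
      have W0: "W 0 = 0" using W by (simp add: linear_simps)
      have Wn: "(L ^^ n) (W y) = W ((L ^^ n) y)" for y by (rule funpow_commute[symmetric]) (simp add: LW)
      obtain k where k: "n = k + Suc m" using \<open>m < n\<close> less_iff_Suc_add by (metis add.commute add_Suc_right)
      have "(L ^^ n) (x m) = 0"
        unfolding k funpow_add o_def x(1) using bounded_linear_funpow[OF L.bounded_linear_axioms, of k]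
        by (simp add: linear_simps)
      moreover have "(L ^^ n) (L y) = L ((L ^^ n) y)" for y by (simp add: funpow_swap1)
      moreover have "L ((L ^^ n) (x n)) = 0" using x(1)[of n] by simp
      \<comment> \<open>The images of \<open>x n\<close> and \<open>x m\<close> differ by \<open>x n\<close> minus this element of the kernel.\<close>
      ultimately have "(L ^^ n) (x m + L (W (x n)) - L (W (x m))) = 0"
        by (simp add: Ln.add Ln.diff Wn LW W0 L.zero)
      from x(3)[OF this]
      show "1/2 \<le> norm ((x n - L (W (x n))) - (x m - L (W (x m))))" by (simp add: algebra_simps)
    qed (use x in auto)
  qed
  then obtain n where n: "\<And>x. (L ^^ Suc n) x = 0 \<Longrightarrow> (L ^^ n) x = 0" by blast
  have "(L ^^ (n + k)) x = 0 \<Longrightarrow> (L ^^ n) x = 0" for k x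
  proof (induction k arbitrary: x)
    case (Suc k)
    have "(L ^^ (n + k)) (L x) = 0" using Suc.prems by (simp add: funpow_swap1)
    from Suc.IH[OF this] have "(L ^^ Suc n) x = 0" by (simp add: funpow_swap1)
    then show ?case by (rule n)
  qed simp
  then show ?thesis by (rule that)
qed

text \<open>The preimages of minimal norm are controlled by their images: for almost minimal preimages \<open>y\<close>
  with \<open>L y / \<parallel>y\<parallel>\<close> tending to \<open>0\<close>, a subsequence of \<open>y / \<parallel>y\<parallel>\<close> converges to an element of the kernel, and
  subtracting a multiple of that element would shorten \<open>y\<close> too much.\<close>

lemma parametrix_closed_range:
  fixes L :: "'a::banach \<Rightarrow> 'a"
  assumes p: "parametrix L W"
  shows "closed (range L)"
proof -
  interpret L: bounded_linear L using p by (simp add: parametrix_def)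
  have "\<exists>c. \<forall>x. \<exists>x'. L x' = L x \<and> norm x' \<le> c * norm (L x)"
  proof (rule ccontr)
    assume "\<not> ?thesis"
    then have "\<forall>k. \<exists>x. \<forall>x'. L x' = L x \<longrightarrow> real (Suc k) * norm (L x) < norm x'"
      by (auto simp: not_le)
    then obtain x where x: "\<And>k x'. L x' = L (x k) \<Longrightarrow> real (Suc k) * norm (L (x k)) < norm x'"
      by metis
    have Lx0: "0 < norm (L (x k))" for k using x[of 0 k] by (auto simp: L.zero)
    define D where "D k = norm ` {x'. L x' = L (x k)}" for k
    have Dne: "D k \<noteq> {}" for k by (auto simp: D_def)
    have Dlow: "real (Suc k) * norm (L (x k)) \<le> Inf (D k)" for k
      using x Dne by (intro cInf_greatest) (auto simp: D_def intro: less_imp_le)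
    have Dpos: "0 < Inf (D k)" for k
      using Dlow[of k] Lx0[of k] by (smt (verit) mult_pos_pos of_nat_0_less_iff zero_less_Suc)
    have "\<exists>x'. L x' = L (x k) \<and> norm x' < 2 * Inf (D k)" for k
      using cInf_lessD[OF Dne, of k "2 * Inf (D k)"] Dpos[of k] by (auto simp: D_def)
    then obtain y where y: "\<And>k. L (y k) = L (x k)" "\<And>k. norm (y k) < 2 * Inf (D k)" by metis
    have low: "Inf (D k) \<le> norm x'" if "L x' = L (x k)" for k x'
      using that by (intro cInf_lower) (auto simp: D_def intro!: bdd_belowI[of _ 0])
    have y0: "0 < norm (y k)" for k using low[OF y(1), of k] Dpos[of k] by linarith
    define z where "z k = (1 / norm (y k)) *\<^sub>R y k" for k
    have z1: "norm (z k) = 1" for k using y0[of k] by (simp add: z_def)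
    have "norm (L (z k)) \<le> 1 / real (Suc k)" for k
      using x[OF y(1), of k] y0[of k] by (simp add: z_def L.scaleR y(1) field_simps)
    then have Lz: "(\<lambda>k. L (z k)) \<longlonglongrightarrow> 0"
      using LIMSEQ_inverse_real_of_nat
      by (intro Lim_null_comparison[of "\<lambda>k. L (z k)" "\<lambda>k. inverse (real (Suc k))"])
        (auto simp: inverse_eq_divide)
    obtain l r where l: "strict_mono (r :: nat \<Rightarrow> nat)" "(\<lambda>n. z (r n)) \<longlonglongrightarrow> l" "L l = 0"
      by (rule parametrix_convergent[OF p _ Lz, of 1]) (auto simp: z1)
    have "1/2 \<le> norm (z k - l)" for k
    proof -
      have "L (y k - norm (y k) *\<^sub>R l) = L (x k)" by (simp add: L.diff L.scaleR l(3) y(1))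
      from low[OF this] y(2)[of k] have "norm (y k) * (1/2) \<le> norm (y k - norm (y k) *\<^sub>R l)" by simp
      also have "y k - norm (y k) *\<^sub>R l = norm (y k) *\<^sub>R (z k - l)"
        using y0[of k] by (simp add: z_def algebra_simps)
      also have "norm \<dots> = norm (y k) * norm (z k - l)" by simp
      finally show ?thesis using y0[of k] by (simp only: mult_le_cancel_left_pos)
    qed
    moreover have "(\<lambda>n. norm (z (r n) - l)) \<longlonglongrightarrow> 0" using l(2) by (simp add: LIM_zero tendsto_norm_zero)
    ultimately have "1/2 \<le> (0::real)" by (intro LIMSEQ_le_const[of "\<lambda>n. norm (z (r n) - l)"]) auto
    then show False by simp
  qed
  then obtain c where c: "\<And>x. \<exists>x'. L x' = L x \<and> norm x' \<le> c * norm (L x)" by blast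
  show ?thesis
    unfolding closed_sequential_limits
  proof (intro allI impI, elim conjE)
    fix s l assume s: "\<forall>n. s n \<in> range L" "s \<longlonglongrightarrow> l"
    then have "\<forall>n. \<exists>x. s n = L x" by blast
    with c have "\<forall>n. \<exists>x. s n = L x \<and> norm x \<le> c * norm (s n)" by metis
    then obtain x where x: "\<And>n. s n = L (x n)" "\<And>n. norm (x n) \<le> c * norm (s n)" by metis
    obtain B where B: "\<And>n. norm (s n) \<le> B" using convergent_imp_Bseq[of s] s(2)
      by (auto simp: convergent_def Bseq_def)
    have bd: "norm (x n) \<le> \<bar>c\<bar> * B" for n
    proof -
      have "c * norm (s n) \<le> \<bar>c\<bar> * B" using B[of n] by (intro mult_mono) auto
      then show ?thesis using x(2)[of n] by simp
    qed
    have lim: "(\<lambda>n. L (x n)) \<longlonglongrightarrow> l" using Lim_transform_eventually[OF s(2)] x(1) by simp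
    obtain y where "L y = l" by (rule parametrix_convergent[OF p bd lim]) blast
    then show "l \<in> range L" by blast
  qed
qed

text \<open>Dual to \<open>parametrix_ascent\<close>, with the decreasing ranges of the powers in place of the kernels. That these are
  closed is needed for Riesz's lemma.\<close>

lemma parametrix_descent:
  fixes L :: "'a::banach \<Rightarrow> 'a"
  assumes p: "parametrix L W"
  obtains n where "\<And>k. range (L ^^ n) \<subseteq> range (L ^^ (n + k))"
proof -
  interpret L: bounded_linear L using p by (simp add: parametrix_def)
  have LW: "L (W x) = W (L x)" for x using p by (simp add: parametrix_def)
  have dec: "range (L ^^ (n + k)) \<subseteq> range (L ^^ n)" for n k by (auto simp: funpow_add)
  have "\<exists>n. range (L ^^ n) \<subseteq> range (L ^^ Suc n)"
  proof (rule ccontr)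
    assume "\<not> ?thesis"
    then have ex: "\<forall>n. \<exists>a. a \<in> range (L ^^ n) \<and> a \<notin> range (L ^^ Suc n)" by blast
    have "\<exists>x. x \<in> range (L ^^ n) \<and> norm x = 1 \<and> (\<forall>v\<in>range (L ^^ Suc n). 1/2 \<le> norm (x - v))" for n
    proof -
      obtain a where a: "a \<in> range (L ^^ n)" "a \<notin> range (L ^^ Suc n)" using ex by blast
      obtain x where "x \<in> range (L ^^ n)" "norm x = 1"
        "\<And>v. v \<in> range (L ^^ Suc n) \<Longrightarrow> 1/2 \<le> norm (x - v)"
        using riesz_lemma[of "range (L ^^ Suc n)" "range (L ^^ n)" a] a dec[of n 1]
          parametrix_closed_range[OF parametrix_funpow[OF p, of "Suc n"]]
          subspace_range_funpow[OF L.bounded_linear_axioms, of n]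
          subspace_range_funpow[OF L.bounded_linear_axioms, of "Suc n"]
        by (metis Suc_eq_plus1)
      then show ?thesis by blast
    qed
    then obtain x where x: "\<And>n. x n \<in> range (L ^^ n)" "\<And>n. norm (x n) = 1"
      "\<And>n v. v \<in> range (L ^^ Suc n) \<Longrightarrow> 1/2 \<le> norm (x n - v)" by metis
    have K: "compact_map (\<lambda>x. x - L (W x))" using p unfolding parametrix_def by blast
    show False
    proof (rule compact_map_not_separated[OF K, of x 1 "1/2"])
      fix m n :: nat assume "m < n"
      note sub = subspace_range_funpow[OF L.bounded_linear_axioms, of "Suc m"]
      have Wr: "L (W y) \<in> range (L ^^ Suc k)" if y: "y \<in> range (L ^^ k)" for y k
      proof -
        obtain v where "y = (L ^^ k) v" using y by blast
        then have "L (W y) = (L ^^ Suc k) (W v)" using funpow_commute[of W L k v] LW by simp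
        then show ?thesis by blast
      qed
      obtain k where n: "n = Suc m + k" using less_imp_Suc_add[OF \<open>m < n\<close>] by auto
      have xn: "x n \<in> range (L ^^ Suc m)" using x(1)[of n] dec[of "Suc m" k] unfolding n by blast
      have "L (W (x n)) \<in> range (L ^^ Suc m)"
        using Wr[OF xn] dec[of "Suc m" 1] by (simp only: add_Suc_right Suc_eq_plus1) blast
      then have "L (W (x m)) + x n - L (W (x n)) \<in> range (L ^^ Suc m)"
        using Wr[OF x(1)] xn by (intro subspace_diff[OF sub] subspace_add[OF sub])
      from x(3)[OF this]
      show "1/2 \<le> norm ((x n - L (W (x n))) - (x m - L (W (x m))))"
        by (simp add: norm_minus_commute algebra_simps)
    qed (use x in auto)
  qed
  then obtain n where n: "range (L ^^ n) \<subseteq> range (L ^^ Suc n)" by blast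
  have "range (L ^^ n) \<subseteq> range (L ^^ (n + k))" for k
  proof (induction k)
    case (Suc k)
    have "(L ^^ (n + k)) v \<in> range (L ^^ (n + Suc k))" for v
    proof -
      have "(L ^^ n) v \<in> range (L ^^ Suc n)" using n by blast
      then obtain w where w: "(L ^^ n) v = (L ^^ Suc n) w" by blast
      have "(L ^^ (k + n)) v = (L ^^ (k + Suc n)) w"
        using w by (simp only: funpow_add o_apply)
      moreover have "n + k = k + n" "n + Suc k = k + Suc n" by simp_all
      ultimately have "(L ^^ (n + k)) v = (L ^^ (n + Suc k)) w" by (simp only:)
      then show ?thesis by blast
    qed
    then have "range (L ^^ (n + k)) \<subseteq> range (L ^^ (n + Suc k))" by (rule image_subsetI)
    with Suc show ?case by (rule order_trans)
  qed simp
  then show ?thesis by (rule that)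
qed

text \<open>For large \<open>m\<close> the space is the direct sum of the kernel and the range of \<open>L\<^sup>m\<close>, and \<open>L\<close> is invertible on
  the range. The operator \<open>J\<close> inverts \<open>L\<close> on the range and vanishes on the kernel; it is the Drazin inverse of
  \<open>L\<close>. Since it is determined uniquely by \<open>L\<close>, it commutes with everything that commutes with \<open>L\<close>. This one
  property gives complex linearity and all commutation relations used later.\<close>

theorem drazin_inverse:
  fixes L :: "'a::banach \<Rightarrow> 'a"
  assumes p: "parametrix L W"
  obtains J m where "bounded_linear J" "1 \<le> m"
    "\<And>X x. (\<And>y. X (L y) = L (X y)) \<Longrightarrow> X (J x) = J (X x)"
    "\<And>x. J (L (J x)) = J x" "\<And>x. (L ^^ m) (x - L (J x)) = 0"
proof -
  have L: "bounded_linear L" using p by (simp add: parametrix_def)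
  obtain a where asc: "\<And>k x. (L ^^ (a + k)) x = 0 \<Longrightarrow> (L ^^ a) x = 0"
    using parametrix_ascent[OF p] by blast
  obtain b where desc: "\<And>k. range (L ^^ b) \<subseteq> range (L ^^ (b + k))"
    using parametrix_descent[OF p] by blast
  define m where "m = Suc (a + b)"
  define R where "R = range (L ^^ m)"
  note Lp = bounded_linear_funpow[OF L]
  have ker: "(L ^^ m) x = 0" if "(L ^^ (m + k)) x = 0" for k x
  proof -
    have "(L ^^ a) x = 0"
    proof (rule asc)
      show "(L ^^ (a + (Suc b + k))) x = 0" using that by (simp add: m_def algebra_simps)
    qed
    moreover have "(L ^^ m) x = (L ^^ Suc b) ((L ^^ a) x)"
      unfolding m_def by (simp add: funpow_add add.commute[of a])
    ultimately show ?thesis using linear_simps(3)[OF Lp] by (simp del: funpow.simps)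
  qed
  have ran: "\<exists>w. (L ^^ m) v = (L ^^ (m + k)) w" for v k
  proof -
    have "(L ^^ m) v = (L ^^ b) ((L ^^ Suc a) v)"
      unfolding m_def by (simp add: funpow_add add.commute[of a] funpow_swap1)
    then have "(L ^^ m) v \<in> range (L ^^ (b + (Suc a + k)))" using desc[of "Suc a + k"] by auto
    then show ?thesis by (auto simp: m_def algebra_simps)
  qed
  have R: "subspace R" "closed R"
    unfolding R_def using subspace_range_funpow[OF L] parametrix_closed_range[OF parametrix_funpow[OF p]]
    by blast+
  have inj: "y = 0" if y: "y \<in> R" "(L ^^ Suc m) y = 0" for y
  proof -
    obtain v where v: "y = (L ^^ m) v" using y(1) by (auto simp: R_def)
    have "(L ^^ (m + Suc m)) v = 0"
      using y(2) unfolding v by (simp add: funpow_add funpow_swap1)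
    from ker[OF this] show ?thesis by (simp add: v)
  qed
  obtain c where c: "\<And>y. y \<in> R \<Longrightarrow> norm y \<le> c * norm ((L ^^ Suc m) y)"
    using parametrix_bounded_below[OF parametrix_funpow[OF p, of "Suc m"] R(2,1) inj] by blast
  have "\<exists>y\<in>R. (L ^^ Suc m) y = (L ^^ m) x" for x
  proof -
    obtain w where w: "(L ^^ m) x = (L ^^ (m + Suc m)) w" using ran by blast
    have "m + Suc m = Suc m + m" by simp
    then have "(L ^^ (m + Suc m)) w = (L ^^ Suc m) ((L ^^ m) w)"
      by (simp only: funpow_add o_apply)
    with w have "(L ^^ Suc m) ((L ^^ m) w) = (L ^^ m) x" by (simp only:)
    then show ?thesis unfolding R_def by (rule bexI) simp
  qed
  \<comment> \<open>\<open>J x\<close> is the unique solution \<open>y\<close> in the range \<open>R\<close> of this equation.\<close>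
  then obtain J where J: "\<And>x. J x \<in> R" "\<And>x. (L ^^ Suc m) (J x) = (L ^^ m) x" by metis
  have uniq: "J x = y" if "y \<in> R" "(L ^^ Suc m) y = (L ^^ m) x" for x y
  proof -
    have "J x - y \<in> R" by (rule subspace_diff[OF R(1) J(1) that(1)])
    moreover have "(L ^^ Suc m) (J x - y) = 0"
      by (simp only: linear_simps(2)[OF Lp] J(2) that(2) diff_self)
    ultimately have "J x - y = 0" by (rule inj)
    then show ?thesis by simp
  qed
  have XJ: "X (J x) = J (X x)" if X: "\<And>y. X (L y) = L (X y)" for X x
  proof (rule uniq[symmetric])
    have Xp: "X ((L ^^ k) y) = (L ^^ k) (X y)" for k y by (rule funpow_commute) (rule X)
    obtain v where "J x = (L ^^ m) v" using J(1)[of x] by (auto simp: R_def)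
    then have "X (J x) = (L ^^ m) (X v)" by (simp only: Xp)
    then show "X (J x) \<in> R" unfolding R_def by (rule range_eqI)
    show "(L ^^ Suc m) (X (J x)) = (L ^^ m) (X x)" by (simp only: Xp[symmetric] J(2))
  qed
  obtain B where B: "\<And>x. norm ((L ^^ m) x) \<le> norm x * B" "0 < B"
    using bounded_linear.pos_bounded[OF Lp[of m]] by blast
  have lin: "bounded_linear J"
  proof (rule bounded_linear_intro)
    fix x y and r :: real
    show "J (x + y) = J x + J y"
      by (intro uniq subspace_add[OF R(1)] J(1)) (simp only: linear_simps(1)[OF Lp] J(2))
    show "J (r *\<^sub>R x) = r *\<^sub>R J x"
      by (intro uniq subspace_scale[OF R(1)] J(1)) (simp only: linear_simps(5)[OF Lp] J(2))
    have "norm (J x) \<le> c * norm ((L ^^ m) x)" using c[OF J(1)] J(2) by simp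
    also have "\<dots> \<le> \<bar>c\<bar> * (norm x * B)" using B(1)[of x] by (intro mult_mono) auto
    finally show "norm (J x) \<le> norm x * (B * \<bar>c\<bar>)" by (simp add: mult.commute mult.left_commute)
  qed
  show ?thesis
  proof (rule that[OF lin _ XJ])
    show "1 \<le> m" by (simp add: m_def)
    have LJ: "L (J x) = J (L x)" for x by (rule XJ) simp
    have top: "(L ^^ m) (L (J x)) = (L ^^ m) x" for x
      using J(2)[of x] by (simp only: funpow.simps(2) o_apply funpow_swap1)
    show "J (L (J x)) = J x" for x
      by (rule uniq[OF J(1)]) (simp only: J(2) top)
    show "(L ^^ m) (x - L (J x)) = 0" for x
      by (simp only: linear_simps(2)[OF Lp] top diff_self)
  qed
qed

text \<open>The coefficient of \<open>a\<close> depends continuously on the vector, since \<open>a\<close> has positive distance from \<open>S\<close>.\<close>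

lemma closed_span_insert:
  fixes S :: "'a::banach set"
  assumes S: "closed S" "subspace S" "a \<notin> S"
  shows "closed {x. \<exists>k. x - k *\<^sub>R a \<in> S}"
  unfolding closed_sequential_limits
proof (intro allI impI, elim conjE)
  fix x l assume x: "\<forall>n. x n \<in> {x. \<exists>k. x - k *\<^sub>R a \<in> S}" and l: "x \<longlonglongrightarrow> l"
  from x obtain k where k: "\<And>n. x n - k n *\<^sub>R a \<in> S" by (simp add: mem_Collect_eq) metis
  define d where "d = infdist a S"
  have ne: "S \<noteq> {}" using subspace_0[OF S(2)] by blast
  have d: "0 < d"
    using S(3,1) ne infdist_nonneg[of a S] by (auto simp: d_def less_le in_closed_iff_infdist_zero)
  have low: "\<bar>t\<bar> * d \<le> norm (s + t *\<^sub>R a)" if "s \<in> S" for s t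
  proof (cases "t = 0")
    case False
    have "- (1 / t) *\<^sub>R s \<in> S" using S(2) that by (rule subspace_scale)
    then have "d \<le> norm (a - (- (1 / t) *\<^sub>R s))" unfolding d_def by (metis dist_norm infdist_le)
    then have "\<bar>t\<bar> * d \<le> \<bar>t\<bar> * norm (a - (- (1 / t) *\<^sub>R s))" by (intro mult_left_mono) auto
    also have "\<dots> = norm (t *\<^sub>R (a - (- (1 / t) *\<^sub>R s)))" by simp
    also have "t *\<^sub>R (a - (- (1 / t) *\<^sub>R s)) = s + t *\<^sub>R a" using False by (simp add: algebra_simps)
    finally show ?thesis .
  qed simp
  have "Cauchy k"
  proof (rule CauchyI)
    fix e :: real assume "0 < e"
    then have "0 < e * d" using d by simp
    then obtain N where N: "\<And>m n. N \<le> m \<Longrightarrow> N \<le> n \<Longrightarrow> norm (x m - x n) < e * d"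
      using CauchyD[OF LIMSEQ_imp_Cauchy[OF l]] by blast
    have "norm (k m - k n) < e" if "N \<le> m" "N \<le> n" for m n
    proof -
      have "\<bar>k m - k n\<bar> * d \<le> norm (((x m - k m *\<^sub>R a) - (x n - k n *\<^sub>R a)) + (k m - k n) *\<^sub>R a)"
        by (intro low subspace_diff[OF S(2) k k])
      also have "\<dots> = norm (x m - x n)" by (simp add: algebra_simps)
      also have "\<dots> < e * d" using N that by blast
      finally show ?thesis using d by simp
    qed
    then show "\<exists>M. \<forall>m\<ge>M. \<forall>n\<ge>M. norm (k m - k n) < e" by blast
  qed
  then obtain k0 where k0: "k \<longlonglongrightarrow> k0" by (auto simp: Cauchy_convergent_iff convergent_def)
  have lim: "(\<lambda>n. x n - k n *\<^sub>R a) \<longlonglongrightarrow> l - k0 *\<^sub>R a" by (intro tendsto_intros l k0)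
  have "l - k0 *\<^sub>R a \<in> S" by (rule closed_sequentially[OF S(1) k lim])
  then show "l \<in> {x. \<exists>k. x - k *\<^sub>R a \<in> S}" by blast
qed

lemma closed_span_finite:
  fixes B :: "'a::banach set"
  assumes "finite B"
  shows "closed (span B)"
  using assms
proof (induction B rule: finite_induct)
  case (insert a B)
  show ?case
  proof (cases "a \<in> span B")
    case True
    then show ?thesis using insert by (simp add: span_redundant)
  next
    case False
    then show ?thesis using closed_span_insert[OF insert(3) subspace_span] by (simp add: span_insert)
  qed
qed simp

text \<open>On the kernel of \<open>L\<close> the compact map \<open>I - L W\<close> is the identity, so a separated sequence of
  unit vectors in the kernel cannot exist.\<close>

theorem parametrix_kernel_finite_dimensional:
  fixes L :: "'a::banach \<Rightarrow> 'a"
  assumes p: "parametrix L W"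
  obtains B where "finite B" "{x. L x = 0} \<subseteq> span B"
proof (rule ccontr)
  note found = that
  assume contra: "\<not> thesis"
  have L: "bounded_linear L" and LW: "L (W x) = W (L x)" and W: "bounded_linear W"
    and K: "compact_map (\<lambda>x. x - L (W x))" for x
    using p unfolding parametrix_def by blast+
  have sub: "subspace {x. L x = 0}" by (rule subspace_kernel_bounded_linear[OF L])
  let ?Q = "\<lambda>x n r. L r = 0 \<and> norm r = 1 \<and> (\<forall>i<n::nat. 1/2 \<le> norm (r - x i))"
  have "\<exists>x. \<forall>n. ?Q x n (x n)"
  proof (rule dependent_wellorder_choice)
    fix n and x :: "nat \<Rightarrow> 'a" assume prev: "\<And>i. i < n \<Longrightarrow> ?Q x i (x i)"
    have fin: "finite (x ` {..<n})" by simp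
    have V: "span (x ` {..<n}) \<subseteq> {x. L x = 0}" using prev by (intro span_minimal sub) auto
    have "\<not> {x. L x = 0} \<subseteq> span (x ` {..<n})" using found[OF fin] contra by blast
    then obtain a where a: "a \<in> {x. L x = 0}" "a \<notin> span (x ` {..<n})" by blast
    obtain r where "r \<in> {x. L x = 0}" "norm r = 1" "\<And>v. v \<in> span (x ` {..<n}) \<Longrightarrow> 1/2 \<le> norm (r - v)"
      by (rule riesz_lemma[OF closed_span_finite[OF fin] subspace_span sub V a]) blast
    then have "?Q x n r" by (auto intro: span_base)
    then show "\<exists>r. ?Q x n r" by blast
  qed simp
  then obtain x where x: "\<And>n. ?Q x n (x n)" by blast
  show False
  proof (rule compact_map_not_separated[OF K, of x 1 "1/2"])
    fix m n :: nat assume "m < n"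
    have "L (W (x k)) = 0" for k using x[of k] W by (simp add: LW linear_simps)
    then show "1/2 \<le> norm ((x n - L (W (x n))) - (x m - L (W (x m))))"
      using x[of n] \<open>m < n\<close> by simp
  qed (use x in auto)
qed

section \<open>Neumann series and resolvents\<close>

lemma bounded_linear_scaleC: "bounded_linear (\<lambda>x. c *\<^sub>C (x::'a::complex_normed_vector))"
  by (rule bounded_bilinear.bounded_linear_right[OF bounded_bilinear_scaleC])

text \<open>The operator \<open>X\<close> is the sum of the powers of \<open>F\<close>. That it commutes with every operator that commutes
  with \<open>F\<close> is read off from the series.\<close>

lemma neumann_series:
  fixes F :: "'a::complex_banach \<Rightarrow> 'a"
  assumes F: "bounded_clinear F" and q: "0 \<le> q" "q < 1" and bd: "\<And>x. norm (F x) \<le> q * norm x"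
  obtains X where "bounded_clinear X" "\<And>x. X x = x + F (X x)"
    "\<And>Y x. bounded_linear Y \<Longrightarrow> (\<And>y. Y (F y) = F (Y y)) \<Longrightarrow> Y (X x) = X (Y x)"
proof -
  note Fl = bounded_clinearD(1)[OF F]
  have pow: "norm ((F ^^ n) x) \<le> norm x * q ^ n" for n x
  proof (induction n)
    case (Suc n)
    have "norm ((F ^^ Suc n) x) \<le> q * norm ((F ^^ n) x)" using bd by simp
    also have "\<dots> \<le> q * (norm x * q ^ n)" by (rule mult_left_mono[OF Suc q(1)])
    finally show ?case by (simp add: mult.left_commute)
  qed simp
  have summ: "summable (\<lambda>n. (F ^^ n) x)" for x
  proof (rule summable_comparison_test'[where N = 0])
    show "summable (\<lambda>n. norm x * q ^ n)" using q by (intro summable_mult summable_geometric) simp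
  qed (rule pow)
  define X where "X x = (\<Sum>n. (F ^^ n) x)" for x
  have comm: "Y (X x) = X (Y x)" if Y: "bounded_linear Y" "\<And>y. Y (F y) = F (Y y)" for Y x
  proof -
    have "Y (X x) = (\<Sum>n. Y ((F ^^ n) x))"
      unfolding X_def by (rule bounded_linear.suminf[OF Y(1) summ])
    also have "\<dots> = X (Y x)" unfolding X_def by (subst funpow_commute[of Y F]) (simp_all add: Y(2))
    finally show ?thesis .
  qed
  have fixpt: "X x = x + F (X x)" for x
  proof -
    have "X x = (F ^^ 0) x + (\<Sum>n. (F ^^ Suc n) x)"
      unfolding X_def using suminf_split_head[OF summ[of x]] by simp
    also have "(\<Sum>n. (F ^^ Suc n) x) = F (X x)"
      unfolding X_def by (simp add: bounded_linear.suminf[OF Fl summ])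
    finally show ?thesis by simp
  qed
  have "bounded_clinear X"
  proof (rule bounded_clinearI)
    show "X (x + y) = X x + X y" for x y
      unfolding X_def
      by (simp add: suminf_add[OF summ summ] bounded_clinearD(3)[OF bounded_clinear_funpow[OF F]])
    show "X (c *\<^sub>C x) = c *\<^sub>C X x" for c x
      by (rule comm[symmetric, of "\<lambda>x. c *\<^sub>C x"])
        (simp_all add: bounded_linear_scaleC bounded_clinearD(2)[OF F])
    show "norm (X x) \<le> norm x * (1 / (1 - q))" for x
    proof -
      have "norm (X x) \<le> norm x + norm (F (X x))" using norm_triangle_ineq fixpt by metis
      also have "\<dots> \<le> norm x + q * norm (X x)" using bd by simp
      finally show ?thesis using q by (simp add: field_simps)
    qed
  qed
  with fixpt comm that show ?thesis by blast
qed

lemma resolvent_setI: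
  assumes G: "bounded_clinear G" and right: "\<And>x. G x \<in> dom A" "\<And>x. z *\<^sub>C G x - the (A (G x)) = x"
    and left: "\<And>x. x \<in> dom A \<Longrightarrow> G (z *\<^sub>C x - the (A x)) = x"
  shows "z \<in> resolvent_set A" "resolvent A z = G"
proof -
  have bij: "bij_betw (\<lambda>x. z *\<^sub>C x - the (A x)) (dom A) UNIV"
    by (rule bij_betw_byWitness[where f' = G]) (use right left in auto)
  show eq: "resolvent A z = G"
  proof
    fix y
    show "resolvent A z y = G y"
      unfolding resolvent_def
      by (rule inv_into_f_eq) (use bij right in \<open>auto simp: bij_betw_def\<close>)
  qed
  show "z \<in> resolvent_set A" using bij G by (simp add: resolvent_set_def eq)
qed

lemma resolventD:
  assumes "z \<in> resolvent_set A"
  shows "bounded_clinear (resolvent A z)" "resolvent A z x \<in> dom A"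
    "z *\<^sub>C resolvent A z x - the (A (resolvent A z x)) = x"
    "y \<in> dom A \<Longrightarrow> resolvent A z (z *\<^sub>C y - the (A y)) = y"
proof -
  have bij: "bij_betw (\<lambda>x. z *\<^sub>C x - the (A x)) (dom A) UNIV"
    using assms by (simp add: resolvent_set_def)
  show "bounded_clinear (resolvent A z)" using assms by (simp add: resolvent_set_def)
  have x: "x \<in> (\<lambda>x. z *\<^sub>C x - the (A x)) ` dom A" using bij by (simp add: bij_betw_def)
  show "resolvent A z x \<in> dom A" unfolding resolvent_def by (rule inv_into_into[OF x])
  show "z *\<^sub>C resolvent A z x - the (A (resolvent A z x)) = x"
    unfolding resolvent_def by (rule f_inv_into_f[OF x])
  show "resolvent A z (z *\<^sub>C y - the (A y)) = y" if "y \<in> dom A"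
    unfolding resolvent_def using bij that by (intro inv_into_f_eq) (auto simp: bij_betw_def)
qed

lemma resolvent_identity:
  assumes z: "z \<in> resolvent_set A" and w: "w \<in> resolvent_set A"
  shows "resolvent A z x - resolvent A w x = (w - z) *\<^sub>C resolvent A z (resolvent A w x)"
proof -
  define y where "y = resolvent A w x"
  note Rz = resolventD(1)[OF z]
  have "w *\<^sub>C y - the (A y) = x" unfolding y_def by (rule resolventD(3)[OF w])
  then have "z *\<^sub>C y - the (A y) = x + (z - w) *\<^sub>C y"
    by (simp add: cvs.scale_left_diff_distrib algebra_simps)
  then have "y = resolvent A z (x + (z - w) *\<^sub>C y)"
    using resolventD(4)[OF z, of y] resolventD(2)[OF w, of x] by (simp add: y_def)
  then have "y = resolvent A z x + (z - w) *\<^sub>C resolvent A z y"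
    by (simp add: bounded_clinearD(2,3)[OF Rz])
  then have "resolvent A z x - y = - ((z - w) *\<^sub>C resolvent A z y)" by (simp add: algebra_simps)
  then show ?thesis by (simp add: y_def flip: cvs.scale_minus_left)
qed

lemma resolvent_commute:
  assumes z: "z \<in> resolvent_set A" and w: "w \<in> resolvent_set A"
  shows "resolvent A z (resolvent A w x) = resolvent A w (resolvent A z x)"
proof (cases "z = w")
  case False
  have "(w - z) *\<^sub>C resolvent A z (resolvent A w x) = - ((z - w) *\<^sub>C resolvent A w (resolvent A z x))"
    by (simp only: minus_diff_eq flip: resolvent_identity[OF z w] resolvent_identity[OF w z])
  also have "\<dots> = (w - z) *\<^sub>C resolvent A w (resolvent A z x)"
    by (simp flip: cvs.scale_minus_left)
  finally show ?thesis using False by simp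
qed simp

text \<open>A right inverse of \<open>z - A\<close> that commutes with one resolvent is also a left inverse. It reduces the
  verifications below to one side.\<close>

lemma resolvent_setI_commuting:
  assumes \<omega>: "\<omega> \<in> resolvent_set A"
    and G: "bounded_clinear G" and right: "\<And>x. G x \<in> dom A" "\<And>x. z *\<^sub>C G x - the (A (G x)) = x"
    and comm: "\<And>x. G (resolvent A \<omega> x) = resolvent A \<omega> (G x)"
  shows "z \<in> resolvent_set A" "resolvent A z = G"
proof -
  have left: "G (z *\<^sub>C x - the (A x)) = x" if x: "x \<in> dom A" for x
  proof -
    define v where "v = \<omega> *\<^sub>C x - the (A x)"
    define y where "y = G v"
    note R = resolventD(1)[OF \<omega>]
    have xv: "x = resolvent A \<omega> v" unfolding v_def by (rule resolventD(4)[OF \<omega> x, symmetric])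
    have "z *\<^sub>C y - the (A y) = v" unfolding y_def by (rule right(2))
    then have "\<omega> *\<^sub>C y - the (A y) = v + (\<omega> - z) *\<^sub>C y"
      by (simp add: cvs.scale_left_diff_distrib algebra_simps)
    then have "y = resolvent A \<omega> (v + (\<omega> - z) *\<^sub>C y)"
      using resolventD(4)[OF \<omega>, of y] right(1) by (simp add: y_def)
    also have "\<dots> = x + (\<omega> - z) *\<^sub>C resolvent A \<omega> y"
      by (simp add: bounded_clinearD(2,3)[OF R] xv)
    also have "resolvent A \<omega> y = G x" by (simp add: y_def xv comm)
    finally have y: "y = x + (\<omega> - z) *\<^sub>C G x" .
    have "z *\<^sub>C x - the (A x) = v - (\<omega> - z) *\<^sub>C x"
      by (simp add: v_def cvs.scale_left_diff_distrib algebra_simps)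
    then have "G (z *\<^sub>C x - the (A x)) = y - (\<omega> - z) *\<^sub>C G x"
      by (simp add: bounded_clinearD(2,4)[OF G] y_def)
    with y show ?thesis by simp
  qed
  show "z \<in> resolvent_set A" "resolvent A z = G"
    by (rule resolvent_setI[OF G right left]; assumption)+
qed

section \<open>Decomposition of the space at a spectral value\<close>

lemma compact_operator_imp_compact_map:
  assumes K: "compact_operator K"
  shows "compact_map K"
  unfolding compact_map_def
proof (intro allI impI)
  fix x :: "nat \<Rightarrow> 'a" and M :: real assume x: "\<forall>n. norm (x n) \<le> M"
  have Kc: "bounded_clinear K" and cpt: "compact (closure (K ` cball 0 1))"
    using K by (auto simp: compact_operator_def)
  define c where "c = \<bar>M\<bar> + 1"
  have c: "0 < c" by (simp add: c_def)
  have "norm (x n) \<le> c" for n using x[rule_format, of n] by (simp add: c_def)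
  then have "(1 / c) *\<^sub>R x n \<in> cball 0 1" for n using c by simp
  then have "\<forall>n. K ((1 / c) *\<^sub>R x n) \<in> closure (K ` cball 0 1)"
    using closure_subset by blast
  then obtain l r where r: "strict_mono (r :: nat \<Rightarrow> nat)"
    "((\<lambda>n. K ((1 / c) *\<^sub>R x n)) \<circ> r) \<longlonglongrightarrow> l"
    using cpt unfolding compact_eq_seq_compact_metric seq_compact_def by metis
  have "(\<lambda>n. c *\<^sub>R K ((1 / c) *\<^sub>R x (r n))) \<longlonglongrightarrow> c *\<^sub>R l"
    using r(2) by (intro tendsto_scaleR tendsto_const) (simp add: o_def)
  moreover have "c *\<^sub>R K ((1 / c) *\<^sub>R x (r n)) = K (x (r n))" for n
    using c linear_simps(5)[OF bounded_clinearD(1)[OF Kc]] by simp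
  ultimately have "(\<lambda>n. K (x (r n))) \<longlonglongrightarrow> c *\<^sub>R l" by simp
  with r(1) show "\<exists>l r. strict_mono (r :: nat \<Rightarrow> nat) \<and> (\<lambda>n. K (x (r n))) \<longlonglongrightarrow> l" by blast
qed

text \<open>The analogue of \<open>parametrix\<close> for the unbounded operator \<open>z - A\<close>; the same \<open>V\<close> serves on both
  sides.\<close>

definition right_parametrix ::
  "'a::complex_normed_vector operator \<Rightarrow> complex \<Rightarrow> ('a \<Rightarrow> 'a) \<Rightarrow> ('a \<Rightarrow> 'a) \<Rightarrow> bool" where
  "right_parametrix A z V K \<longleftrightarrow> bounded_clinear V \<and> compact_operator K \<and>
     (\<forall>x. V x \<in> dom A \<and> z *\<^sub>C V x - the (A (V x)) = x - K x) \<and>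
     (\<forall>x\<in>dom A. V (z *\<^sub>C x - the (A x)) = x - K x)"

text \<open>The projection \<open>P\<close> splits the space into its finite-dimensional range, on which \<open>A - z\<close> is the nilpotent
  operator \<open>D\<close>, and its kernel, on which \<open>z - A\<close> has the inverse \<open>S\<close>. These are the data from which the
  Laurent expansion of the resolvent at \<open>z\<close> is built. The last clause says that they commute with
  every bounded operator that commutes with the resolvent at \<open>\<omega>\<close>.\<close>

definition spectral_decomposition ::
  "'a::complex_normed_vector operator \<Rightarrow> complex \<Rightarrow> complex \<Rightarrow> ('a \<Rightarrow> 'a) \<Rightarrow> ('a \<Rightarrow> 'a) \<Rightarrow> ('a \<Rightarrow> 'a) \<Rightarrow> bool"
  where
  "spectral_decomposition A \<omega> z P D S \<longleftrightarrow>
     bounded_clinear P \<and> bounded_clinear D \<and> bounded_clinear S \<and>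
     (\<forall>x. P (P x) = P x \<and> D (P x) = D x \<and> P (D x) = D x \<and> P (S x) = 0) \<and>
     (\<forall>x. P x \<in> dom A \<and> the (A (P x)) = z *\<^sub>C P x + D x) \<and>
     (\<forall>x. S x \<in> dom A \<and> z *\<^sub>C S x - the (A (S x)) = x - P x) \<and>
     (\<exists>m. \<forall>x. (D ^^ m) (P x) = 0) \<and> (\<exists>x. P x \<noteq> 0) \<and>
     (\<exists>B. finite B \<and> range P \<subseteq> span B) \<and>
     (\<forall>Y. bounded_clinear Y \<longrightarrow> (\<forall>x. Y (resolvent A \<omega> x) = resolvent A \<omega> (Y x)) \<longrightarrow>
        (\<forall>x. Y (P x) = P (Y x) \<and> Y (D x) = D (Y x) \<and> Y (S x) = S (Y x)))"

lemma funpow_product: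
  assumes "\<And>x. L (Y x) = Y (L x)"
  shows "((\<lambda>x. L (Y x)) ^^ k) x = (L ^^ k) ((Y ^^ k) x)"
proof (induction k)
  case (Suc k)
  have "Y ((L ^^ k) y) = (L ^^ k) (Y y)" for y by (rule funpow_commute) (simp add: assms)
  with Suc show ?case by simp
qed simp

text \<open>The bounded operator \<open>L = (z - A) R\<close>, where \<open>R\<close> is the resolvent at \<open>\<omega>\<close>, has the parametrix
  \<open>W = (\<omega> - A) V\<close>, because \<open>L W = (z - A) V\<close>. If \<open>J\<close> is the Drazin inverse of \<open>L\<close>, then \<open>P = I - L J\<close> is
  the projection, and \<open>S = R J\<close> inverts \<open>z - A\<close> on its kernel. On the range of \<open>P\<close> the operator \<open>L\<close> is
  nilpotent, hence \<open>c R = I - L\<close> is invertible there by a finite geometric series and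
  \<open>A - z = c - R\<^sup>-\<^sup>1\<close> has the factor \<open>L\<close>, where \<open>c = \<omega> - z\<close>.\<close>

theorem spectral_decomposition_exists:
  fixes A :: "'a::complex_banach operator"
  assumes \<omega>: "\<omega> \<in> resolvent_set A" and z: "z \<in> spectrum A" and VK: "right_parametrix A z V K"
  obtains P D S where "spectral_decomposition A \<omega> z P D S"
proof -
  have V: "bounded_clinear V" "\<And>x. V x \<in> dom A" "\<And>x. z *\<^sub>C V x - the (A (V x)) = x - K x"
    "\<And>x. x \<in> dom A \<Longrightarrow> V (z *\<^sub>C x - the (A x)) = x - K x"
    and K: "compact_operator K" "bounded_clinear K"
    using VK by (auto simp: right_parametrix_def compact_operator_def)
  define c where "c = \<omega> - z"
  have c0: "c \<noteq> 0" using \<omega> z by (auto simp: c_def spectrum_def)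
  define R where "R = resolvent A \<omega>"
  have R: "bounded_clinear R" "\<And>x. R x \<in> dom A" "\<And>x. \<omega> *\<^sub>C R x - the (A (R x)) = x"
    "\<And>x. x \<in> dom A \<Longrightarrow> R (\<omega> *\<^sub>C x - the (A x)) = x"
    unfolding R_def using resolventD[OF \<omega>] by auto
  note Vs = bounded_clinearD(2-)[OF V(1)] and Ks = bounded_clinearD(2-)[OF K(2)]
    and Rs = bounded_clinearD(2-)[OF R(1)]
  define L where "L x = x - c *\<^sub>C R x" for x
  define W where "W x = x - K x + c *\<^sub>C V x" for x
  have Lc: "bounded_clinear L" and Wc: "bounded_clinear W"
    unfolding L_def W_def
    by (intro bounded_clinear_diff bounded_clinear_add bounded_clinear_scaleC bounded_clinear_id R V K)+
  note Ls = bounded_clinearD(2-)[OF Lc] and Ws = bounded_clinearD(2-)[OF Wc]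
  have AR: "z *\<^sub>C R x - the (A (R x)) = L x" for x
    using R(3)[of x] by (simp add: L_def c_def cvs.scale_left_diff_distrib algebra_simps)
  have RW: "R (W x) = V x" for x
  proof -
    have "W x = \<omega> *\<^sub>C V x - the (A (V x))"
      using V(3)[of x] by (simp add: W_def c_def cvs.scale_left_diff_distrib algebra_simps)
    then show ?thesis using R(4)[OF V(2)] by simp
  qed
  have LW: "L (W x) = x - K x" for x by (simp add: L_def[of "W x"] RW) (simp add: W_def)
  have WR: "W (R x) = V x" for x
  proof -
    have "R x - K (R x) = V (L x)" using V(4)[OF R(2)[of x]] by (simp add: AR)
    also have "\<dots> = V x - c *\<^sub>C V (R x)" by (simp add: L_def Vs)
    finally show ?thesis by (simp add: W_def)
  qed
  have WL: "W (L x) = x - K x" for x by (simp add: L_def Ws WR) (simp add: W_def)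
  have par: "parametrix L W"
    unfolding parametrix_def LW WL
    using compact_operator_imp_compact_map[OF K(1)] bounded_clinearD(1)[OF Lc] bounded_clinearD(1)[OF Wc]
    by simp
  obtain J m where J: "bounded_linear J" "1 \<le> m"
    "\<And>X x. (\<And>y. X (L y) = L (X y)) \<Longrightarrow> X (J x) = J (X x)"
    "\<And>x. J (L (J x)) = J x" "\<And>x. (L ^^ m) (x - L (J x)) = 0"
    by (rule drazin_inverse[OF par]) blast
  have Jc: "bounded_clinear J"
    using J(1) J(3)[of "\<lambda>x. a *\<^sub>C x" for a] Ls(1) by (simp add: bounded_clinear_iff)
  have JL: "L (J x) = J (L x)" for x by (rule J(3)) simp
  note Js = bounded_clinearD(2-)[OF Jc]
  define P where "P x = x - L (J x)" for x
  have Pc: "bounded_clinear P"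
    unfolding P_def by (intro bounded_clinear_diff bounded_clinear_id bounded_clinear_compose[OF Lc Jc])
  note Ps = bounded_clinearD(2-)[OF Pc]
  have LmP: "(L ^^ m) (P x) = 0" for x using J(5) by (simp add: P_def)
  have PP: "P (P x) = P x" for x by (simp add: P_def Ls Js J(4))
  have JJL: "J (J (L x)) = J x" for x using J(4)[of x] by (simp only: JL)
  have PJ: "P (J x) = 0" for x by (simp add: P_def JL JJL)
  have comm_L: "X (L x) = L (X x)" if "bounded_clinear X" "\<And>y. X (R y) = R (X y)" for X x
    using that by (simp add: L_def bounded_clinearD(2,4))
  have comm_P: "X (P x) = P (X x)" if X: "bounded_clinear X" "\<And>y. X (R y) = R (X y)" for X x
    by (simp add: P_def bounded_clinearD(4)[OF X(1)] comm_L[OF X] J(3)[of X, OF comm_L[OF X]])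
  \<comment> \<open>\<open>G\<close> inverts \<open>R\<close> on the range of \<open>P\<close>. Splitting off its first term and a factor \<open>L\<close> from the others leaves
    the negative of \<open>Y\<close>.\<close>
  define Y where "Y x = - c *\<^sub>C (\<Sum>j<m - 1. (L ^^ j) (P x))" for x
  define D where "D x = L (Y x)" for x
  have Yc: "bounded_clinear Y"
    unfolding Y_def
    by (intro bounded_clinear_scaleC bounded_clinear_sum bounded_clinear_compose[OF bounded_clinear_funpow[OF Lc] Pc])
  note Ys = bounded_clinearD(2-)[OF Yc]
  have Dc: "bounded_clinear D" unfolding D_def by (rule bounded_clinear_compose[OF Lc Yc])
  have lin_sum: "X (\<Sum>j\<in>I. f j) = (\<Sum>j\<in>I. X (f j))" if "bounded_clinear X" for X :: "'a \<Rightarrow> 'a" and f :: "nat \<Rightarrow> 'a" and I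
    using linear_sum[OF bounded_linear.linear[OF bounded_clinearD(1)[OF that]]] .
  have comm_Y: "X (Y x) = Y (X x)" if X: "bounded_clinear X" "\<And>y. X (R y) = R (X y)" for X x
  proof -
    have "X ((L ^^ j) y) = (L ^^ j) (X y)" for j y by (rule funpow_commute) (rule comm_L[OF X])
    then show ?thesis by (simp add: Y_def bounded_clinearD(2,6)[OF X(1)] lin_sum[OF X(1)] comm_P[OF X])
  qed
  have RL: "L (R x) = R (L x)" for x by (simp add: L_def Rs)
  have RP: "P (R x) = R (P x)" for x by (rule comm_P[OF R(1), symmetric]) simp
  have LP: "P (L x) = L (P x)" for x by (rule comm_P[OF Lc, symmetric]) (rule RL)
  have YL: "L (Y x) = Y (L x)" for x by (rule comm_Y[OF Lc]) (rule RL)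
  have YP: "P (Y x) = Y (P x)" for x by (rule comm_Y[OF Pc]) (rule RP)
  have YPx: "Y (P x) = Y x" for x by (simp add: Y_def PP)
  define G where "G x = c *\<^sub>C (\<Sum>j<m. (L ^^ j) (P x))" for x
  have RG: "R (G x) = P x" for x
  proof -
    have cR: "c *\<^sub>C R y = y - L y" for y by (simp add: L_def)
    have "R (G x) = c *\<^sub>C R (\<Sum>j<m. (L ^^ j) (P x))" by (simp add: G_def Rs)
    also have "\<dots> = (\<Sum>j<m. (L ^^ j) (P x) - (L ^^ Suc j) (P x))"
      by (simp add: cR lin_sum[OF Lc] sum_subtractf)
    also have "\<dots> = (L ^^ 0) (P x) - (L ^^ m) (P x)" by (rule sum_lessThan_telescope')
    finally show ?thesis by (simp add: LmP)
  qed
  have DG: "D x = c *\<^sub>C P x - G x" for x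
  proof -
    obtain k where m: "m = Suc k" using J(2) by (cases m) auto
    have "D x = - c *\<^sub>C (\<Sum>j<k. (L ^^ Suc j) (P x))"
      by (simp add: D_def Y_def m Ls lin_sum[OF Lc])
    moreover have "G x = c *\<^sub>C P x + c *\<^sub>C (\<Sum>j<k. (L ^^ Suc j) (P x))"
      unfolding G_def m sum.lessThan_Suc_shift by (simp add: scaleC_add_right)
    ultimately show ?thesis by simp
  qed
  have Pdom: "P x \<in> dom A" and AP: "the (A (P x)) = z *\<^sub>C P x + D x" for x
  proof -
    show "P x \<in> dom A" using R(2)[of "G x"] by (simp add: RG)
    have "\<omega> *\<^sub>C P x - the (A (P x)) = G x" using R(3)[of "G x"] by (simp add: RG)
    then have "the (A (P x)) = \<omega> *\<^sub>C P x - G x" by (simp add: algebra_simps)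
    then show "the (A (P x)) = z *\<^sub>C P x + D x"
      by (simp add: DG c_def cvs.scale_left_diff_distrib)
  qed
  define S where "S x = R (J x)" for x
  have Sc: "bounded_clinear S" unfolding S_def by (rule bounded_clinear_compose[OF R(1) Jc])
  have Sdom: "S x \<in> dom A" and AS: "z *\<^sub>C S x - the (A (S x)) = x - P x" for x
    using R(2) AR[of "J x"] by (simp_all add: S_def P_def)
  have PS: "P (S x) = 0" for x by (simp add: S_def RP PJ Rs)
  have nil: "(D ^^ m) (P x) = 0" for x
  proof -
    have "(D ^^ m) (P x) = (L ^^ m) ((Y ^^ m) (P x))"
      unfolding D_def[abs_def] by (rule funpow_product) (rule YL)
    also have "(Y ^^ m) (P x) = P ((Y ^^ m) x)" by (rule funpow_commute[symmetric]) (rule YP)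
    finally show ?thesis by (simp add: LmP)
  qed
  have P0: "\<exists>x. P x \<noteq> 0"
  proof (rule ccontr)
    assume "\<not> ?thesis"
    then have P: "P x = 0" for x by simp
    have "z \<in> resolvent_set A"
    proof (rule resolvent_setI_commuting[OF \<omega> Sc Sdom])
      show "z *\<^sub>C S x - the (A (S x)) = x" for x using AS P by simp
      have "R (J x) = J (R x)" for x by (rule J(3)) (simp add: RL)
      then show "S (resolvent A \<omega> x) = resolvent A \<omega> (S x)" for x by (simp add: S_def flip: R_def)
    qed
    with z show False by (simp add: spectrum_def)
  qed
  obtain B where B: "finite B" "{x. (L ^^ m) x = 0} \<subseteq> span B"
    by (rule parametrix_kernel_finite_dimensional[OF parametrix_funpow[OF par, of m]])
  have ran: "range P \<subseteq> span B" using LmP B(2) by blast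
  have comm: "X (P x) = P (X x) \<and> X (D x) = D (X x) \<and> X (S x) = S (X x)"
    if X: "bounded_clinear X" "\<forall>y. X (resolvent A \<omega> y) = resolvent A \<omega> (X y)" for X x
  proof -
    have XR: "X (R y) = R (X y)" for y using X(2) by (simp add: R_def)
    show ?thesis
      using comm_P[OF X(1) XR] comm_L[OF X(1) XR] comm_Y[OF X(1) XR] J(3)[of X, OF comm_L[OF X(1) XR]]
      by (simp add: D_def S_def XR)
  qed
  have "spectral_decomposition A \<omega> z P D S"
    unfolding spectral_decomposition_def
  proof (intro conjI allI impI)
    show "D (P x) = D x" "P (D x) = D x" for x
      by (simp_all add: D_def YPx LP YP)
    show "\<exists>m. \<forall>x. (D ^^ m) (P x) = 0" using nil by blast
    show "\<exists>B. finite B \<and> range P \<subseteq> span B" using B(1) ran by blast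
    show "Y (P x) = P (Y x)" "Y (D x) = D (Y x)" "Y (S x) = S (Y x)"
      if "bounded_clinear Y" "\<forall>x. Y (resolvent A \<omega> x) = resolvent A \<omega> (Y x)" for Y x
      using comm[OF that] by auto
  qed (fact Pc Dc Sc PP PS Pdom AP Sdom AS P0)+
  then show ?thesis by (rule that)
qed

section \<open>Laurent expansion of the resolvent\<close>

lemma geometric_expansion:
  assumes S: "bounded_clinear S" and H: "\<And>x. H x = S x - w *\<^sub>C S (H x)"
  shows "H x - (\<Sum>i<k. ((- 1) ^ i * w ^ i) *\<^sub>C (S ^^ Suc i) x) = (- w) ^ k *\<^sub>C (S ^^ k) (H x)"
proof (induction k)
  case (Suc k)
  have Sk: "bounded_clinear (S ^^ k)" by (rule bounded_clinear_funpow[OF S])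
  have "(- w) ^ k *\<^sub>C (S ^^ k) (H x) = (- w) ^ k *\<^sub>C (S ^^ k) (S x - w *\<^sub>C S (H x))"
    using H by simp
  also have "\<dots> = (- w) ^ k *\<^sub>C (S ^^ Suc k) x + (- w) ^ Suc k *\<^sub>C (S ^^ Suc k) (H x)"
    by (simp add: bounded_clinearD(2,4)[OF Sk] funpow_swap1 cvs.scale_right_diff_distrib
        mult.commute)
  also have "(- w) ^ k = (- 1) ^ k * w ^ k" by (rule power_minus)
  finally have "H x - (\<Sum>i<k. ((- 1) ^ i * w ^ i) *\<^sub>C (S ^^ Suc i) x)
      = ((- 1) ^ k * w ^ k) *\<^sub>C (S ^^ Suc k) x + (- w) ^ Suc k *\<^sub>C (S ^^ Suc k) (H x)"
    using Suc by (simp only: power_minus[of w])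
  then show ?case by (simp only: sum.lessThan_Suc) (simp only: algebra_simps)
qed simp

text \<open>With \<open>w = z - z\<^sub>0\<close>, the resolvent near \<open>z\<^sub>0\<close> is the sum of \<open>D\<^sup>j P / w\<^sup>j\<^sup>+\<^sup>1\<close> over \<open>j < n\<close>, which is finite
  because \<open>D\<close> is nilpotent, and of the Neumann series of \<open>(- w)\<^sup>i S\<^sup>i\<^sup>+\<^sup>1\<close>. The order of the pole is the
  order \<open>n\<close> of nilpotency.\<close>

theorem spectral_decomposition_imp_pole:
  fixes A :: "'a::complex_banach operator"
  assumes \<omega>: "\<omega> \<in> resolvent_set A" and dec: "spectral_decomposition A \<omega> z0 P D S"
    and lin: "\<And>x y. x \<in> dom A \<Longrightarrow> y \<in> dom A \<Longrightarrow> x + y \<in> dom A \<and> the (A (x + y)) = the (A x) + the (A y)"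
      "\<And>c x. x \<in> dom A \<Longrightarrow> c *\<^sub>C x \<in> dom A \<and> the (A (c *\<^sub>C x)) = c *\<^sub>C the (A x)"
  shows "resolvent_pole A z0"
proof -
  have P: "bounded_clinear P" and D: "bounded_clinear D" and S: "bounded_clinear S"
    and alg: "\<And>x. P (P x) = P x" "\<And>x. D (P x) = D x" "\<And>x. P (D x) = D x" "\<And>x. P (S x) = 0"
    and AP: "\<And>x. P x \<in> dom A" "\<And>x. the (A (P x)) = z0 *\<^sub>C P x + D x"
    and AS: "\<And>x. S x \<in> dom A" "\<And>x. z0 *\<^sub>C S x - the (A (S x)) = x - P x"
    and nil: "\<exists>m. \<forall>x. (D ^^ m) (P x) = 0" and P0: "\<exists>x. P x \<noteq> 0"
    and comm: "\<And>Y x. bounded_clinear Y \<Longrightarrow> (\<And>x. Y (resolvent A \<omega> x) = resolvent A \<omega> (Y x)) \<Longrightarrow>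
        Y (P x) = P (Y x) \<and> Y (D x) = D (Y x) \<and> Y (S x) = S (Y x)"
    using dec by (auto simp: spectral_decomposition_def)
  note R = resolventD(1)[OF \<omega>]
  have RP: "P (resolvent A \<omega> x) = resolvent A \<omega> (P x)" and RD: "D (resolvent A \<omega> x) = resolvent A \<omega> (D x)"
    and RS: "S (resolvent A \<omega> x) = resolvent A \<omega> (S x)" for x
    using comm[OF R] by simp_all
  define n where "n = (LEAST m. \<forall>x. (D ^^ m) (P x) = 0)"
  have Dn: "(D ^^ n) (P x) = 0" for x
    using LeastI_ex[OF nil] by (simp add: n_def)
  have n0: "0 < n" using Dn P0 by (cases n) auto
  have Dn1: "\<exists>x. (D ^^ (n - 1)) (P x) \<noteq> 0"
    using not_less_Least[of "n - 1" "\<lambda>m. \<forall>x. (D ^^ m) (P x) = 0"] n0 by (auto simp: n_def)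
  obtain M where M: "0 < M" "\<And>x. norm (S x) \<le> M * norm x" using bounded_clinear_bound[OF S] by blast
  \<comment> \<open>In this disc \<open>w S\<close> has norm at most \<open>1/2\<close>, and the Neumann series converges.\<close>
  define r where "r = 1 / (2 * M)"
  have r: "0 < r" using M(1) by (simp add: r_def)
  \<comment> \<open>The coefficient of \<open>w\<^sup>k\<^sup>-\<^sup>n\<close>; the leading one is the last nonvanishing power of \<open>D\<close>.\<close>
  define U where "U k = (if k < n then (\<lambda>x. (D ^^ (n - Suc k)) (P x))
    else (\<lambda>x. (- 1) ^ (k - n) *\<^sub>C (S ^^ Suc (k - n)) x))" for k
  have U: "bounded_clinear (U k)" for k
    unfolding U_def
    using bounded_clinear_compose[OF bounded_clinear_funpow[OF D] P]
      bounded_clinear_scaleC[OF bounded_clinear_funpow[OF S]] by (simp del: funpow.simps)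
  have "z \<in> resolvent_set A \<and>
      (\<lambda>N. onorm (\<lambda>x. resolvent A z x - (\<Sum>k<N. ((z - z0) powi (int k - int n)) *\<^sub>C U k x))) \<longlonglongrightarrow> 0"
    if z: "z \<in> ball z0 r - {z0}" for z
  proof -
    define w where "w = z - z0"
    have w: "w \<noteq> 0" "cmod w < r" using z by (auto simp: w_def dist_norm norm_minus_commute)
    have wM: "cmod w * M \<le> 1/2" using w(2) M(1) by (simp add: r_def field_simps)
    define F where "F x = - w *\<^sub>C S x" for x
    have F: "bounded_clinear F" unfolding F_def by (rule bounded_clinear_scaleC[OF S])
    have wS: "cmod w * norm (S x) \<le> 1/2 * norm x" for x
    proof -
      have "cmod w * norm (S x) \<le> cmod w * (M * norm x)" using M(2) by (intro mult_left_mono) auto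
      also have "\<dots> \<le> 1/2 * norm x" using mult_right_mono[OF wM, of "norm x"] by (simp add: mult.assoc)
      finally show ?thesis .
    qed
    have Fbd: "norm (F x) \<le> 1/2 * norm x" for x
      using wS[of x] by (simp add: F_def norm_scaleC del: cvs.scale_minus_left)
    obtain X where X: "bounded_clinear X" "\<And>x. X x = x + F (X x)"
      "\<And>Y x. bounded_linear Y \<Longrightarrow> (\<And>y. Y (F y) = F (Y y)) \<Longrightarrow> Y (X x) = X (Y x)"
      by (rule neumann_series[OF F _ _ Fbd]) auto
    define H where "H x = S (X x)" for x
    have H: "bounded_clinear H" unfolding H_def by (rule bounded_clinear_compose[OF S X(1)])
    have Hrec: "H x = S x - w *\<^sub>C S (H x)" for x
    proof -
      have "S (X x) = S (x + F (X x))" using X(2) by simp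
      then show ?thesis by (simp add: H_def F_def bounded_clinearD[OF S])
    qed
    define Q where "Q x = (\<Sum>j<n. (inverse w ^ Suc j) *\<^sub>C (D ^^ j) (P x))" for x
    have Q: "bounded_clinear Q"
      unfolding Q_def
      by (intro bounded_clinear_sum bounded_clinear_scaleC bounded_clinear_compose[OF bounded_clinear_funpow[OF D] P])
    define G where "G x = Q x + H x" for x
    have G: "bounded_clinear G" unfolding G_def by (rule bounded_clinear_add[OF Q H])
    have PDj: "P ((D ^^ j) (P x)) = (D ^^ j) (P x)" for j x
      using alg by (cases j) simp_all
    have ADj: "(D ^^ j) (P x) \<in> dom A" "the (A ((D ^^ j) (P x))) = z0 *\<^sub>C (D ^^ j) (P x) + (D ^^ Suc j) (P x)" for j x
      using AP[of "(D ^^ j) (P x)"] by (simp_all add: PDj)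
    have Qsum: "(\<Sum>j<k. (inverse w ^ Suc j) *\<^sub>C (D ^^ j) (P x)) \<in> dom A \<and>
        z *\<^sub>C (\<Sum>j<k. (inverse w ^ Suc j) *\<^sub>C (D ^^ j) (P x))
        - the (A (\<Sum>j<k. (inverse w ^ Suc j) *\<^sub>C (D ^^ j) (P x)))
        = P x - (inverse w ^ k) *\<^sub>C (D ^^ k) (P x)" for k x
    proof (induction k)
      case 0
      have "0 *\<^sub>C P x \<in> dom A" "the (A (0 *\<^sub>C P x)) = 0 *\<^sub>C the (A (P x))"
        using lin(2)[OF AP(1)] by blast+
      then show ?case by simp
    next
      case (Suc k)
      let ?s = "\<Sum>j<k. (inverse w ^ Suc j) *\<^sub>C (D ^^ j) (P x)" and ?t = "(inverse w ^ Suc k) *\<^sub>C (D ^^ k) (P x)"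
      have t: "?t \<in> dom A" "the (A ?t) = (inverse w ^ Suc k) *\<^sub>C (z0 *\<^sub>C (D ^^ k) (P x) + (D ^^ Suc k) (P x))"
        using lin(2)[OF ADj(1)[of k x], of "inverse w ^ Suc k"] by (simp_all only: ADj(2))
      have st: "?s + ?t \<in> dom A" "the (A (?s + ?t)) = the (A ?s) + the (A ?t)"
        using lin(1)[OF conjunct1[OF Suc] t(1)] by blast+
      have "z *\<^sub>C ?t - the (A ?t) = (inverse w ^ Suc k) *\<^sub>C (w *\<^sub>C (D ^^ k) (P x) - (D ^^ Suc k) (P x))"
        unfolding t(2)
        by (simp only: w_def cvs.scale_right_distrib cvs.scale_right_diff_distrib cvs.scale_left_diff_distrib
            cvs.scale_scale algebra_simps)
      also have "\<dots> = (inverse w ^ k) *\<^sub>C (D ^^ k) (P x) - (inverse w ^ Suc k) *\<^sub>C (D ^^ Suc k) (P x)"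
      proof -
        have "inverse w ^ Suc k * w = inverse w ^ k" using w(1) by simp
        then show ?thesis by (simp only: cvs.scale_right_diff_distrib cvs.scale_scale)
      qed
      finally have tt: "z *\<^sub>C ?t - the (A ?t)
        = (inverse w ^ k) *\<^sub>C (D ^^ k) (P x) - (inverse w ^ Suc k) *\<^sub>C (D ^^ Suc k) (P x)" .
      have "z *\<^sub>C (?s + ?t) - the (A (?s + ?t)) = (z *\<^sub>C ?s - the (A ?s)) + (z *\<^sub>C ?t - the (A ?t))"
        unfolding st(2) by (simp only: cvs.scale_right_distrib algebra_simps)
      also have "\<dots> = P x - (inverse w ^ Suc k) *\<^sub>C (D ^^ Suc k) (P x)"
        unfolding conjunct2[OF Suc] tt by (simp only: algebra_simps)
      finally show ?case using st(1) by (simp only: sum.lessThan_Suc)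
    qed
    have Qdom: "Q x \<in> dom A" and AQ: "z *\<^sub>C Q x - the (A (Q x)) = P x" for x
      using Qsum[where k = n and x = x] by (simp_all add: Q_def Dn)
    have Hdom: "H x \<in> dom A" and AH: "z *\<^sub>C H x - the (A (H x)) = x - P x" for x
    proof -
      show "H x \<in> dom A" unfolding H_def by (rule AS(1))
      have PX: "P (X x) = P x"
      proof -
        have "P (X x) = P (x + F (X x))" using X(2) by simp
        then show ?thesis by (simp add: F_def bounded_clinearD[OF P] alg(4))
      qed
      have AHx: "the (A (H x)) = z0 *\<^sub>C H x - (X x - P x)"
        using AS(2)[of "X x"] by (simp add: H_def PX algebra_simps)
      have Xx: "X x = x - w *\<^sub>C H x" using X(2)[of x] by (simp add: F_def H_def)
      have zH: "z *\<^sub>C H x = z0 *\<^sub>C H x + w *\<^sub>C H x"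
        by (simp add: w_def cvs.scale_left_diff_distrib)
      show "z *\<^sub>C H x - the (A (H x)) = x - P x"
        unfolding AHx Xx zH by (simp only: algebra_simps)
    qed
    have Gdom: "G x \<in> dom A" for x
      using lin(1)[OF Qdom Hdom] by (simp add: G_def)
    have AG: "z *\<^sub>C G x - the (A (G x)) = x" for x
    proof -
      have "z *\<^sub>C G x - the (A (G x)) = (z *\<^sub>C Q x - the (A (Q x))) + (z *\<^sub>C H x - the (A (H x)))"
        using lin(1)[OF Qdom Hdom] by (simp add: G_def scaleC_add_right algebra_simps)
      then show ?thesis by (simp add: AQ AH)
    qed
    have RDj: "(D ^^ j) (resolvent A \<omega> x) = resolvent A \<omega> ((D ^^ j) x)" for j x
      by (rule funpow_commute[symmetric]) (simp add: RD)
    have RX: "resolvent A \<omega> (X x) = X (resolvent A \<omega> x)" for x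
      by (rule X(3)) (simp_all add: F_def RS bounded_clinearD[OF R])
    have RG: "G (resolvent A \<omega> x) = resolvent A \<omega> (G x)" for x
      by (simp add: G_def Q_def H_def RP RDj RS bounded_clinearD(2,3)[OF R]
          linear_sum[OF bounded_linear.linear[OF bounded_clinearD(1)[OF R]]] flip: RX)
    note zG = resolvent_setI_commuting[OF \<omega> G Gdom AG RG]
    obtain C where C: "0 < C" "\<And>x. norm (H x) \<le> C * norm x" using bounded_clinear_bound[OF H] by blast
    have rem: "resolvent A z x - (\<Sum>k<N + n. (w powi (int k - int n)) *\<^sub>C U k x)
        = (- w) ^ N *\<^sub>C (S ^^ N) (H x)" for N :: nat and x
    proof -
      have "(\<Sum>k<n. (w powi (int k - int n)) *\<^sub>C U k x) = Q x"
        unfolding Q_def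
      proof (rule sum.reindex_bij_witness[where i = "\<lambda>j. n - Suc j" and j = "\<lambda>k. n - Suc k"])
        fix k assume k: "k \<in> {..<n}"
        then have "int k - int n = - int (Suc (n - Suc k))" by auto
        then have "w powi (int k - int n) = inverse w ^ Suc (n - Suc k)"
          by (simp only: power_int_minus power_int_of_nat power_inverse)
        then show "inverse w ^ Suc (n - Suc k) *\<^sub>C (D ^^ (n - Suc k)) (P x) = (w powi (int k - int n)) *\<^sub>C U k x"
          using k by (simp add: U_def)
      qed auto
      moreover have "(\<Sum>k<N + n. (w powi (int k - int n)) *\<^sub>C U k x) = (\<Sum>k<n. (w powi (int k - int n)) *\<^sub>C U k x)
          + (\<Sum>i<N. ((- 1) ^ i * w ^ i) *\<^sub>C (S ^^ Suc i) x)"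
      proof (induction N)
        case (Suc N)
        then show ?case by (simp add: U_def scaleC_scaleC power_int_of_nat mult.commute)
      qed simp
      ultimately show ?thesis
        using geometric_expansion[OF S Hrec, of x N] by (simp add: zG(2) G_def algebra_simps)
    qed
    have small: "norm ((- w) ^ N *\<^sub>C (S ^^ N) y) \<le> (1/2) ^ N * norm y" for N y
    proof (induction N)
      case (Suc N)
      have "norm ((- w) ^ Suc N *\<^sub>C (S ^^ Suc N) y) = cmod w * norm (S ((- w) ^ N *\<^sub>C (S ^^ N) y))"
        by (simp add: norm_scaleC bounded_clinearD(2)[OF S] norm_mult)
      also have "\<dots> \<le> 1/2 * norm ((- w) ^ N *\<^sub>C (S ^^ N) y)" by (rule wS)
      also have "\<dots> \<le> 1/2 * ((1/2) ^ N * norm y)" using Suc by (intro mult_left_mono) auto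
      finally show ?case by simp
    qed simp
    have "(\<lambda>N. onorm (\<lambda>x. (- w) ^ N *\<^sub>C (S ^^ N) (H x))) \<longlonglongrightarrow> 0"
    proof (rule Lim_null_comparison)
      show "(\<lambda>N. (1/2) ^ N * C) \<longlonglongrightarrow> 0"
        by (intro tendsto_mult_left_zero LIMSEQ_power_zero) simp
      have "norm (onorm (\<lambda>x. (- w) ^ N *\<^sub>C (S ^^ N) (H x))) \<le> (1/2) ^ N * C" for N
      proof -
        have bl: "bounded_linear (\<lambda>x. (- w) ^ N *\<^sub>C (S ^^ N) (H x))"
          by (intro bounded_clinearD(1) bounded_clinear_scaleC bounded_clinear_compose[OF bounded_clinear_funpow[OF S] H])
        have "onorm (\<lambda>x. (- w) ^ N *\<^sub>C (S ^^ N) (H x)) \<le> (1/2) ^ N * C"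
        proof (rule onorm_bound)
          show "norm ((- w) ^ N *\<^sub>C (S ^^ N) (H x)) \<le> (1/2) ^ N * C * norm x" for x
            using order_trans[OF small[of N "H x"] mult_left_mono[OF C(2)[of x], of "(1/2) ^ N"]]
            by (simp add: mult.assoc)
        qed (use C in simp)
        with onorm_pos_le[OF bl] show ?thesis by simp
      qed
      then show "\<forall>\<^sub>F N in sequentially. norm (onorm (\<lambda>x. (- w) ^ N *\<^sub>C (S ^^ N) (H x))) \<le> (1/2) ^ N * C"
        by simp
    qed
    then have "(\<lambda>N. onorm (\<lambda>x. resolvent A z x - (\<Sum>k<N + n. (w powi (int k - int n)) *\<^sub>C U k x))) \<longlonglongrightarrow> 0"
      by (simp only: rem)
    then have "(\<lambda>N. onorm (\<lambda>x. resolvent A z x - (\<Sum>k<N. (w powi (int k - int n)) *\<^sub>C U k x))) \<longlonglongrightarrow> 0"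
      by (rule LIMSEQ_offset)
    with zG(1) show ?thesis by (simp only: w_def)
  qed
  moreover have "U 0 \<noteq> (\<lambda>x. 0)"
    using Dn1 n0 by (auto simp: U_def fun_eq_iff)
  ultimately have "resolvent_pole_of_order n A z0"
    unfolding resolvent_pole_of_order_def using n0 r U by blast
  then show ?thesis by (auto simp: resolvent_pole_def)
qed

text \<open>On the range of \<open>P\<close>, the nonzero values of the last nonvanishing power of \<open>D\<close> are eigenvectors.\<close>

lemma spectral_decomposition_imp_eigenvector:
  fixes A :: "'a::complex_banach operator"
  assumes dec: "spectral_decomposition A \<omega> z P D S"
  obtains x where "x \<in> dom A" "x \<noteq> 0" "the (A x) = z *\<^sub>C x"
proof -
  have alg: "\<And>x. P (P x) = P x" "\<And>x. D (P x) = D x" "\<And>x. P (D x) = D x"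
    and AP: "\<And>x. P x \<in> dom A" "\<And>x. the (A (P x)) = z *\<^sub>C P x + D x"
    and nil: "\<exists>m. \<forall>x. (D ^^ m) (P x) = 0" and P0: "\<exists>x. P x \<noteq> 0"
    using dec by (auto simp: spectral_decomposition_def)
  define n where "n = (LEAST m. \<forall>x. (D ^^ m) (P x) = 0)"
  have Dn: "(D ^^ n) (P x) = 0" for x
    using LeastI_ex[OF nil] by (simp add: n_def)
  have n0: "0 < n" using Dn P0 by (cases n) auto
  obtain x where x: "(D ^^ (n - 1)) (P x) \<noteq> 0"
    using not_less_Least[of "n - 1" "\<lambda>m. \<forall>x. (D ^^ m) (P x) = 0"] n0 by (auto simp: n_def)
  define y where "y = (D ^^ (n - 1)) (P x)"
  have Py: "P y = y" unfolding y_def using alg by (cases "n - 1") simp_all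
  have "D y = (D ^^ Suc (n - 1)) (P x)" by (simp add: y_def)
  then have "D y = 0" using Dn n0 by simp
  moreover have "y \<noteq> 0" unfolding y_def by (rule x)
  ultimately show ?thesis using AP[of y] by (intro that[of y]) (simp_all add: Py)
qed

section \<open>Pseudo-resolvents and the spectral projection\<close>

lemma has_vector_derivative_iff_quotient:
  "(f has_vector_derivative D) (at t within S) \<longleftrightarrow>
    ((\<lambda>s. (f s - f t) /\<^sub>R (s - t)) \<longlongrightarrow> D) (at t within S)"
proof -
  have eq: "norm ((1 / norm (s - t)) *\<^sub>R (f s - (f t + (s - t) *\<^sub>R D)))
      = norm ((f s - f t) /\<^sub>R (s - t) - D)" if "s \<noteq> t" for s
  proof -
    have "(f s - f t) /\<^sub>R (s - t) - D = (1 / (s - t)) *\<^sub>R (f s - (f t + (s - t) *\<^sub>R D))"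
      using that by (simp add: scaleR_right_diff_distrib scaleR_add_right divide_inverse)
    then show ?thesis by simp
  qed
  have "(f has_vector_derivative D) (at t within S) \<longleftrightarrow>
      ((\<lambda>s. norm ((1 / norm (s - t)) *\<^sub>R (f s - (f t + (s - t) *\<^sub>R D)))) \<longlongrightarrow> 0) (at t within S)"
    unfolding tendsto_norm_zero_iff
    by (simp add: has_vector_derivative_def has_derivative_within bounded_linear_scaleR_left)
  also have "\<dots> \<longleftrightarrow> ((\<lambda>s. norm ((f s - f t) /\<^sub>R (s - t) - D)) \<longlongrightarrow> 0) (at t within S)"
    by (intro tendsto_cong, unfold eventually_at_filter, intro always_eventually allI impI eq)
  also have "\<dots> \<longleftrightarrow> ((\<lambda>s. (f s - f t) /\<^sub>R (s - t)) \<longlongrightarrow> D) (at t within S)"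
    by (simp add: tendsto_norm_zero_iff LIM_zero_iff)
  finally show ?thesis .
qed

text \<open>The resolvent identity without reference to an operator. It already implies that \<open>h\<close> is
  continuous and has the derivative \<open>- h z (h z x)\<close>, so such families are holomorphic.\<close>

definition pseudo_resolvent :: "complex set \<Rightarrow> (complex \<Rightarrow> 'a::complex_normed_vector \<Rightarrow> 'a) \<Rightarrow> bool" where
  "pseudo_resolvent U h \<longleftrightarrow> (\<forall>z\<in>U. bounded_clinear (h z)) \<and>
     (\<forall>z\<in>U. \<forall>w\<in>U. \<forall>x. h z x - h w x = (w - z) *\<^sub>C h z (h w x))"

text \<open>The resolvent identity itself bounds \<open>h z\<close> near \<open>w\<close>: \<open>h z x = h w x - (z - w) h w (h z x)\<close>, where the last
  term is at most half of \<open>h z x\<close> in norm if \<open>z\<close> is close to \<open>w\<close>.\<close>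

lemma tendsto_pseudo_resolvent:
  assumes h: "pseudo_resolvent U h" and w: "w \<in> U"
    and g: "(g \<longlongrightarrow> w) F" "\<forall>\<^sub>F t in F. g t \<in> U" and y: "(y \<longlongrightarrow> b) F"
  shows "((\<lambda>t. h (g t) (y t)) \<longlongrightarrow> h w b) F"
proof -
  have bc: "\<And>z. z \<in> U \<Longrightarrow> bounded_clinear (h z)"
    and id: "\<And>z w x. z \<in> U \<Longrightarrow> w \<in> U \<Longrightarrow> h z x - h w x = (w - z) *\<^sub>C h z (h w x)"
    using h by (auto simp: pseudo_resolvent_def)
  obtain M where M: "0 < M" "\<And>x. norm (h w x) \<le> M * norm x"
    using bounded_clinear_bound[OF bc[OF w]] by blast
  have near: "norm (h z x) \<le> 2 * M * norm x" if z: "z \<in> U" "cmod (z - w) \<le> 1 / (2 * M)" for z x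
  proof -
    have "h z x = h w x - (z - w) *\<^sub>C h w (h z x)" using id[OF w z(1), of x] by (simp add: algebra_simps)
    then have "norm (h z x) \<le> norm (h w x) + cmod (z - w) * norm (h w (h z x))"
      using norm_triangle_ineq4 norm_scaleC by metis
    also have "cmod (z - w) * norm (h w (h z x)) \<le> 1 / (2 * M) * (M * norm (h z x))"
      using z(2) M by (intro mult_mono) auto
    also have "\<dots> = norm (h z x) / 2" using M(1) by simp
    finally show ?thesis using M(2)[of x] by simp
  qed
  have ev: "\<forall>\<^sub>F t in F. g t \<in> U \<and> cmod (g t - w) \<le> 1 / (2 * M)"
    using eventually_conj[OF g(2) tendstoD[OF g(1), of "1 / (2 * M)"]] M(1)
    by (auto simp: dist_norm elim: eventually_mono)
  have "((\<lambda>t. h (g t) (y t) - h w b) \<longlongrightarrow> 0) F"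
  proof (rule Lim_null_comparison)
    show "\<forall>\<^sub>F t in F. norm (h (g t) (y t) - h w b)
        \<le> 2 * M * norm (y t - b) + cmod (g t - w) * (2 * M * norm (h w b))"
      using ev
    proof (rule eventually_mono)
      fix t assume t: "g t \<in> U \<and> cmod (g t - w) \<le> 1 / (2 * M)"
      have "h (g t) (y t) - h w b = h (g t) (y t - b) + (w - g t) *\<^sub>C h (g t) (h w b)"
        using id[of "g t" w b] t w by (simp add: bounded_clinearD(4)[OF bc] algebra_simps)
      then have "norm (h (g t) (y t) - h w b)
          \<le> norm (h (g t) (y t - b)) + cmod (g t - w) * norm (h (g t) (h w b))"
        using norm_triangle_ineq norm_scaleC norm_minus_commute by metis
      also have "\<dots> \<le> 2 * M * norm (y t - b) + cmod (g t - w) * (2 * M * norm (h w b))"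
        using near t by (intro add_mono mult_left_mono) auto
      finally show "norm (h (g t) (y t) - h w b)
          \<le> 2 * M * norm (y t - b) + cmod (g t - w) * (2 * M * norm (h w b))" .
    qed
    have "((\<lambda>t. 2 * M * norm (y t - b) + cmod (g t - w) * (2 * M * norm (h w b)))
        \<longlongrightarrow> 2 * M * 0 + 0 * (2 * M * norm (h w b))) F"
      using g(1) y by (intro tendsto_intros tendsto_norm_zero LIM_zero)
    then show "((\<lambda>t. 2 * M * norm (y t - b) + cmod (g t - w) * (2 * M * norm (h w b))) \<longlongrightarrow> 0) F"
      by simp
  qed
  then show ?thesis by (rule LIM_zero_cancel)
qed

lemma has_vector_derivative_pseudo_resolvent:
  assumes h: "pseudo_resolvent U h" and g: "(g has_vector_derivative g') (at t within S)"
    and gU: "\<And>s. s \<in> S \<Longrightarrow> g s \<in> U" and t: "t \<in> S"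
  shows "((\<lambda>s. h (g s) x) has_vector_derivative - (g' *\<^sub>C h (g t) (h (g t) x))) (at t within S)"
  unfolding has_vector_derivative_iff_quotient
proof -
  interpret sc: bounded_bilinear "scaleC :: complex \<Rightarrow> 'a \<Rightarrow> 'a" by (rule bounded_bilinear_scaleC)
  have id: "\<And>z w x. z \<in> U \<Longrightarrow> w \<in> U \<Longrightarrow> h z x - h w x = (w - z) *\<^sub>C h z (h w x)"
    using h by (auto simp: pseudo_resolvent_def)
  have lim: "((\<lambda>s. - (((g s - g t) /\<^sub>R (s - t)) *\<^sub>C h (g s) (h (g t) x))) \<longlongrightarrow>
      - (g' *\<^sub>C h (g t) (h (g t) x))) (at t within S)"
  proof (intro tendsto_minus sc.tendsto)
    show "((\<lambda>s. (g s - g t) /\<^sub>R (s - t)) \<longlongrightarrow> g') (at t within S)"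
      using g by (simp add: has_vector_derivative_iff_quotient)
    have "continuous (at t within S) g" using g by (rule has_vector_derivative_continuous)
    then show "((\<lambda>s. h (g s) (h (g t) x)) \<longlongrightarrow> h (g t) (h (g t) x)) (at t within S)"
      using gU t by (intro tendsto_pseudo_resolvent[OF h])
        (auto simp: continuous_within eventually_at_filter intro: always_eventually)
  qed
  have "\<forall>\<^sub>F s in at t within S. - (((g s - g t) /\<^sub>R (s - t)) *\<^sub>C h (g s) (h (g t) x))
      = (h (g s) x - h (g t) x) /\<^sub>R (s - t)"
  proof -
    have "- (((g s - g t) /\<^sub>R (s - t)) *\<^sub>C h (g s) (h (g t) x)) = (h (g s) x - h (g t) x) /\<^sub>R (s - t)"
      if "s \<in> S" for s
      using id[OF gU[OF that] gU[OF t], of x]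
      by (simp add: sc.scaleR_left flip: cvs.scale_minus_left scaleR_minus_right)
    then show ?thesis by (auto simp: eventually_at_filter intro: always_eventually)
  qed
  from Lim_transform_eventually[OF lim this]
  show "((\<lambda>s. (h (g s) x - h (g t) x) /\<^sub>R (s - t)) \<longlongrightarrow> - (g' *\<^sub>C h (g t) (h (g t) x))) (at t within S)" .
qed

lemma has_vector_derivative_cis: "(cis has_vector_derivative \<i> * cis t) (at t within S)"
  using has_derivative_cis[where f = "\<lambda>t. t", OF has_derivative_ident]
  by (simp add: has_vector_derivative_def)

text \<open>Cauchy's theorem for a disc, for vector-valued functions. Shrink the circle by a factor \<open>s\<close> and
  differentiate the integral in \<open>s\<close>. The derivatives of the integrand in the radial and in the
  angular direction are proportional, with the factor \<open>\<i> s\<close>, so the derivative of the integral is the integral of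
  an angular derivative over a full period, which is \<open>0\<close>.\<close>

theorem pseudo_resolvent_circle_integral:
  fixes h :: "complex \<Rightarrow> 'a::complex_banach \<Rightarrow> 'a"
  assumes h: "pseudo_resolvent (cball z0 r) h" and r: "0 < r"
  shows "integral {0..2 * pi} (\<lambda>\<theta>. rcis r \<theta> *\<^sub>C h (z0 + rcis r \<theta>) x) = 0"
proof -
  interpret sc: bounded_bilinear "scaleC :: complex \<Rightarrow> 'a \<Rightarrow> 'a" by (rule bounded_bilinear_scaleC)
  define \<zeta> where "\<zeta> s \<theta> = z0 + (of_real s * of_real r) * cis \<theta>" for s \<theta>
  have \<zeta>: "\<zeta> s \<theta> \<in> cball z0 r" if "s \<in> {0..1}" for s \<theta>
    using that r by (simp add: \<zeta>_def dist_norm norm_mult mult_left_le_one_le)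
  define f where "f s \<theta> = (of_real s * cis \<theta>) *\<^sub>C h (\<zeta> s \<theta>) x" for s \<theta>
  define f' where "f' s \<theta> = cis \<theta> *\<^sub>C h (\<zeta> s \<theta>) x
      - (of_real s * cis \<theta> * (of_real r * cis \<theta>)) *\<^sub>C h (\<zeta> s \<theta>) (h (\<zeta> s \<theta>) x)" for s \<theta>
  have ds: "((\<lambda>s. f s \<theta>) has_vector_derivative f' s \<theta>) (at s within {0..1})" if s: "s \<in> {0..1}" for s \<theta>
  proof -
    have "((\<lambda>s. \<zeta> s \<theta>) has_vector_derivative of_real r * cis \<theta>) (at s within {0..1})"
      unfolding \<zeta>_def by (auto intro!: derivative_eq_intros)
    from has_vector_derivative_pseudo_resolvent[OF h this _ s]
    have dh: "((\<lambda>s. h (\<zeta> s \<theta>) x) has_vector_derivative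
        - ((of_real r * cis \<theta>) *\<^sub>C h (\<zeta> s \<theta>) (h (\<zeta> s \<theta>) x))) (at s within {0..1})" using \<zeta> by blast
    have dc: "((\<lambda>s. of_real s * cis \<theta>) has_vector_derivative cis \<theta>) (at s within {0..1})"
      by (auto intro!: derivative_eq_intros)
    show ?thesis
      unfolding f_def f'_def
      by (rule has_vector_derivative_eq_rhs[OF sc.has_vector_derivative[OF dc dh]])
        (simp add: scaleC_scaleC)
  qed
  have dt: "(f s has_vector_derivative (\<i> * of_real s) *\<^sub>C f' s \<theta>) (at \<theta> within T)"
    if s: "s \<in> {0..1}" and T: "\<theta> \<in> T" for s \<theta> T
  proof -
    have "(\<zeta> s has_vector_derivative of_real s * of_real r * (\<i> * cis \<theta>)) (at \<theta> within T)"
      unfolding \<zeta>_def by (auto intro!: derivative_eq_intros has_vector_derivative_cis)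
    from has_vector_derivative_pseudo_resolvent[OF h this _ T]
    have dh: "((\<lambda>\<theta>. h (\<zeta> s \<theta>) x) has_vector_derivative
        - ((of_real s * of_real r * (\<i> * cis \<theta>)) *\<^sub>C h (\<zeta> s \<theta>) (h (\<zeta> s \<theta>) x))) (at \<theta> within T)"
      using \<zeta>[OF s] by blast
    have dc: "((\<lambda>\<theta>. of_real s * cis \<theta>) has_vector_derivative of_real s * (\<i> * cis \<theta>)) (at \<theta> within T)"
      by (auto intro!: derivative_eq_intros has_vector_derivative_cis)
    show ?thesis
      unfolding f_def f'_def
      by (rule has_vector_derivative_eq_rhs[OF sc.has_vector_derivative[OF dc dh]])
        (simp add: scaleC_scaleC cvs.scale_right_diff_distrib mult.commute mult.left_commute)
  qed
  have cont: "continuous_on ({0..1} \<times> cbox 0 (2 * pi)) (\<lambda>(s, \<theta>). f' s \<theta>)"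
    unfolding continuous_on_def case_prod_beta f'_def
  proof
    fix p :: "real \<times> real" assume p: "p \<in> {0..1} \<times> cbox 0 (2 * pi)"
    let ?F = "at p within {0..1} \<times> cbox 0 (2 * pi)"
    have cis: "((\<lambda>p. cis (snd p)) \<longlongrightarrow> cis (snd p)) ?F"
      using has_vector_derivative_cis[of "snd p" UNIV, THEN has_vector_derivative_continuous]
      by (intro isCont_tendsto_compose[where g = cis] tendsto_intros) auto
    have lim: "((\<lambda>p. \<zeta> (fst p) (snd p)) \<longlongrightarrow> \<zeta> (fst p) (snd p)) ?F"
      unfolding \<zeta>_def by (intro tendsto_intros cis)
    have ev: "\<forall>\<^sub>F q in ?F. \<zeta> (fst q) (snd q) \<in> cball z0 r"
      using \<zeta> by (auto simp: eventually_at_filter intro!: always_eventually)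
    have p1: "\<zeta> (fst p) (snd p) \<in> cball z0 r" using p \<zeta> by auto
    note T = tendsto_pseudo_resolvent[OF h p1 lim ev]
    show "((\<lambda>p. cis (snd p) *\<^sub>C h (\<zeta> (fst p) (snd p)) x
        - (of_real (fst p) * cis (snd p) * (of_real r * cis (snd p))) *\<^sub>C h (\<zeta> (fst p) (snd p)) (h (\<zeta> (fst p) (snd p)) x))
      \<longlongrightarrow> cis (snd p) *\<^sub>C h (\<zeta> (fst p) (snd p)) x
        - (of_real (fst p) * cis (snd p) * (of_real r * cis (snd p))) *\<^sub>C h (\<zeta> (fst p) (snd p)) (h (\<zeta> (fst p) (snd p)) x)) ?F"
      by (intro tendsto_intros sc.tendsto T cis)
  qed
  define I where "I s = integral (cbox 0 (2 * pi)) (f s)" for s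
  have int: "f s integrable_on cbox 0 (2 * pi)" if "s \<in> {0..1}" for s
    using dt[OF that] by (intro integrable_continuous)
      (auto simp: continuous_on_eq_continuous_within intro: has_vector_derivative_continuous)
  have I': "(I has_vector_derivative integral (cbox 0 (2 * pi)) (f' s)) (at s within {0..1})"
    if "s \<in> {0..1}" for s
    unfolding I_def using ds int cont that
    by (intro leibniz_rule_vector_derivative) auto
  \<comment> \<open>At \<open>s = 0\<close> the factor \<open>\<i> s\<close> vanishes and nothing can be concluded, but a single point may be omitted.\<close>
  have zero: "integral (cbox 0 (2 * pi)) (f' s) = 0" if s: "s \<in> {0..1}" "s \<noteq> 0" for s
  proof -
    have "continuous_on (cbox 0 (2 * pi)) (f' s)"
      using continuous_on_compose2[OF cont, of "cbox 0 (2 * pi)" "\<lambda>\<theta>. (s, \<theta>)"] s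
      by (simp add: continuous_on_Pair image_subset_iff)
    then have int': "f' s integrable_on cbox 0 (2 * pi)" by (rule integrable_continuous)
    have "((\<lambda>\<theta>. (\<i> * of_real s) *\<^sub>C f' s \<theta>) has_integral f s (2 * pi) - f s 0) {0..2 * pi}"
      using dt[OF s(1)] by (intro fundamental_theorem_of_calculus) auto
    moreover have "f s (2 * pi) = f s 0" by (simp add: f_def \<zeta>_def)
    ultimately have "integral {0..2 * pi} (\<lambda>\<theta>. (\<i> * of_real s) *\<^sub>C f' s \<theta>) = 0"
      by (simp add: integral_unique)
    moreover have "integral (cbox 0 (2 * pi)) ((\<lambda>y. (\<i> * of_real s) *\<^sub>C y) \<circ> f' s)
        = (\<i> * of_real s) *\<^sub>C integral (cbox 0 (2 * pi)) (f' s)"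
      by (rule integral_linear[OF int' bounded_linear_scaleC])
    ultimately show ?thesis using s(2) by (simp add: o_def)
  qed
  have "I 1 = 0"
  proof (rule has_derivative_zero_unique_strong_interval[of "{0}" 0 1 I])
    show "continuous_on {0..1} I"
      unfolding continuous_on_eq_continuous_within
      using I' has_vector_derivative_continuous by blast
    show "I 0 = 0" by (simp add: I_def f_def[abs_def])
    show "(I has_derivative (\<lambda>h. 0)) (at s within {0..1})" if "s \<in> {0..1} - {0}" for s
      using I'[of s] zero[of s] that by (simp add: has_vector_derivative_def)
  qed auto
  moreover have "rcis r \<theta> *\<^sub>C h (z0 + rcis r \<theta>) x = r *\<^sub>R f 1 \<theta>" for \<theta>
    by (simp add: f_def \<zeta>_def rcis_def scaleC_scaleC flip: scaleC_of_real)
  ultimately show ?thesis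
    by (simp add: I_def)
qed

lemma complex_span_superset: "span B \<subseteq> cvs.span B"
proof
  fix x assume "x \<in> span B"
  then show "x \<in> cvs.span B"
  proof (induction rule: span_induct)
    case base
    show ?case
      by (auto simp: subspace_def cvs.span_zero cvs.span_add cvs.span_scale simp flip: scaleC_of_real)
  next
    case (step x)
    then show ?case by (rule cvs.span_base)
  qed
qed

text \<open>On the kernel of \<open>P\<close> the resolvent extends across \<open>z\<^sub>0\<close> by the value \<open>S\<close> to a pseudo-resolvent on
  the whole disc. By Cauchy's theorem the complementary projection annihilates the spectral
  projection, whatever circle is used in its definition.\<close>

theorem spectral_decomposition_imp_finite_multiplicity:
  fixes A :: "'a::complex_banach operator"
  assumes \<omega>: "\<omega> \<in> resolvent_set A" and dec: "spectral_decomposition A \<omega> z0 P D S"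
    and isolated: "\<exists>r>0. ball z0 r - {z0} \<subseteq> resolvent_set A"
  shows "algebraic_multiplicity A z0 < \<infinity>"
proof -
  have P: "bounded_clinear P" and S: "bounded_clinear S"
    and alg: "\<And>x. P (P x) = P x" "\<And>x. P (S x) = 0"
    and AS: "\<And>x. S x \<in> dom A" "\<And>x. z0 *\<^sub>C S x - the (A (S x)) = x - P x"
    and fin: "\<exists>B. finite B \<and> range P \<subseteq> span B"
    and comm: "\<And>Y x. bounded_clinear Y \<Longrightarrow> (\<And>x. Y (resolvent A \<omega> x) = resolvent A \<omega> (Y x)) \<Longrightarrow>
        Y (P x) = P (Y x) \<and> Y (S x) = S (Y x)"
    using dec by (auto simp: spectral_decomposition_def)
  define r where "r = (SOME r. 0 < r \<and> cball z0 r - {z0} \<subseteq> resolvent_set A)"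
  have r: "0 < r" "cball z0 r - {z0} \<subseteq> resolvent_set A"
  proof -
    obtain s where s: "0 < s" "ball z0 s - {z0} \<subseteq> resolvent_set A" using isolated by blast
    have "cball z0 (s / 2) \<subseteq> ball z0 s" using s(1) by auto
    with s have "\<exists>r. 0 < r \<and> cball z0 r - {z0} \<subseteq> resolvent_set A"
      by (intro exI[of _ "s / 2"]) auto
    from someI_ex[OF this] show "0 < r" "cball z0 r - {z0} \<subseteq> resolvent_set A" by (auto simp: r_def)
  qed
  define Q where "Q x = x - P x" for x
  have Q: "bounded_clinear Q" unfolding Q_def by (intro bounded_clinear_diff bounded_clinear_id P)
  have RQ: "resolvent A z (Q x) = Q (resolvent A z x)" and RS: "resolvent A z (S x) = S (resolvent A z x)"
    if z: "z \<in> resolvent_set A" for z x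
    using comm[OF resolventD(1)[OF z] resolvent_commute[OF z \<omega>], of x]
    by (simp_all add: Q_def bounded_clinearD(4)[OF resolventD(1)[OF z]])
  have PQ: "Q (Q x) = Q x" "Q (S x) = S x" for x
    by (simp_all add: Q_def alg bounded_clinearD(4)[OF P])
  define h where "h z x = (if z = z0 then S x else Q (resolvent A z x))" for z x
  have RSid: "resolvent A z (Q x) - S x = (z0 - z) *\<^sub>C resolvent A z (S x)" if z: "z \<in> resolvent_set A" for z x
  proof -
    have "z *\<^sub>C S x - the (A (S x)) = Q x + (z - z0) *\<^sub>C S x"
      using AS(2)[of x] by (simp add: Q_def cvs.scale_left_diff_distrib algebra_simps)
    then have "S x = resolvent A z (Q x) + (z - z0) *\<^sub>C resolvent A z (S x)"
      using resolventD(4)[OF z AS(1)[of x]] by (simp add: bounded_clinearD(2,3)[OF resolventD(1)[OF z]])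
    then show ?thesis by (simp add: cvs.scale_left_diff_distrib algebra_simps)
  qed
  have ps: "pseudo_resolvent (cball z0 r) h"
    unfolding pseudo_resolvent_def
  proof (intro conjI ballI allI)
    fix z assume z: "z \<in> cball z0 r"
    show "bounded_clinear (h z)"
    proof (cases "z = z0")
      case False
      then have zr: "z \<in> resolvent_set A" using z r(2) by blast
      show ?thesis
        using bounded_clinear_compose[OF Q resolventD(1)[OF zr]] False by (simp add: h_def[abs_def])
    qed (simp add: h_def[abs_def] S)
    fix w x assume w: "w \<in> cball z0 r"
    consider "z = z0" "w = z0" | "z = z0" "w \<noteq> z0" | "z \<noteq> z0" "w = z0" | "z \<noteq> z0" "w \<noteq> z0" by blast
    then show "h z x - h w x = (w - z) *\<^sub>C h z (h w x)"
    proof cases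
      case 2
      then have wr: "w \<in> resolvent_set A" using w r(2) by blast
      have "h w x - h z x = (z0 - w) *\<^sub>C resolvent A w (S x)"
        using RSid[OF wr] 2 by (simp add: h_def RQ[OF wr])
      also have "resolvent A w (S x) = S (Q (resolvent A w x))"
      proof -
        have "S (Q y) = Q (S y)" for y
          using comm[OF S RS[OF \<omega>, symmetric], of y] by (simp add: Q_def bounded_clinearD(4)[OF S])
        then show ?thesis by (simp add: RS[OF wr] PQ)
      qed
      finally have "h w x - h z x = (z0 - w) *\<^sub>C h z (h w x)" using 2 by (simp add: h_def)
      then have "- (h w x - h z x) = - ((z0 - w) *\<^sub>C h z (h w x))" by simp
      then show ?thesis using 2 by (simp flip: cvs.scale_minus_left)
    next
      case 3
      then have zr: "z \<in> resolvent_set A" using z r(2) by blast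
      show ?thesis using RSid[OF zr, of x] 3 RS[OF zr, of x]
        by (simp add: h_def RQ[OF zr] PQ)
    next
      case 4
      then have zr: "z \<in> resolvent_set A" and wr: "w \<in> resolvent_set A" using z w r(2) by blast+
      have "h z x - h w x = Q (resolvent A z x - resolvent A w x)"
        using 4 by (simp add: h_def bounded_clinearD(4)[OF Q])
      also have "\<dots> = (w - z) *\<^sub>C Q (resolvent A z (resolvent A w x))"
        by (simp add: resolvent_identity[OF zr wr] bounded_clinearD(2)[OF Q])
      finally show ?thesis using 4 by (simp add: h_def RQ[OF zr] PQ)
    qed simp
  qed
  have proj: "Q (spectral_projection A z0 x) = 0" for x
  proof -
    define g where "g \<theta> = (rcis r \<theta> / of_real (2 * pi)) *\<^sub>C resolvent A (z0 + rcis r \<theta>) x" for \<theta>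
    have sp: "spectral_projection A z0 x = integral {0..2 * pi} g"
      by (simp add: spectral_projection_def r_def[symmetric] g_def[abs_def])
    show ?thesis
    proof (cases "g integrable_on {0..2 * pi}")
      case True
      have "Q (integral {0..2 * pi} g) = integral {0..2 * pi} (Q \<circ> g)"
        by (rule integral_linear[OF True bounded_clinearD(1)[OF Q], symmetric])
      also have "Q \<circ> g = (\<lambda>\<theta>. (1 / (2 * pi)) *\<^sub>R (rcis r \<theta> *\<^sub>C h (z0 + rcis r \<theta>) x))"
        using r(1) by (auto simp: g_def h_def bounded_clinearD(2)[OF Q] scaleC_scaleC fun_eq_iff simp flip: scaleC_of_real)
      also have "integral {0..2 * pi} \<dots> = 0"
        using pseudo_resolvent_circle_integral[OF ps r(1), of x] by simp
      finally show ?thesis by (simp add: sp)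
    qed (simp add: sp not_integrable_integral bounded_clinearD(5)[OF Q])
  qed
  obtain B where B: "finite B" "range P \<subseteq> span B" using fin by blast
  have "range (spectral_projection A z0) \<subseteq> cvs.span B"
  proof
    fix y assume "y \<in> range (spectral_projection A z0)"
    then have "Q y = 0" using proj by auto
    then have "y = P y" by (simp add: Q_def)
    then have "y \<in> span B" using B(2) by (metis rangeI subsetD)
    then show "y \<in> cvs.span B" using complex_span_superset by blast
  qed
  with B(1) show ?thesis
    unfolding algebraic_multiplicity_def cdimension_def by auto
qed

section \<open>Strongly continuous semigroups and their generators\<close>

lemma semigroup_bounded_clinear: "C0_semigroup T \<Longrightarrow> 0 \<le> t \<Longrightarrow> bounded_clinear (T t)"
  by (simp add: C0_semigroup_def)

lemma semigroup_zero: "C0_semigroup T \<Longrightarrow> T 0 x = x"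
  by (simp add: C0_semigroup_def)

lemma semigroup_add: "C0_semigroup T \<Longrightarrow> 0 \<le> s \<Longrightarrow> 0 \<le> t \<Longrightarrow> T (s + t) x = T s (T t x)"
  by (simp add: C0_semigroup_def)

lemma semigroup_tendsto: "C0_semigroup T \<Longrightarrow> ((\<lambda>t. T t x) \<longlongrightarrow> x) (at_right 0)"
  by (simp add: C0_semigroup_def)

lemma semigroup_commute:
  assumes "C0_semigroup T" "0 \<le> s" "0 \<le> t"
  shows "T s (T t x) = T t (T s x)"
  using semigroup_add[OF assms(1-3), of x] semigroup_add[OF assms(1,3,2), of x]
  by (simp add: add.commute)

text \<open>Otherwise the uniform boundedness principle fails for \<open>T t\<^sub>n\<close> with suitable \<open>t\<^sub>n\<close> tending to \<open>0\<close>.\<close>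

lemma semigroup_locally_bounded:
  fixes T :: "real \<Rightarrow> 'a::complex_banach \<Rightarrow> 'a"
  assumes T: "C0_semigroup T"
  obtains M \<delta> where "0 < \<delta>" "1 \<le> M" "\<And>t x. 0 \<le> t \<Longrightarrow> t \<le> \<delta> \<Longrightarrow> norm (T t x) \<le> M * norm x"
proof (rule ccontr)
  note found = that
  assume contra: "\<not> thesis"
  have "\<exists>t x. 0 \<le> t \<and> t \<le> inverse (real (Suc n)) \<and> real (Suc n) * norm x < norm (T t x)" for n
  proof (rule ccontr)
    assume "\<not> ?thesis"
    then have "\<And>t x. 0 \<le> t \<Longrightarrow> t \<le> inverse (real (Suc n)) \<Longrightarrow> norm (T t x) \<le> real (Suc n) * norm x"
      by (auto simp: not_less)
    with found[where \<delta> = "inverse (real (Suc n))" and M = "real (Suc n)"] contra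
    show False by (simp del: of_nat_Suc)
  qed
  then obtain t x where tx: "\<And>n. 0 \<le> t n" "\<And>n. t n \<le> inverse (real (Suc n))"
    "\<And>n. real (Suc n) * norm (x n) < norm (T (t n) (x n))" by metis
  have t0: "0 < t n" for n
  proof (rule ccontr)
    assume "\<not> 0 < t n"
    then have "t n = 0" using tx(1)[of n] by simp
    then have "real (Suc n) * norm (x n) < norm (x n)" using tx(3)[of n] semigroup_zero[OF T] by simp
    moreover have "1 * norm (x n) \<le> real (Suc n) * norm (x n)" by (rule mult_right_mono) simp_all
    ultimately show False by simp
  qed
  have "t \<longlonglongrightarrow> 0"
    using tx(1,2) by (intro tendsto_sandwich[OF _ _ tendsto_const LIMSEQ_inverse_real_of_nat]) auto
  then have t_lim: "filterlim t (at_right 0) sequentially"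
    using t0 by (simp add: filterlim_at less_imp_neq[symmetric])
  have "\<exists>c. \<forall>n. norm (T (t n) y) \<le> c" for y
  proof -
    have "(\<lambda>n. T (t n) y) \<longlonglongrightarrow> y"
      by (rule filterlim_compose[OF semigroup_tendsto[OF T] t_lim])
    then have "Bseq (\<lambda>n. T (t n) y)" by (intro convergent_imp_Bseq) (auto simp: convergent_def)
    then show ?thesis by (auto simp: Bseq_def)
  qed
  then obtain M where M: "\<And>n y. norm (T (t n) y) \<le> M * norm y"
    using uniform_boundedness[of "\<lambda>n. T (t n)", OF bounded_clinearD(1)[OF semigroup_bounded_clinear[OF T tx(1)]]]
    by blast
  obtain n where n: "M \<le> real n" using real_arch_simple by blast
  have "norm (T (t n) (x n)) \<le> real (Suc n) * norm (x n)"
    using M[of n "x n"] mult_right_mono[of M "real (Suc n)" "norm (x n)"] n by simp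
  with tx(3)[of n] show False by simp
qed

lemma semigroup_bounded_on_interval:
  fixes T :: "real \<Rightarrow> 'a::complex_banach \<Rightarrow> 'a"
  assumes T: "C0_semigroup T"
  obtains M where "0 < M" "\<And>t x. 0 \<le> t \<Longrightarrow> t \<le> b \<Longrightarrow> norm (T t x) \<le> M * norm x"
proof -
  obtain M \<delta> where M: "0 < \<delta>" "1 \<le> M" "\<And>t x. 0 \<le> t \<Longrightarrow> t \<le> \<delta> \<Longrightarrow> norm (T t x) \<le> M * norm x"
    by (rule semigroup_locally_bounded[OF T]) blast
  have bd: "norm (T t x) \<le> M ^ n * norm x" if "0 \<le> t" "t \<le> real n * \<delta>" for n t x
    using that
  proof (induction n arbitrary: t x)
    case 0
    then show ?case by (simp add: semigroup_zero[OF T])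
  next
    case (Suc n)
    show ?case
    proof (cases "t \<le> \<delta>")
      case True
      have "M * norm x \<le> M ^ Suc n * norm x"
        using M(2) self_le_power[of M "Suc n"] by (intro mult_right_mono) auto
      with M(3)[OF Suc.prems(1) True, of x] show ?thesis by simp
    next
      case False
      have "T t x = T \<delta> (T (t - \<delta>) x)"
        using semigroup_add[OF T, of \<delta> "t - \<delta>" x] M(1) False by simp
      then have "norm (T t x) \<le> M * norm (T (t - \<delta>) x)" using M by simp
      also have "\<dots> \<le> M * (M ^ n * norm x)"
        using Suc.prems False M(2) by (intro mult_left_mono Suc.IH) (simp_all add: algebra_simps)
      finally show ?thesis by simp
    qed
  qed
  obtain n where "b / \<delta> \<le> real n" using real_arch_simple by blast
  then have "b \<le> real n * \<delta>" using M(1) by (simp add: pos_divide_le_eq)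
  then show ?thesis using M(2) bd by (intro that[of "M ^ n"]) auto
qed

text \<open>Continuity from the left needs the local bound, since
  \<open>T s x - T (s + h) x = T s (x - T h x)\<close> with a varying operator \<open>T s\<close>.\<close>

lemma semigroup_continuous_on:
  fixes T :: "real \<Rightarrow> 'a::complex_banach \<Rightarrow> 'a"
  assumes T: "C0_semigroup T"
  shows "continuous_on {0..b} (\<lambda>t. T t x)"
  unfolding continuous_on_iff
proof (intro ballI allI impI)
  fix t e :: real assume t: "t \<in> {0..b}" and e: "0 < e"
  obtain M where M: "0 < M" "\<And>t x. 0 \<le> t \<Longrightarrow> t \<le> b \<Longrightarrow> norm (T t x) \<le> M * norm x"
    by (rule semigroup_bounded_on_interval[OF T, of b]) blast
  have "\<forall>\<^sub>F h in at_right 0. dist (T h x) x < e / M"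
    using semigroup_tendsto[OF T, of x] e M(1) by (intro tendstoD) auto
  then obtain d where d: "0 < d" "\<And>h. 0 < h \<Longrightarrow> h < d \<Longrightarrow> dist (T h x) x < e / M"
    by (auto simp: eventually_at_right_field)
  have step: "dist (T (s + h) x) (T s x) < e" if "0 \<le> s" "s \<le> b" "0 \<le> h" "h < d" for s h
  proof -
    have "dist (T h x) x < e / M"
      using d e M(1) that by (cases "h = 0") (auto simp: semigroup_zero[OF T])
    then have "M * norm (T h x - x) < e" using M(1) by (simp add: dist_norm pos_less_divide_eq mult.commute)
    moreover have "T (s + h) x - T s x = T s (T h x - x)"
      using semigroup_add[OF T] bounded_clinearD(4)[OF semigroup_bounded_clinear[OF T]] that by simp
    moreover have "norm (T s (T h x - x)) \<le> M * norm (T h x - x)" using M(2) that by blast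
    ultimately show ?thesis by (simp add: dist_norm)
  qed
  show "\<exists>d>0. \<forall>s\<in>{0..b}. dist s t < d \<longrightarrow> dist (T s x) (T t x) < e"
  proof (intro exI[of _ d] conjI ballI impI)
    fix s assume s: "s \<in> {0..b}" "dist s t < d"
    show "dist (T s x) (T t x) < e"
    proof (cases "t \<le> s")
      case True
      then show ?thesis using step[of t "s - t"] s t by (auto simp: dist_real_def)
    next
      case False
      then show ?thesis using step[of s "t - s"] s t by (auto simp: dist_real_def dist_commute)
    qed
  qed (fact d(1))
qed

lemma generatorI:
  assumes "((\<lambda>h. (T h x - x) /\<^sub>R h) \<longlongrightarrow> y) (at_right 0)"
  shows "x \<in> dom (generator T)" "the (generator T x) = y"
proof -
  have "Lim (at_right 0) (\<lambda>h. (T h x - x) /\<^sub>R h) = y"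
    using assms by (intro tendsto_Lim) simp_all
  with assms have "generator T x = Some y" by (auto simp: generator_def)
  then show "x \<in> dom (generator T)" "the (generator T x) = y" by auto
qed

lemma generatorD:
  assumes "x \<in> dom (generator T)"
  shows "((\<lambda>h. (T h x - x) /\<^sub>R h) \<longlongrightarrow> the (generator T x)) (at_right 0)"
proof -
  obtain y where y: "((\<lambda>h. (T h x - x) /\<^sub>R h) \<longlongrightarrow> y) (at_right 0)"
    using assms by (auto simp: generator_def dom_def split: if_splits)
  with generatorI(2)[of T x y, OF y] show ?thesis by simp
qed

lemma eventually_at_right_0_nonneg: "\<forall>\<^sub>F h in at_right (0::real). 0 \<le> h"
  by (auto simp: eventually_at_filter intro: always_eventually)

lemma generator_linear:
  assumes T: "C0_semigroup T"
  shows "x \<in> dom (generator T) \<Longrightarrow> y \<in> dom (generator T) \<Longrightarrow>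
      x + y \<in> dom (generator T) \<and> the (generator T (x + y)) = the (generator T x) + the (generator T y)"
    and "x \<in> dom (generator T) \<Longrightarrow>
      c *\<^sub>C x \<in> dom (generator T) \<and> the (generator T (c *\<^sub>C x)) = c *\<^sub>C the (generator T x)"
proof -
  note lin = bounded_clinearD[OF semigroup_bounded_clinear[OF T]]
  assume x: "x \<in> dom (generator T)"
  {
    assume y: "y \<in> dom (generator T)"
    have "((\<lambda>h. (T h (x + y) - (x + y)) /\<^sub>R h) \<longlongrightarrow> the (generator T x) + the (generator T y)) (at_right 0)"
    proof (rule Lim_transform_eventually[OF tendsto_add[OF generatorD[OF x] generatorD[OF y]]])
      show "\<forall>\<^sub>F h in at_right 0. (T h x - x) /\<^sub>R h + (T h y - y) /\<^sub>R h = (T h (x + y) - (x + y)) /\<^sub>R h"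
        using eventually_at_right_0_nonneg
        by eventually_elim (simp add: lin algebra_simps)
    qed
    from generatorI[of T, OF this] show "x + y \<in> dom (generator T) \<and> the (generator T (x + y)) = the (generator T x) + the (generator T y)"
      by simp
  }
  have "((\<lambda>h. (T h (c *\<^sub>C x) - c *\<^sub>C x) /\<^sub>R h) \<longlongrightarrow> c *\<^sub>C the (generator T x)) (at_right 0)"
  proof (rule Lim_transform_eventually[OF bounded_linear.tendsto[OF bounded_linear_scaleC generatorD[OF x]]])
    show "\<forall>\<^sub>F h in at_right 0. c *\<^sub>C ((T h x - x) /\<^sub>R h) = (T h (c *\<^sub>C x) - c *\<^sub>C x) /\<^sub>R h"
      using eventually_at_right_0_nonneg
      by eventually_elim (simp add: lin scaleC_scaleR_commute cvs.scale_right_diff_distrib)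
  qed
  from generatorI[of T, OF this]
  show "c *\<^sub>C x \<in> dom (generator T) \<and> the (generator T (c *\<^sub>C x)) = c *\<^sub>C the (generator T x)" by simp
qed

text \<open>The semigroup generated by \<open>A - z\<close>.\<close>

definition rescaled :: "(real \<Rightarrow> 'a::complex_normed_vector \<Rightarrow> 'a) \<Rightarrow> complex \<Rightarrow> real \<Rightarrow> 'a \<Rightarrow> 'a" where
  "rescaled T z t x = exp (- z * of_real t) *\<^sub>C T t x"

text \<open>The Laplace transform of the semigroup, truncated at \<open>\<tau>\<close>. Unlike the full transform it exists for all \<open>z\<close>,
  and it inverts \<open>z - A\<close> up to the operator \<open>rescaled T z \<tau>\<close>.\<close>

definition laplace_segment :: "(real \<Rightarrow> 'a::complex_banach \<Rightarrow> 'a) \<Rightarrow> complex \<Rightarrow> real \<Rightarrow> 'a \<Rightarrow> 'a" where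
  "laplace_segment T z \<tau> x = integral {0..\<tau>} (\<lambda>s. rescaled T z s x)"

lemma rescaled_continuous_on:
  assumes T: "C0_semigroup T"
  shows "continuous_on {0..b} (\<lambda>t. rescaled T z t x)"
proof -
  interpret sc: bounded_bilinear "scaleC :: complex \<Rightarrow> 'a \<Rightarrow> 'a" by (rule bounded_bilinear_scaleC)
  show ?thesis unfolding rescaled_def
    by (intro sc.continuous_on semigroup_continuous_on[OF T] continuous_intros)
qed

lemma rescaled_bounded_clinear: "C0_semigroup T \<Longrightarrow> 0 \<le> t \<Longrightarrow> bounded_clinear (rescaled T z t)"
  using bounded_clinear_scaleC[OF semigroup_bounded_clinear] by (simp add: rescaled_def[abs_def])

lemma laplace_segment_bounded_clinear:
  assumes T: "C0_semigroup T" and \<tau>: "0 \<le> \<tau>"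
  shows "bounded_clinear (laplace_segment T z \<tau>)"
proof -
  note lin = bounded_clinearD[OF rescaled_bounded_clinear[OF T]]
  have int: "(\<lambda>s. rescaled T z s x) integrable_on {0..\<tau>}" for x
    by (rule integrable_continuous_real[OF rescaled_continuous_on[OF T]])
  obtain M where M: "0 < M" "\<And>t x. 0 \<le> t \<Longrightarrow> t \<le> \<tau> \<Longrightarrow> norm (T t x) \<le> M * norm x"
    by (rule semigroup_bounded_on_interval[OF T, of \<tau>]) blast
  have "continuous_on {0..\<tau>} (\<lambda>t. norm (exp (- z * of_real t)))" by (intro continuous_intros)
  then have "bounded ((\<lambda>t. norm (exp (- z * of_real t))) ` {0..\<tau>})"
    by (intro compact_imp_bounded compact_continuous_image) auto
  then obtain C where "\<forall>y\<in>(\<lambda>t. norm (exp (- z * of_real t))) ` {0..\<tau>}. norm y \<le> C"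
    unfolding bounded_iff by blast
  then have C: "norm (exp (- z * of_real t)) \<le> C" if "t \<in> {0..\<tau>}" for t
    using that by (auto simp del: norm_exp_eq_Re)
  have C0: "0 \<le> C" using C[of 0] \<tau> norm_ge_zero order_trans by fastforce
  show ?thesis
  proof (rule bounded_clinearI)
    fix x y and c :: complex
    show "laplace_segment T z \<tau> (x + y) = laplace_segment T z \<tau> x + laplace_segment T z \<tau> y"
      unfolding laplace_segment_def integral_add[OF int int, symmetric]
      by (intro integral_cong) (simp add: lin)
    have "laplace_segment T z \<tau> (c *\<^sub>C x) = integral {0..\<tau>} ((\<lambda>y. c *\<^sub>C y) \<circ> (\<lambda>s. rescaled T z s x))"
      unfolding laplace_segment_def by (intro integral_cong) (simp add: lin)
    also have "\<dots> = c *\<^sub>C laplace_segment T z \<tau> x"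
      unfolding laplace_segment_def by (rule integral_linear[OF int bounded_linear_scaleC])
    finally show "laplace_segment T z \<tau> (c *\<^sub>C x) = c *\<^sub>C laplace_segment T z \<tau> x" .
    have "norm (laplace_segment T z \<tau> x) \<le> (C * (M * norm x)) * (\<tau> - 0)"
      unfolding laplace_segment_def
    proof (rule integral_bound[OF \<tau> rescaled_continuous_on[OF T]])
      fix t assume t: "t \<in> {0..\<tau>}"
      show "norm (rescaled T z t x) \<le> C * (M * norm x)"
        unfolding rescaled_def norm_scaleC using C[OF t] C0 M t by (intro mult_mono) auto
    qed
    then show "norm (laplace_segment T z \<tau> x) \<le> norm x * (C * M * \<tau>)" by (simp add: mult_ac)
  qed
qed

lemma laplace_segment_commute:
  assumes T: "C0_semigroup T" and \<tau>: "0 \<le> \<tau>" and h: "0 \<le> h"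
  shows "T h (laplace_segment T z \<tau> x) = laplace_segment T z \<tau> (T h x)"
proof -
  note Th = semigroup_bounded_clinear[OF T h]
  have int: "(\<lambda>s. rescaled T z s x) integrable_on {0..\<tau>}"
    by (rule integrable_continuous_real[OF rescaled_continuous_on[OF T]])
  have "T h (laplace_segment T z \<tau> x) = integral {0..\<tau>} (T h \<circ> (\<lambda>s. rescaled T z s x))"
    unfolding laplace_segment_def by (rule integral_linear[OF int bounded_clinearD(1)[OF Th], symmetric])
  also have "\<dots> = laplace_segment T z \<tau> (T h x)"
    unfolding laplace_segment_def
    by (intro integral_cong) (simp add: rescaled_def bounded_clinearD(2)[OF Th] semigroup_commute[OF T h])
  finally show ?thesis .
qed

text \<open>Applying the rescaled semigroup at time \<open>h\<close> shifts the interval of integration by \<open>h\<close>, so the difference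
  quotient consists of the averages over \<open>[\<tau>, \<tau> + h]\<close> and \<open>[0, h]\<close>.\<close>

lemma laplace_segment_generator:
  assumes T: "C0_semigroup T" and \<tau>: "0 \<le> \<tau>"
  shows "laplace_segment T z \<tau> x \<in> dom (generator T)"
    "z *\<^sub>C laplace_segment T z \<tau> x - the (generator T (laplace_segment T z \<tau> x)) = x - rescaled T z \<tau> x"
proof -
  interpret sc: bounded_bilinear "scaleC :: complex \<Rightarrow> 'a \<Rightarrow> 'a" by (rule bounded_bilinear_scaleC)
  define E where "E t = rescaled T z t" for t
  define \<Phi> where "\<Phi> u = integral {0..u} (\<lambda>s. E s x)" for u
  define V where "V = laplace_segment T z \<tau> x"
  have V: "V = \<Phi> \<tau>" by (simp add: V_def laplace_segment_def \<Phi>_def E_def)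
  have cont: "continuous_on {0..b} (\<lambda>s. E s x)" for b
    unfolding E_def by (rule rescaled_continuous_on[OF T])
  have int: "(\<lambda>s. E s x) integrable_on {0..b}" for b
    by (rule integrable_continuous_real[OF cont])
  have EE: "E h (E s x) = E (h + s) x" if "0 \<le> h" "0 \<le> s" for h s
    using that semigroup_add[OF T, of h s x]
    by (simp add: E_def rescaled_def bounded_clinearD(2)[OF semigroup_bounded_clinear[OF T]] scaleC_scaleC
        algebra_simps flip: exp_add)
  have EV: "E h V - V = (\<Phi> (\<tau> + h) - \<Phi> \<tau>) - (\<Phi> h - \<Phi> 0)" if h: "0 \<le> h" for h
  proof -
    have "E h V = integral {0..\<tau>} (E h \<circ> (\<lambda>s. E s x))"
      unfolding V \<Phi>_def E_def
      by (rule integral_linear[OF int[unfolded E_def] bounded_clinearD(1)[OF rescaled_bounded_clinear[OF T h]], symmetric])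
    also have "\<dots> = integral {0..\<tau>} ((\<lambda>s. E s x) \<circ> (+) h)"
      by (intro integral_cong) (simp add: EE h)
    also have "\<dots> = integral {h..\<tau> + h} (\<lambda>s. E s x)"
      using integral_shift_Icc_real[of 0 \<tau> "\<lambda>s. E s x" h] by simp
    also have "\<dots> = \<Phi> (\<tau> + h) - \<Phi> h"
      using Henstock_Kurzweil_Integration.integral_combine[OF h _ int, of "\<tau> + h"] \<tau>
      by (simp add: \<Phi>_def algebra_simps)
    finally show ?thesis by (simp add: V \<Phi>_def)
  qed
  have deriv: "((\<lambda>h. (\<Phi> (u + h) - \<Phi> u) /\<^sub>R h) \<longlongrightarrow> E u x) (at_right 0)" if u: "0 \<le> u" "u \<le> \<tau>" for u
  proof -
    have "(\<Phi> has_vector_derivative E u x) (at u within {0..\<tau> + 1})"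
      unfolding \<Phi>_def using u by (intro integral_has_vector_derivative cont) auto
    then have "((\<lambda>s. (\<Phi> s - \<Phi> u) /\<^sub>R (s - u)) \<longlongrightarrow> E u x) (at u within {0..\<tau> + 1})"
      by (simp add: has_vector_derivative_iff_quotient)
    moreover have "filterlim (\<lambda>h. u + h) (at u within {0..\<tau> + 1}) (at_right 0)"
    proof -
      have "((\<lambda>h. u + h) \<longlongrightarrow> u + 0) (at_right 0)" by (intro tendsto_intros)
      moreover have "\<forall>\<^sub>F h in at_right (0::real). h \<in> {0<..<1}"
        by (rule eventually_at_right_real) simp
      then have "\<forall>\<^sub>F h in at_right 0. u + h \<in> {0..\<tau> + 1} \<and> u + h \<noteq> u"
        by eventually_elim (use u in auto)
      ultimately show ?thesis by (simp add: filterlim_at)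
    qed
    ultimately have "((\<lambda>h. (\<Phi> (u + h) - \<Phi> u) /\<^sub>R (u + h - u)) \<longlongrightarrow> E u x) (at_right 0)"
      by (rule filterlim_compose)
    then show ?thesis by simp
  qed
  have "((\<lambda>h. (\<Phi> (\<tau> + h) - \<Phi> \<tau>) /\<^sub>R h - (\<Phi> (0 + h) - \<Phi> 0) /\<^sub>R h) \<longlongrightarrow> E \<tau> x - E 0 x) (at_right 0)"
    using \<tau> by (intro tendsto_diff deriv) auto
  then have EVlim: "((\<lambda>h. (E h V - V) /\<^sub>R h) \<longlongrightarrow> E \<tau> x - x) (at_right 0)"
  proof (rule Lim_transform_eventually[THEN tendsto_eq_rhs])
    show "\<forall>\<^sub>F h in at_right 0. (\<Phi> (\<tau> + h) - \<Phi> \<tau>) /\<^sub>R h - (\<Phi> (0 + h) - \<Phi> 0) /\<^sub>R h = (E h V - V) /\<^sub>R h"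
      using eventually_at_right_0_nonneg
      by eventually_elim (simp add: EV scaleR_right_diff_distrib)
    show "E \<tau> x - E 0 x = E \<tau> x - x" by (simp add: E_def rescaled_def semigroup_zero[OF T])
  qed
  \<comment> \<open>Passing from the rescaled semigroup back to \<open>T\<close> contributes the derivative of the exponential factor.\<close>
  have ed: "((\<lambda>h. exp (z * of_real h)) has_vector_derivative z) (at 0 within {0<..})"
    by (rule has_vector_derivative_real_field) (auto intro!: derivative_eq_intros)
  have "((\<lambda>h. exp (z * of_real h)) \<longlongrightarrow> exp (z * of_real 0)) (at_right 0)"
    by (intro tendsto_intros)
  then have exp1: "((\<lambda>h. exp (z * of_real h)) \<longlongrightarrow> 1) (at_right 0)" by simp
  have "((\<lambda>h. exp (z * of_real h) *\<^sub>C ((E h V - V) /\<^sub>R h) + ((exp (z * of_real h) - 1) /\<^sub>R h) *\<^sub>C V)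
      \<longlongrightarrow> 1 *\<^sub>C (E \<tau> x - x) + z *\<^sub>C V) (at_right 0)"
    using ed unfolding has_vector_derivative_iff_quotient
    by (intro tendsto_add sc.tendsto exp1 EVlim tendsto_const) simp
  then have "((\<lambda>h. (T h V - V) /\<^sub>R h) \<longlongrightarrow> 1 *\<^sub>C (E \<tau> x - x) + z *\<^sub>C V) (at_right 0)"
  proof (rule Lim_transform_eventually)
    have "exp (z * of_real h) *\<^sub>C ((E h V - V) /\<^sub>R h) + ((exp (z * of_real h) - 1) /\<^sub>R h) *\<^sub>C V
        = (T h V - V) /\<^sub>R h" for h
    proof -
      have "exp (z * of_real h) *\<^sub>C E h V = T h V"
        by (simp add: E_def rescaled_def scaleC_scaleC flip: exp_add)
      then have "exp (z * of_real h) *\<^sub>C (E h V - V) + (exp (z * of_real h) - 1) *\<^sub>C V = T h V - V"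
        by (simp add: cvs.scale_right_diff_distrib cvs.scale_left_diff_distrib)
      then have "(exp (z * of_real h) *\<^sub>C (E h V - V) + (exp (z * of_real h) - 1) *\<^sub>C V) /\<^sub>R h = (T h V - V) /\<^sub>R h"
        by simp
      then show ?thesis by (simp only: scaleR_add_right scaleC_scaleR_commute sc.scaleR_left)
    qed
    then show "\<forall>\<^sub>F h in at_right 0. exp (z * of_real h) *\<^sub>C ((E h V - V) /\<^sub>R h)
        + ((exp (z * of_real h) - 1) /\<^sub>R h) *\<^sub>C V = (T h V - V) /\<^sub>R h" by simp
  qed
  from generatorI[of T, OF this]
  show "laplace_segment T z \<tau> x \<in> dom (generator T)"
    "z *\<^sub>C laplace_segment T z \<tau> x - the (generator T (laplace_segment T z \<tau> x)) = x - rescaled T z \<tau> x"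
    by (simp_all add: V_def E_def)
qed

text \<open>The integral commutes with the semigroup, hence with the generator.\<close>

lemma laplace_segment_generator_left:
  assumes T: "C0_semigroup T" and \<tau>: "0 \<le> \<tau>" and x: "x \<in> dom (generator T)"
  shows "laplace_segment T z \<tau> (z *\<^sub>C x - the (generator T x)) = x - rescaled T z \<tau> x"
proof -
  define V where "V = laplace_segment T z \<tau>"
  have V: "bounded_clinear V" unfolding V_def by (rule laplace_segment_bounded_clinear[OF T \<tau>])
  have "((\<lambda>h. (T h (V x) - V x) /\<^sub>R h) \<longlongrightarrow> V (the (generator T x))) (at_right 0)"
  proof (rule Lim_transform_eventually[OF bounded_linear.tendsto[OF bounded_clinearD(1)[OF V] generatorD[OF x]]])
    show "\<forall>\<^sub>F h in at_right 0. V ((T h x - x) /\<^sub>R h) = (T h (V x) - V x) /\<^sub>R h"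
      using eventually_at_right_0_nonneg
      by eventually_elim
        (simp add: V_def laplace_segment_commute[OF T \<tau>] bounded_clinearD(4)[OF V[unfolded V_def]]
          linear_simps(5)[OF bounded_clinearD(1)[OF V[unfolded V_def]]])
  qed
  from generatorI(2)[of T, OF this] have "the (generator T (V x)) = V (the (generator T x))" .
  then show ?thesis
    using laplace_segment_generator(2)[OF T \<tau>, of z x]
    by (simp add: bounded_clinearD(2,4)[OF V] flip: V_def)
qed

lemma compact_operator_scaleC:
  assumes K: "compact_operator K"
  shows "compact_operator (\<lambda>x. c *\<^sub>C K x)"
proof -
  have Kc: "bounded_clinear K" and cpt: "compact (closure (K ` cball 0 1))"
    using K by (auto simp: compact_operator_def)
  define M where "M = (\<lambda>y. c *\<^sub>C y) ` closure (K ` cball 0 1)"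
  have M: "compact M"
    unfolding M_def by (intro compact_continuous_image cpt linear_continuous_on bounded_linear_scaleC)
  have "(\<lambda>x. c *\<^sub>C K x) ` cball 0 1 \<subseteq> M"
    using closure_subset[of "K ` cball 0 1"] by (auto simp: M_def)
  then have sub: "closure ((\<lambda>x. c *\<^sub>C K x) ` cball 0 1) \<subseteq> M"
    by (rule closure_minimal[OF _ compact_imp_closed[OF M]])
  have "compact (closure ((\<lambda>x. c *\<^sub>C K x) ` cball 0 1))"
    using compact_Int_closed[OF M closed_closure, of "(\<lambda>x. c *\<^sub>C K x) ` cball 0 1"]
    by (simp only: Int_absorb1[OF sub])
  with bounded_clinear_scaleC[OF Kc] show ?thesis by (simp add: compact_operator_def)
qed

lemma semigroup_right_parametrix:
  assumes T: "C0_semigroup T" and \<tau>: "0 \<le> \<tau>" and K: "compact_operator (T \<tau>)"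
  shows "right_parametrix (generator T) z (laplace_segment T z \<tau>) (rescaled T z \<tau>)"
  unfolding right_parametrix_def
  using laplace_segment_bounded_clinear[OF T \<tau>] compact_operator_scaleC[OF K]
    laplace_segment_generator[OF T \<tau>] laplace_segment_generator_left[OF T \<tau>]
  by (simp add: rescaled_def[abs_def])

text \<open>For \<open>\<omega> = ln (2 M)\<close>, where \<open>M\<close> bounds \<open>T 1\<close>, the operator \<open>rescaled T \<omega> 1\<close> has norm at most \<open>1/2\<close>, so that \<open>I\<close> minus this operator is
  inverted by a Neumann series.\<close>

lemma generator_resolvent_set_nonempty:
  fixes T :: "real \<Rightarrow> 'a::complex_banach \<Rightarrow> 'a"
  assumes T: "C0_semigroup T"
  shows "resolvent_set (generator T) \<noteq> {}"
proof -
  have T1: "bounded_clinear (T 1)" by (rule semigroup_bounded_clinear[OF T]) simp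
  obtain M where M: "0 < M" "\<And>x. norm (T 1 x) \<le> M * norm x" using bounded_clinear_bound[OF T1] by blast
  define a where "a = ln (2 * M)"
  define \<omega> where "\<omega> = complex_of_real a"
  define V where "V = laplace_segment T \<omega> 1"
  define K where "K = rescaled T \<omega> 1"
  have V: "bounded_clinear V" unfolding V_def by (rule laplace_segment_bounded_clinear[OF T]) simp
  have K: "bounded_clinear K" unfolding K_def by (rule rescaled_bounded_clinear[OF T]) simp
  have VA: "V x \<in> dom (generator T)" "\<omega> *\<^sub>C V x - the (generator T (V x)) = x - K x" for x
    unfolding V_def K_def using laplace_segment_generator[OF T, of 1] by auto
  have AV: "V (\<omega> *\<^sub>C x - the (generator T x)) = x - K x" if "x \<in> dom (generator T)" for x
    unfolding V_def K_def using laplace_segment_generator_left[OF T _ that, of 1] by auto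
  have Kbd: "norm (K x) \<le> 1/2 * norm x" for x
  proof -
    have "cmod (exp (- \<omega> * of_real 1)) = 1 / (2 * M)"
    proof -
      have "cmod (exp (- \<omega> * of_real 1)) = exp (- a)" by (simp add: \<omega>_def)
      then show ?thesis using M(1) by (simp add: a_def exp_minus inverse_eq_divide)
    qed
    then have "norm (K x) = 1 / (2 * M) * norm (T 1 x)" by (simp only: K_def rescaled_def norm_scaleC)
    also have "\<dots> \<le> 1 / (2 * M) * (M * norm x)" using M by (intro mult_left_mono) auto
    finally show ?thesis using M(1) by simp
  qed
  have KV: "V (K x) = K (V x)" for x
    unfolding V_def K_def rescaled_def
    using laplace_segment_commute[OF T, of 1 1 \<omega> x]
    by (simp add: bounded_clinearD(2)[OF V[unfolded V_def]])
  obtain X where X: "bounded_clinear X" "\<And>x. X x = x + K (X x)"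
    "\<And>Y x. bounded_linear Y \<Longrightarrow> (\<And>y. Y (K y) = K (Y y)) \<Longrightarrow> Y (X x) = X (Y x)"
    by (rule neumann_series[OF K _ _ Kbd]) auto
  have VX: "V (X x) = X (V x)" for x by (rule X(3)[OF bounded_clinearD(1)[OF V] KV])
  have KX: "K (X x) = X (K x)" for x by (rule X(3)[OF bounded_clinearD(1)[OF K]]) simp
  have "\<omega> \<in> resolvent_set (generator T)"
  proof (rule resolvent_setI[OF bounded_clinear_compose[OF V X(1)]])
    fix x
    show "V (X x) \<in> dom (generator T)" by (rule VA)
    have "X x - K (X x) = x" using X(2)[of x] by (metis add_diff_cancel_right')
    then show "\<omega> *\<^sub>C V (X x) - the (generator T (V (X x))) = x" by (simp only: VA(2))
    assume x: "x \<in> dom (generator T)"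
    have "V (X (\<omega> *\<^sub>C x - the (generator T x))) = X (x - K x)"
      by (simp only: VX AV[OF x])
    also have "\<dots> = X x - X (K x)" by (rule bounded_clinearD(4)[OF X(1)])
    also have "\<dots> = x" using X(2)[of x] KX by (metis add_diff_cancel_right')
    finally show "V (X (\<omega> *\<^sub>C x - the (generator T x))) = x" .
  qed
  then show ?thesis by blast
qed

section \<open>Spectrum of a semigroup with a compact operator\<close>

lemma eigenvalue_in_spectrum:
  assumes x: "x \<in> dom A" "x \<noteq> 0" "the (A x) = z *\<^sub>C x"
  shows "z \<in> spectrum A"
proof (rule ccontr)
  assume "z \<notin> spectrum A"
  then have z: "z \<in> resolvent_set A" by (simp add: spectrum_def)
  have "resolvent A z (z *\<^sub>C x - the (A x)) = x" by (rule resolventD(4)[OF z x(1)])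
  then have "resolvent A z 0 = x" by (simp add: x(3))
  with x(2) show False by (simp add: bounded_clinearD(5)[OF resolventD(1)[OF z]])
qed

lemma compact_semigroup_spectral_decomposition:
  fixes T :: "real \<Rightarrow> 'a::complex_banach \<Rightarrow> 'a"
  assumes T: "C0_semigroup T" and \<tau>: "0 \<le> \<tau>" and K: "compact_operator (T \<tau>)"
    and \<omega>: "\<omega> \<in> resolvent_set (generator T)" and z: "z \<in> spectrum (generator T)"
  obtains P D S where "spectral_decomposition (generator T) \<omega> z P D S"
  using spectral_decomposition_exists[OF \<omega> z semigroup_right_parametrix[OF T \<tau> K]] .

lemma resolvent_pole_isolated:
  assumes "resolvent_pole A z"
  shows "\<exists>r>0. ball z r - {z} \<subseteq> resolvent_set A"
proof -
  obtain n where "resolvent_pole_of_order n A z" using assms by (auto simp: resolvent_pole_def)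
  then obtain r where "0 < r" "\<forall>w\<in>ball z r - {z}. w \<in> resolvent_set A"
    unfolding resolvent_pole_of_order_def by (elim conjE exE) simp
  then show ?thesis by blast
qed

lemma compact_semigroup_spectrum:
  fixes T :: "real \<Rightarrow> 'a::complex_banach \<Rightarrow> 'a"
  assumes T: "C0_semigroup T" and \<tau>: "0 \<le> \<tau>" and K: "compact_operator (T \<tau>)"
    and z: "z \<in> spectrum (generator T)"
  shows "resolvent_pole (generator T) z" "algebraic_multiplicity (generator T) z < \<infinity>"
    "\<exists>x\<in>dom (generator T). x \<noteq> 0 \<and> the (generator T x) = z *\<^sub>C x"
proof -
  obtain \<omega> where \<omega>: "\<omega> \<in> resolvent_set (generator T)"
    using generator_resolvent_set_nonempty[OF T] by blast
  obtain P D S where dec: "spectral_decomposition (generator T) \<omega> z P D S"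
    by (rule compact_semigroup_spectral_decomposition[OF T \<tau> K \<omega> z])
  show pole: "resolvent_pole (generator T) z"
    by (rule spectral_decomposition_imp_pole[OF \<omega> dec generator_linear[OF T]])
  show "algebraic_multiplicity (generator T) z < \<infinity>"
    by (rule spectral_decomposition_imp_finite_multiplicity[OF \<omega> dec resolvent_pole_isolated[OF pole]])
  show "\<exists>x\<in>dom (generator T). x \<noteq> 0 \<and> the (generator T x) = z *\<^sub>C x"
    by (rule spectral_decomposition_imp_eigenvector[OF dec]) blast
qed

text \<open>Unit eigenvectors \<open>x\<^sub>n\<close> for distinct spectral values \<open>z\<^sub>n\<close> in the half-plane satisfy
  \<open>x\<^sub>n = e\<^sup>-\<^sup>z\<^sup>\<tau> T \<tau> x\<^sub>n\<close> with \<open>z = z\<^sub>n\<close> and bounded factors, so a subsequence converges to a unit vector \<open>b\<close>. From the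
  resolvent \<open>R\<close> at \<open>\<omega>\<close>, which divides \<open>x\<^sub>n\<close> by \<open>\<omega> - z\<^sub>n\<close>, one sees that the \<open>z\<^sub>n\<close> stay bounded, as \<open>R b \<noteq> 0\<close>. They
  accumulate at an eigenvalue, which contradicts the isolation of spectral values.\<close>

theorem compact_semigroup_spectrum_half_plane_finite:
  fixes T :: "real \<Rightarrow> 'a::complex_banach \<Rightarrow> 'a"
  assumes T: "C0_semigroup T" and \<tau>: "0 \<le> \<tau>" and K: "compact_operator (T \<tau>)"
  shows "finite {z \<in> spectrum (generator T). a \<le> Re z}"
proof (rule ccontr)
  interpret sc: bounded_bilinear "scaleC :: complex \<Rightarrow> 'a \<Rightarrow> 'a" by (rule bounded_bilinear_scaleC)
  let ?A = "generator T"
  assume "infinite {z \<in> spectrum ?A. a \<le> Re z}"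
  then obtain z :: "nat \<Rightarrow> complex" where z: "inj z" "range z \<subseteq> {z \<in> spectrum ?A. a \<le> Re z}"
    using infinite_countable_subset by blast
  have z\<sigma>: "z n \<in> spectrum ?A" and za: "a \<le> Re (z n)" for n using z(2) by auto
  obtain \<omega> where \<omega>: "\<omega> \<in> resolvent_set ?A"
    using generator_resolvent_set_nonempty[OF T] by blast
  define R where "R = resolvent ?A \<omega>"
  have R: "bounded_clinear R" unfolding R_def by (rule resolventD(1)[OF \<omega>])
  have "\<exists>x. x \<in> dom ?A \<and> norm x = 1 \<and> the (?A x) = z n *\<^sub>C x" for n
  proof -
    obtain x where x: "x \<in> dom ?A" "x \<noteq> 0" "the (?A x) = z n *\<^sub>C x"
      using compact_semigroup_spectrum(3)[OF T \<tau> K z\<sigma>] by blast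
    let ?c = "complex_of_real (1 / norm x)"
    have "?c *\<^sub>C x \<in> dom ?A" "the (?A (?c *\<^sub>C x)) = z n *\<^sub>C (?c *\<^sub>C x)"
      using generator_linear(2)[OF T x(1), of ?c] by (simp_all add: x(3) scaleC_scaleC mult.commute)
    moreover have "norm (?c *\<^sub>C x) = 1" using x(2) by (simp add: norm_scaleC norm_divide)
    ultimately show ?thesis by blast
  qed
  then obtain x where x: "\<And>n. x n \<in> dom ?A" "\<And>n. norm (x n) = 1" "\<And>n. the (?A (x n)) = z n *\<^sub>C x n"
    by metis
  have xK: "x n = exp (- z n * of_real \<tau>) *\<^sub>C T \<tau> (x n)" for n
  proof -
    have "laplace_segment T (z n) \<tau> (z n *\<^sub>C x n - the (?A (x n))) = x n - rescaled T (z n) \<tau> (x n)"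
      by (rule laplace_segment_generator_left[OF T \<tau> x(1)])
    then show ?thesis
      by (simp add: x(3) bounded_clinearD(5)[OF laplace_segment_bounded_clinear[OF T \<tau>]] rescaled_def)
  qed
  have xR: "x n = (\<omega> - z n) *\<^sub>C R (x n)" for n
  proof -
    have "R (\<omega> *\<^sub>C x n - z n *\<^sub>C x n) = x n"
      using resolventD(4)[OF \<omega> x(1)[of n]] by (simp add: x(3) R_def)
    then show ?thesis by (simp add: bounded_clinearD(2)[OF R] flip: cvs.scale_left_diff_distrib)
  qed
  obtain y r where r: "strict_mono (r :: nat \<Rightarrow> nat)" "(\<lambda>n. T \<tau> (x (r n))) \<longlonglongrightarrow> y"
    by (rule compact_mapD[OF compact_operator_imp_compact_map[OF K], of x 1]) (auto simp: x(2))
  have "bounded (range (\<lambda>n. exp (- z (r n) * of_real \<tau>)))"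
  proof (rule boundedI)
    fix e assume "e \<in> range (\<lambda>n. exp (- z (r n) * of_real \<tau>))"
    then obtain n where "e = exp (- z (r n) * of_real \<tau>)" by blast
    then have "norm e = exp (- (Re (z (r n)) * \<tau>))" by simp
    also have "\<dots> \<le> exp (- (a * \<tau>))" using za[of "r n"] \<tau> by (simp add: mult_right_mono)
    finally show "norm e \<le> exp (- (a * \<tau>))" .
  qed
  then obtain c s where s: "strict_mono (s :: nat \<Rightarrow> nat)"
    "((\<lambda>n. exp (- z (r n) * of_real \<tau>)) \<circ> s) \<longlonglongrightarrow> c"
    using bounded_imp_convergent_subsequence by metis
  define q where "q n = r (s n)" for n
  have q: "strict_mono q" using strict_mono_o[OF r(1) s(1)] by (simp add: q_def[abs_def] o_def)
  define b where "b = c *\<^sub>C y"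
  have "(\<lambda>n. exp (- z (q n) * of_real \<tau>) *\<^sub>C T \<tau> (x (q n))) \<longlonglongrightarrow> b"
    unfolding b_def q_def
    using sc.tendsto[OF s(2) LIMSEQ_subseq_LIMSEQ[OF r(2) s(1)]] by (simp add: o_def)
  then have xb: "(\<lambda>n. x (q n)) \<longlonglongrightarrow> b" by (simp only: xK[symmetric])
  have "norm b = 1" using tendsto_norm[OF xb] by (simp add: x(2) LIMSEQ_const_iff)
  have Rb: "(\<lambda>n. R (x (q n))) \<longlonglongrightarrow> R b"
    by (rule bounded_linear.tendsto[OF bounded_clinearD(1)[OF R] xb])
  have "R b \<noteq> 0"
  proof
    assume "R b = 0"
    then have "0 \<in> dom ?A" and b: "b = - the (?A 0)"
      using resolventD(2,3)[OF \<omega>, of b] by (simp_all add: R_def)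
    from generator_linear(2)[OF T this(1), of 0] have "the (?A 0) = 0" by simp
    with b \<open>norm b = 1\<close> show False by simp
  qed
  have Rn: "norm (R (x n)) * cmod (\<omega> - z n) = 1" for n
  proof -
    have "norm (x n) = norm ((\<omega> - z n) *\<^sub>C R (x n))" using xR by simp
    then show ?thesis by (simp add: x(2) norm_scaleC mult.commute)
  qed
  define \<nu> where "\<nu> = norm (R b)"
  have \<nu>: "0 < \<nu>" using \<open>R b \<noteq> 0\<close> by (simp add: \<nu>_def)
  have "(\<lambda>n. inverse (norm (R (x (q n))))) \<longlonglongrightarrow> inverse \<nu>"
    using tendsto_inverse[OF tendsto_norm[OF Rb]] \<open>R b \<noteq> 0\<close> by (simp add: \<nu>_def)
  moreover have "inverse (norm (R (x n))) = cmod (\<omega> - z n)" for n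
    using Rn[of n] by (metis inverse_unique)
  ultimately have \<omega>z: "(\<lambda>n. cmod (\<omega> - z (q n))) \<longlonglongrightarrow> inverse \<nu>" by simp
  then have "Bseq (\<lambda>n. \<omega> - z (q n))"
    using convergent_imp_Bseq[of "\<lambda>n. cmod (\<omega> - z (q n))"] by (auto simp: convergent_def Bseq_def)
  then have "bounded (range (\<lambda>n. \<omega> - z (q n)))" by (simp add: Bseq_eq_bounded)
  then obtain d p where p: "strict_mono (p :: nat \<Rightarrow> nat)" "((\<lambda>n. \<omega> - z (q n)) \<circ> p) \<longlonglongrightarrow> d"
    using bounded_imp_convergent_subsequence by metis
  define \<zeta> where "\<zeta> = \<omega> - d"
  have "(\<lambda>n. \<omega> - (\<omega> - z (q (p n)))) \<longlonglongrightarrow> \<zeta>"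
    unfolding \<zeta>_def using p(2) by (intro tendsto_diff tendsto_const) (simp add: o_def)
  then have z\<zeta>: "(\<lambda>n. z (q (p n))) \<longlonglongrightarrow> \<zeta>" by simp
  have "(\<lambda>n. (\<omega> - z (q (p n))) *\<^sub>C R (x (q (p n)))) \<longlonglongrightarrow> d *\<^sub>C R b"
    using sc.tendsto[OF p(2) LIMSEQ_subseq_LIMSEQ[OF Rb p(1)]] by (simp add: o_def)
  then have "(\<lambda>n. x (q (p n))) \<longlonglongrightarrow> d *\<^sub>C R b" by (simp only: xR[symmetric])
  moreover have "(\<lambda>n. x (q (p n))) \<longlonglongrightarrow> b"
    using LIMSEQ_subseq_LIMSEQ[OF xb p(1)] by (simp add: o_def)
  ultimately have b: "d *\<^sub>C R b = b" by (rule LIMSEQ_unique)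
  have "\<zeta> \<in> spectrum ?A"
  proof (rule eigenvalue_in_spectrum)
    show "R b \<in> dom ?A" unfolding R_def by (rule resolventD(2)[OF \<omega>])
    have "the (?A (R b)) = \<omega> *\<^sub>C R b - b"
      using resolventD(3)[OF \<omega>, of b] by (simp add: R_def algebra_simps)
    also have "\<dots> = \<omega> *\<^sub>C R b - d *\<^sub>C R b" by (simp only: b)
    finally show "the (?A (R b)) = \<zeta> *\<^sub>C R b" by (simp add: \<zeta>_def cvs.scale_left_diff_distrib)
  qed (fact \<open>R b \<noteq> 0\<close>)
  then obtain \<rho> where \<rho>: "0 < \<rho>" "ball \<zeta> \<rho> - {\<zeta>} \<subseteq> resolvent_set ?A"
    using resolvent_pole_isolated[OF compact_semigroup_spectrum(1)[OF T \<tau> K]] by blast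
  obtain N where N: "\<And>n. N \<le> n \<Longrightarrow> dist (z (q (p n))) \<zeta> < \<rho>"
    using z\<zeta> \<rho>(1) unfolding lim_sequentially by blast
  have "z (q (p n)) = \<zeta>" if "N \<le> n" for n
  proof (rule ccontr)
    assume "z (q (p n)) \<noteq> \<zeta>"
    then have "z (q (p n)) \<in> resolvent_set ?A" using N[OF that] \<rho>(2) by (auto simp: dist_commute)
    with z\<sigma>[of "q (p n)"] show False by (simp add: spectrum_def)
  qed
  from this[of N] this[of "Suc N"] have "z (q (p N)) = z (q (p (Suc N)))" by simp
  then have "q (p N) = q (p (Suc N))" by (rule injD[OF z(1)])
  moreover have "q (p N) < q (p (Suc N))"
    using q p(1) by (simp add: strict_mono_def)
  ultimately show False by simp
qed

text \<open>All peripheral spectral values have the same real part.\<close>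

theorem compact_semigroup_peripheral_spectrum_finite:
  fixes T :: "real \<Rightarrow> 'a::complex_banach \<Rightarrow> 'a"
  assumes T: "C0_semigroup T" and \<tau>: "0 \<le> \<tau>" and K: "compact_operator (T \<tau>)"
  shows "finite (peripheral_spectrum (generator T))"
proof (cases "peripheral_spectrum (generator T) = {}")
  case False
  then obtain z where z: "z \<in> peripheral_spectrum (generator T)" by blast
  have "Re w = Re z" if "w \<in> peripheral_spectrum (generator T)" for w
  proof -
    have "ereal (Re w) = ereal (Re z)" using that z by (simp add: peripheral_spectrum_def)
    then show ?thesis by simp
  qed
  then have "peripheral_spectrum (generator T) \<subseteq> {w \<in> spectrum (generator T). Re z \<le> Re w}"
    by (auto simp: peripheral_spectrum_def)
  then show ?thesis
    using compact_semigroup_spectrum_half_plane_finite[OF T \<tau> K] by (rule finite_subset)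
qed simp

theorem corollary2p5:
  fixes T :: "real \<Rightarrow> 'a::order_continuous_banach_lattice complexification \<Rightarrow> 'a complexification"
    and A :: "'a complexification operator"
    and u :: 'a and t0 :: real
  assumes "0 \<le> u"
    and "C0_semigroup T"
    and "A = generator T"
    and "0 \<le> t0"
    and "range (T t0) \<subseteq> principal_ideal u"
  shows "eventually_compact T
    \<and> (\<forall>z\<in>spectrum A. resolvent_pole A z \<and> algebraic_multiplicity A z < \<infinity>)
    \<and> finite (peripheral_spectrum A)"
proof -
  have "T (t0 + t0) = T t0 \<circ> T t0"
    by (rule ext) (simp only: o_apply semigroup_add[OF assms(2,4,4)])
  then have K: "compact_operator (T (t0 + t0))"
    using ideal_valued_square_compact[OF semigroup_bounded_clinear[OF assms(2,4)] assms(1,5)] by (simp only:)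
  have \<tau>: "0 \<le> t0 + t0" using assms(4) by simp
  from \<tau> K have "eventually_compact T" unfolding eventually_compact_def by blast
  moreover have "resolvent_pole A z \<and> algebraic_multiplicity A z < \<infinity>" if "z \<in> spectrum A" for z
    using compact_semigroup_spectrum(1,2)[OF assms(2) \<tau> K, of z] that unfolding assms(3) by blast
  moreover have "finite (peripheral_spectrum A)"
    unfolding assms(3) by (rule compact_semigroup_peripheral_spectrum_finite[OF assms(2) \<tau> K])
  ultimately show ?thesis by blast
qed

end
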